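(* The Riemann hypothesis holds if and only if there exists a Polya frequency function $\Lambda$ such that $$\frac{1}{\Xi(s)} = \int_{-\infty}^{\infty} \Lambda(x)\, e^{-sx}\, dx \qquad \text{for all } s \in \mathbb{C} \text{ with } |\mathrm{Re}\, s| < t_0,$$ where $\tfrac12 + i t_0$ ($t_0>0$) is the first zero of the Riemann zeta function on the critical line.
   Context: A measurable function $\Lambda:\mathbb{R}\to\mathbb{R}$ is called totally positive if for every $n\in\mathbb{N}$ and all real numbers $x_1<x_2<\dots<x_n$ and $y_1<y_2<\dots<y_n$ one has $\det\big(\Lambda(x_j-y_k)\big)_{j,k=1,\dots,n}\ge 0$. A totally positive function that is moreover integrable on $\mathbb{R}$ is called a Polya frequency function. Let $\zeta$ be the Riemann zeta function (defined by $\zeta(s)=\sum_{n\ge1}n^{-s}$ for $\mathrm{Re}\,s>1$ and meromorphically continued), let $\xi(s)=\tfrac12 s(s-1)\pi^{-s/2}\Gamma(s/2)\zeta(s)$ be the Riemann xi-function (an entire function), and let $\Xi(s)=\xi(\tfrac12+is)$. The Riemann hypothesis is the assertion that all non-trivial zeros of $\zeta$ lie on the critical line $\{\tfrac12+it: t\in\mathbb{R}\}$, equivalently that $\Xi$ has only real zeros. "The first zero on the critical line" means the zero $\tfrac12+it$ with the smallest positive $t$. *)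

theory Defs
  imports "HOL-Complex_Analysis.Complex_Analysis" "Jordan_Normal_Form.Determinant"
begin

(* Matrices of size n x n with n a term: det and mat are those of Jordan_Normal_Form,
   not the type-indexed ones of HOL-Analysis. *)
definition totally_positive :: "(real \<Rightarrow> real) \<Rightarrow> bool" where
  "totally_positive \<Lambda> \<longleftrightarrow>
     \<Lambda> \<in> borel_measurable lebesgue \<and>
     (\<forall>n\<ge>1. \<forall>x y :: nat \<Rightarrow> real.
        strict_mono_on {..<n} x \<longrightarrow> strict_mono_on {..<n} y \<longrightarrow>
        0 \<le> Determinant.det (Matrix.mat n n (\<lambda>(j, k). \<Lambda> (x j - y k))))"

definition polya_frequency_function :: "(real \<Rightarrow> real) \<Rightarrow> bool" where
  "polya_frequency_function \<Lambda> \<longleftrightarrow> totally_positive \<Lambda> \<and> integrable lebesgue \<Lambda>"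

(* The meromorphic continuation of the Dirichlet series. A nicely meromorphic function is
   continuous off its poles and 0 at its poles, so its values are determined everywhere;
   in particular zeta 1 = 0 is a convention, not a zero. *)
definition zeta :: "complex \<Rightarrow> complex" where
  "zeta = (THE f. f nicely_meromorphic_on UNIV \<and>
             (\<forall>s. Re s > 1 \<longrightarrow> (\<lambda>n. 1 / of_nat (Suc n) powr s) sums f s))"

(* The product has removable singularities at 1 (pole of zeta) and at 0, -2, -4, ...
   (poles of Gamma, where Gamma has the value 0 in HOL); the entire function
   is obtained by filling them in. *)
definition xi :: "complex \<Rightarrow> complex" where
  "xi = remove_sings
     (\<lambda>s. 1/2 * s * (s - 1) * of_real pi powr (- (s / 2)) * Gamma (s / 2) * zeta s)"

definition Xi :: "complex \<Rightarrow> complex" where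
  "Xi s = xi (1/2 + \<i> * s)"

(* The point 1 is the pole of zeta, see above. *)
definition nontrivial_zeta_zero :: "complex \<Rightarrow> bool" where
  "nontrivial_zeta_zero s \<longleftrightarrow>
     s \<noteq> 1 \<and> zeta s = 0 \<and> (\<forall>n::nat. n \<ge> 1 \<longrightarrow> s \<noteq> - (2 * of_nat n))"

definition riemann_hypothesis :: bool where
  "riemann_hypothesis \<longleftrightarrow> (\<forall>s. nontrivial_zeta_zero s \<longrightarrow> Re s = 1/2)"

definition first_critical_zero :: "real \<Rightarrow> bool" where
  "first_critical_zero t\<^sub>0 \<longleftrightarrow>
     t\<^sub>0 > 0 \<and> zeta (1/2 + \<i> * of_real t\<^sub>0) = 0 \<and>
     (\<forall>t. 0 < t \<and> t < t\<^sub>0 \<longrightarrow> zeta (1/2 + \<i> * of_real t) \<noteq> 0)"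

end

theory Submission
  imports Defs "HOL-Probability.Characteristic_Functions" "HOL-Real_Asymp.Real_Asymp"
begin

text \<open>
  Riemann's theta integral gives \<open>\<Xi> s = F (s\<^sup>2)\<close> with \<open>F\<close> entire, of order below 1 and \<open>F 0 > 0\<close>, and the
  Riemann hypothesis says that all zeros of \<open>\<Xi>\<close> are real.

  If they are, then \<open>F\<close> is a limit of products of factors \<open>1 - w / a\<^sup>2\<close>, so \<open>1 / \<Xi>\<close> is a limit of products of
  \<open>1 / (1 - s\<^sup>2 / a\<^sup>2)\<close>, the Laplace transforms of the densities \<open>a / 2 * exp (- a * \<bar>x\<bar>)\<close>. These are totally positive,
  hence so are their convolutions, and uniform Lipschitz and exponential bounds let one pass to the limit.

  Conversely, if \<open>1 / \<Xi>\<close> is the Laplace transform of a Polya frequency function, then convolution with it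
  inverts the operator \<open>\<Xi> D\<close> on polynomials and, being variation diminishing, forces \<open>\<Xi> D\<close> to preserve
  real-rootedness. Applied to \<open>x ^ n\<close> this shows that the Jensen polynomials of \<open>\<Xi>\<close> have only real zeros, and
  Hurwitz's theorem transfers this to \<open>\<Xi>\<close>.
\<close>

section \<open>Determinants and total positivity\<close>

text \<open>The variable \<open>w = s ^ 2\<close> keeps the product simple: in \<open>w\<close> the
  function grows more slowly than every \<open>exp (\<epsilon> * norm w)\<close>, so no exponential
  factor can stand beside the zeros. The smallest zero \<open>t\<^sub>0 ^ 2\<close> is kept as one
  fixed factor of all approximants; its density supplies their common Lipschitz constant, and as no
  zero is smaller, all factors have exponential moments on the strip
  \<open>\<bar>Re s\<bar> < t\<^sub>0\<close>. In the converse, variation diminution speaks of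
  strict sign changes, of which \<open>x ^ n\<close> has at most one. It is therefore replaced by a
  polynomial with \<open>n\<close> close simple zeros, and the count of real zeros is turned into a
  lower bound by powers of \<open>\<bar>Im w\<bar>\<close>, which survives the limit in which the
  zeros merge. Zeta is specified only by the uniqueness of its continuation, so a candidate has to
  be built: the theta integral yields an entire xi, and division by the Gamma factor yields a
  function that agrees with the Dirichlet series for \<open>Re s > 1\<close>.\<close>

lemma det_mat_eq:
  "Determinant.det (Matrix.mat n n (\<lambda>(i, j). a i j)) =
    (\<Sum>p | p permutes {0..<n}. of_int (sign p) * (\<Prod>i = 0..<n. a i (p i)))"
  by (subst Determinant.det_def'[of _ n])
     (auto intro!: sum.cong prod.cong simp: permutes_in_image[of _ "{0..<n}", simplified])

lemma det_mat_transpose: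
  fixes a :: "nat \<Rightarrow> nat \<Rightarrow> 'a::comm_ring_1"
  shows "Determinant.det (Matrix.mat n n (\<lambda>(i, j). a j i)) = Determinant.det (Matrix.mat n n (\<lambda>(i, j). a i j))"
proof -
  have "transpose_mat (Matrix.mat n n (\<lambda>(i, j). a i j)) = Matrix.mat n n (\<lambda>(i, j). a j i)"
    by (intro eq_matI) auto
  then show ?thesis by (metis det_transpose mat_carrier)
qed

lemma det_mat_scale:
  fixes a :: "nat \<Rightarrow> nat \<Rightarrow> 'a::comm_ring_1"
  shows "Determinant.det (Matrix.mat n n (\<lambda>(i, j). u i * a i j * v j)) =
    (\<Prod>i<n. u i) * (\<Prod>j<n. v j) * Determinant.det (Matrix.mat n n (\<lambda>(i, j). a i j))"
proof -
  have "of_int (sign p) * (\<Prod>i = 0..<n. u i * a i (p i) * v (p i)) =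
      (\<Prod>i<n. u i) * (\<Prod>j<n. v j) * (of_int (sign p) * (\<Prod>i = 0..<n. a i (p i)))"
    if "p permutes {0..<n}" for p
  proof -
    have "(\<Prod>i = 0..<n. v (p i)) = (\<Prod>j = 0..<n. v j)"
      using prod.permute[OF that, of v] by (simp add: o_def)
    then show ?thesis by (simp add: prod.distrib lessThan_atLeast0 mult_ac)
  qed
  then show ?thesis
    unfolding det_mat_eq sum_distrib_left by (intro sum.cong) auto
qed

lemma det_mat_permute_rows:
  fixes a :: "nat \<Rightarrow> nat \<Rightarrow> 'a::comm_ring_1"
  assumes "p permutes {0..<n}"
  shows "Determinant.det (Matrix.mat n n (\<lambda>(i, j). a (p i) j)) =
    of_int (sign p) * Determinant.det (Matrix.mat n n (\<lambda>(i, j). a i j))"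
proof -
  have "Matrix.mat n n (\<lambda>(i, j). a (p i) j) =
      Matrix.mat n n (\<lambda>(i, j). Matrix.mat n n (\<lambda>(i, j). a i j) $$ (p i, j))"
    using permutes_in_image[OF assms] by (intro eq_matI) auto
  then show ?thesis using det_permute_rows[OF _ assms, of "Matrix.mat n n (\<lambda>(i, j). a i j)"] by simp
qed

text \<open>If the matrix of the first \<open>k\<close> rows is singular, one column is redundant on these rows and is
  dropped; otherwise expand the singular matrix \<open>[A | A c]\<close> along its last column.\<close>

lemma tp_no_full_alternation:
  fixes A :: "nat \<Rightarrow> nat \<Rightarrow> real"
  assumes "\<And>n r c. strict_mono_on {..<n} r \<Longrightarrow> strict_mono_on {..<n} c \<Longrightarrow>
      (\<And>i. i < n \<Longrightarrow> r i \<le> k \<and> c i < k) \<Longrightarrow>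
      0 \<le> Determinant.det (Matrix.mat n n (\<lambda>(i, j). A (r i) (c j)))"
    and "\<And>i. i \<le> k \<Longrightarrow> 0 < (-1) ^ i * (\<Sum>j<k. A i j * c j)"
  shows False
  using assms
proof (induction k arbitrary: A c)
  case 0
  show ?case using "0.prems"(2)[of 0] by simp
next
  case (Suc k)
  let ?A = "Matrix.mat (Suc k) (Suc k) (\<lambda>(i, j). A i j)"
  show False
  proof (cases "Determinant.det ?A = 0")
    case True
    then obtain v where v: "v \<in> carrier_vec (Suc k)" "v \<noteq> 0\<^sub>v (Suc k)" "?A *\<^sub>v v = 0\<^sub>v (Suc k)"
      using det_0_iff_vec_prod_zero[of ?A "Suc k"] by auto
    obtain l where l: "l < Suc k" "vec_index v l \<noteq> 0"
      using v by (metis carrier_vecD eq_vecI index_zero_vec(1) index_zero_vec(2))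
    have ker: "(\<Sum>j<Suc k. A i j * vec_index v j) = 0" if "i < Suc k" for i
    proof -
      have "vec_index (?A *\<^sub>v v) i = (\<Sum>j<Suc k. A i j * vec_index v j)"
        using v(1) that by (simp add: scalar_prod_def lessThan_atLeast0 del: sum.op_ivl_Suc)
      moreover have "vec_index (?A *\<^sub>v v) i = 0" unfolding v(3) using that by simp
      ultimately show ?thesis by simp
    qed
    \<comment> \<open>The columns other than \<open>l\<close>, renumbered. As \<open>s\<close>
      increases, minors of the reduced matrix are minors of \<open>A\<close>.\<close>
    define s where "s = (\<lambda>j. if j < l then j else Suc j)"
    have bij: "bij_betw s {..<k} ({..<Suc k} - {l})"
      unfolding bij_betw_def
    proof
      show "inj_on s {..<k}" by (auto simp: inj_on_def s_def split: if_splits)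
      show "s ` {..<k} = {..<Suc k} - {l}"
      proof (intro equalityI subsetI)
        fix x assume x: "x \<in> {..<Suc k} - {l}"
        show "x \<in> s ` {..<k}"
          using x l by (intro image_eqI[of _ _ "if x < l then x else x - 1"]) (auto simp: s_def)
      qed (auto simp: s_def)
    qed
    have smono: "strict_mono s" by (auto simp: strict_mono_def s_def)
    \<comment> \<open>Subtracting the multiple of the kernel vector that cancels the coefficient of
      column \<open>l\<close> leaves the row sums of the first \<open>Suc k\<close> rows
      unchanged.\<close>
    define d where "d = (\<lambda>j. c j - c l * vec_index v j / vec_index v l)"
    have red: "(\<Sum>j<Suc k. A i j * c j) = (\<Sum>j<k. A i (s j) * d (s j))" if "i < Suc k" for i
    proof -
      have "(\<Sum>j<Suc k. A i j * d j) = (\<Sum>j<Suc k. A i j * c j) - c l / vec_index v l * (\<Sum>j<Suc k. A i j * vec_index v j)"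
        unfolding sum_distrib_left sum_subtractf[symmetric]
        by (intro sum.cong) (auto simp: d_def algebra_simps)
      then have "(\<Sum>j<Suc k. A i j * c j) = (\<Sum>j<Suc k. A i j * d j)" using ker[OF that] by simp
      also have "\<dots> = (\<Sum>j\<in>{..<Suc k} - {l}. A i j * d j)"
        using l by (intro sum.mono_neutral_right) (auto simp: d_def)
      also have "\<dots> = (\<Sum>j<k. A i (s j) * d (s j))"
        by (rule sum.reindex_bij_betw[OF bij, symmetric])
      finally show ?thesis .
    qed
    show False
    proof (rule Suc.IH[of "\<lambda>i j. A i (s j)" "\<lambda>j. d (s j)"])
      fix n and r c :: "nat \<Rightarrow> nat" assume *: "strict_mono_on {..<n} r" "strict_mono_on {..<n} c"
        "\<And>i. i < n \<Longrightarrow> r i \<le> k \<and> c i < (k::nat)"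
      have "strict_mono_on {..<n} (s \<circ> c)"
        using *(2) smono by (auto simp: strict_mono_on_def strict_mono_def)
      moreover have "s (c i) < Suc k" if "i < n" for i
        using *(3)[OF that] by (auto simp: s_def)
      ultimately have "0 \<le> Determinant.det (Matrix.mat n n (\<lambda>(i, j). A (r i) ((s \<circ> c) j)))"
        by (intro Suc.prems(1)) (use * in \<open>auto intro: le_SucI simp: comp_def\<close>)
      then show "0 \<le> Determinant.det (Matrix.mat n n (\<lambda>(i, j). A (r i) (s (c j))))" by simp
    next
      fix i assume "i \<le> k"
      then show "0 < (- 1) ^ i * (\<Sum>j<k. A i (s j) * d (s j))"
        using Suc.prems(2)[of i] red[of i] by auto
    qed
  next
    case False
    define V where "V = (\<lambda>i. \<Sum>j<Suc k. A i j * c j)"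
    have Vpos: "0 < (-1) ^ i * V i" if "i \<le> Suc k" for i
      using Suc.prems(2)[OF that] by (simp only: V_def)
    \<comment> \<open>The last column is the combination of the others with coefficients
      \<open>c\<close>, so \<open>(c, -1)\<close> lies in the kernel of \<open>B\<close>.\<close>
    define B where "B = Matrix.mat (Suc (Suc k)) (Suc (Suc k)) (\<lambda>(i, j). if j < Suc k then A i j else V i)"
    define w where "w = Matrix.vec (Suc (Suc k)) (\<lambda>j. if j < Suc k then c j else -1)"
    have B: "B \<in> carrier_mat (Suc (Suc k)) (Suc (Suc k))" by (simp add: B_def)
    have "B *\<^sub>v w = 0\<^sub>v (Suc (Suc k))"
      by (intro eq_vecI)
         (auto simp: B_def w_def scalar_prod_def V_def lessThan_atLeast0)
    moreover have "w \<noteq> 0\<^sub>v (Suc (Suc k))"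
    proof
      assume "w = 0\<^sub>v (Suc (Suc k))"
      then have "vec_index w (Suc k) = 0" by simp
      then show False by (simp add: w_def)
    qed
    moreover have "w \<in> carrier_vec (Suc (Suc k))" by (simp add: w_def)
    ultimately have "Determinant.det B = 0"
      using det_0_iff_vec_prod_zero[OF B] by blast
    then have "0 = (\<Sum>i<Suc (Suc k). B $$ (i, Suc k) * cofactor B i (Suc k))"
      using laplace_expansion_column[OF B, of "Suc k"] by simp
    define M where "M = (\<lambda>i. Determinant.det (mat_delete B i (Suc k)))"
    have Meq: "M i = Determinant.det (Matrix.mat (Suc k) (Suc k) (\<lambda>(i', j). A (if i' < i then i' else Suc i') j))"
      if "i < Suc (Suc k)" for i
      unfolding M_def mat_delete_def using that
      by (intro arg_cong[where f = Determinant.det] eq_matI) (auto simp: B_def)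
    have Mnn: "0 \<le> M i" if "i < Suc (Suc k)" for i
      unfolding Meq[OF that]
      by (rule Suc.prems(1)[of "Suc k" "\<lambda>i'. if i' < i then i' else Suc i'" id, simplified])
         (auto simp: strict_mono_on_def)
    have "M (Suc k) = Determinant.det ?A"
      unfolding Meq[of "Suc k", simplified] by (intro arg_cong[where f = Determinant.det] eq_matI) auto
    with False Mnn[of "Suc k"] have Mpos: "0 < M (Suc k)" by simp
    \<comment> \<open>The cofactor signs cancel the alternation of the last column, so no term is
      negative; the term \<open>i = Suc k\<close> is positive because its minor is the nonzero
      determinant of \<open>?A\<close>.\<close>
    have "0 = (-1) ^ Suc k * (\<Sum>i<Suc (Suc k). B $$ (i, Suc k) * cofactor B i (Suc k))"
      using \<open>0 = _\<close> by simp
    also have "\<dots> = (\<Sum>i<Suc (Suc k). ((-1) ^ i * V i) * M i)"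
      unfolding sum_distrib_left
    proof (intro sum.cong refl)
      fix i assume "i \<in> {..<Suc (Suc k)}"
      then have "B $$ (i, Suc k) = V i" by (simp add: B_def)
      moreover have "(-1::real) ^ Suc k * (-1) ^ (i + Suc k) = (-1) ^ i"
        by (simp add: power_add)
      ultimately show "(-1) ^ Suc k * (B $$ (i, Suc k) * cofactor B i (Suc k)) = ((-1) ^ i * V i) * M i"
        unfolding cofactor_def M_def by (metis mult.assoc mult.left_commute)
    qed
    also have "\<dots> > 0"
    proof (rule sum_pos2[of _ "Suc k"])
      show "0 < (- 1) ^ Suc k * V (Suc k) * M (Suc k)"
        by (rule mult_pos_pos[OF Vpos[OF order.refl] Mpos])
      fix i assume "i \<in> {..<Suc (Suc k)}"
      then show "0 \<le> (- 1) ^ i * V i * M i"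
        using Vpos[of i] Mnn[of i] by (intro mult_nonneg_nonneg[OF less_imp_le]) auto
    qed auto
    finally show False by simp
  qed
qed

text \<open>Each product of the Leibniz expansion takes exactly one entry from every row. Giving row
  \<open>i\<close> its own variable \<open>z i\<close> therefore turns a product of integrals into
  one integral over the product space.\<close>

lemma det_integral:
  fixes g :: "nat \<Rightarrow> nat \<Rightarrow> 'a \<Rightarrow> real"
  assumes M: "sigma_finite_measure M" and g: "\<And>i j. i < n \<Longrightarrow> j < n \<Longrightarrow> integrable M (g i j)"
  shows integrable_det: "integrable (Pi\<^sub>M {0..<n} (\<lambda>_. M)) (\<lambda>z. Determinant.det (Matrix.mat n n (\<lambda>(i, j). g i j (z i))))"
    and "Determinant.det (Matrix.mat n n (\<lambda>(i, j). integral\<^sup>L M (g i j))) =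
      (LINT z|Pi\<^sub>M {0..<n} (\<lambda>_. M). Determinant.det (Matrix.mat n n (\<lambda>(i, j). g i j (z i))))"
proof -
  interpret product_sigma_finite "\<lambda>_::nat. M"
    using M by (simp add: product_sigma_finite_def)
  have g': "integrable M (g i (p i))" if "p permutes {0..<n}" "i \<in> {0..<n}" for i p
    using that permutes_in_image[OF that(1), of i] by (intro g) auto
  have int: "integrable (Pi\<^sub>M {0..<n} (\<lambda>_. M)) (\<lambda>z. of_int (sign p) * (\<Prod>i = 0..<n. g i (p i) (z i)))"
    if "p \<in> {p. p permutes {0..<n}}" for p
    using that g' by (intro integrable_mult_right product_integrable_prod) auto
  show "integrable (Pi\<^sub>M {0..<n} (\<lambda>_. M)) (\<lambda>z. Determinant.det (Matrix.mat n n (\<lambda>(i, j). g i j (z i))))"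
    unfolding det_mat_eq by (intro Bochner_Integration.integrable_sum int)
  show "Determinant.det (Matrix.mat n n (\<lambda>(i, j). integral\<^sup>L M (g i j))) =
      (LINT z|Pi\<^sub>M {0..<n} (\<lambda>_. M). Determinant.det (Matrix.mat n n (\<lambda>(i, j). g i j (z i))))"
    unfolding det_mat_eq
    by (subst Bochner_Integration.integral_sum[OF int], assumption,
        intro sum.cong refl, subst integral_mult_right_zero)
       (subst product_integral_prod, use g' in auto)
qed

lemma sorting_permutation:
  fixes z :: "nat \<Rightarrow> real"
  assumes inj: "inj_on z {0..<n}"
  obtains p where "p permutes {0..<n}" "strict_mono_on {..<n} (z \<circ> p)"
proof -
  define xs where "xs = sorted_list_of_set (z ` {0..<n})"
  have len: "length xs = n" and set: "set xs = z ` {0..<n}" and sorted: "sorted_wrt (<) xs"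
    using inj by (auto simp: xs_def card_image)
  define p where "p = (\<lambda>i. if i < n then the_inv_into {0..<n} z (xs ! i) else i)"
  have mem: "xs ! i \<in> z ` {0..<n}" if "i < n" for i using that len set nth_mem by metis
  have zp: "z (p i) = xs ! i" if "i < n" for i
    using f_the_inv_into_f[OF inj mem[OF that]] that by (simp add: p_def)
  have "p i < n" if "i < n" for i
    using the_inv_into_into[OF inj mem[OF that], of "{0..<n}"] that by (simp add: p_def)
  moreover have sm: "strict_mono_on {..<n} (z \<circ> p)"
    using sorted by (auto simp: strict_mono_on_def zp len sorted_wrt_iff_nth_less)
  moreover have "inj_on p {0..<n}"
    using strict_mono_on_imp_inj_on[OF sm] by (metis inj_on_imageI2 lessThan_atLeast0)
  ultimately have "p permutes {0..<n}"
    by (intro bij_imp_permutes bij_betw_imageI endo_inj_surj) (auto simp: p_def)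
  then show thesis using sm that by blast
qed

text \<open>Both determinants use the same points \<open>z\<close>, so sorting them multiplies both
  by the same sign; two equal points give equal rows.\<close>

lemma det_product_nonneg:
  fixes \<phi> \<psi> :: "nat \<Rightarrow> real \<Rightarrow> real"
  assumes "\<And>z. strict_mono_on {..<n} z \<Longrightarrow> 0 \<le> Determinant.det (Matrix.mat n n (\<lambda>(i, j). \<phi> j (z i)))"
    and "\<And>z. strict_mono_on {..<n} z \<Longrightarrow> 0 \<le> Determinant.det (Matrix.mat n n (\<lambda>(i, j). \<psi> j (z i)))"
  shows "0 \<le> Determinant.det (Matrix.mat n n (\<lambda>(i, j). \<phi> j (z i))) *
    Determinant.det (Matrix.mat n n (\<lambda>(i, j). \<psi> j (z i)))"
proof (cases "inj_on z {0..<n}")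
  case True
  then obtain p where p: "p permutes {0..<n}" "strict_mono_on {..<n} (z \<circ> p)"
    by (rule sorting_permutation)
  have "0 \<le> of_int (sign p) * Determinant.det (Matrix.mat n n (\<lambda>(i, j). \<phi> j (z i))) *
      (of_int (sign p) * Determinant.det (Matrix.mat n n (\<lambda>(i, j). \<psi> j (z i))))"
    using assms[OF p(2)] det_mat_permute_rows[OF p(1), of "\<lambda>i j. \<phi> j (z i)"]
      det_mat_permute_rows[OF p(1), of "\<lambda>i j. \<psi> j (z i)"]
    unfolding comp_def by (metis mult_nonneg_nonneg)
  then show ?thesis by (auto simp: sign_def split: if_splits)
next
  case False
  then obtain i j where "i < n" "j < n" "i \<noteq> j" "z i = z j" by (auto simp: inj_on_def)
  then have "Determinant.det (Matrix.mat n n (\<lambda>(i, j). \<phi> j (z i))) = 0"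
    by (intro det_identical_rows[of _ n i j]) (auto intro!: eq_vecI)
  then show ?thesis by simp
qed

text \<open>Antisymmetrising the integrand of \<open>det_integral\<close> over row permutations turns it into the product
  of two determinants (Andreief's identity).\<close>

lemma det_integral_product_nonneg:
  fixes \<phi> \<psi> :: "nat \<Rightarrow> real \<Rightarrow> real"
  assumes M: "sigma_finite_measure M"
    and int: "\<And>i j. i < n \<Longrightarrow> j < n \<Longrightarrow> integrable M (\<lambda>z. \<phi> i z * \<psi> j z)"
    and "\<And>z. strict_mono_on {..<n} z \<Longrightarrow> 0 \<le> Determinant.det (Matrix.mat n n (\<lambda>(i, j). \<phi> j (z i)))"
    and "\<And>z. strict_mono_on {..<n} z \<Longrightarrow> 0 \<le> Determinant.det (Matrix.mat n n (\<lambda>(i, j). \<psi> j (z i)))"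
  shows "0 \<le> Determinant.det (Matrix.mat n n (\<lambda>(i, j). \<integral>z. \<phi> i z * \<psi> j z \<partial>M))"
proof -
  let ?P = "{p. p permutes {0..<n}}" and ?N = "Pi\<^sub>M {0..<n} (\<lambda>_. M)"
  let ?D = "Determinant.det (Matrix.mat n n (\<lambda>(i, j). \<integral>z. \<phi> i z * \<psi> j z \<partial>M))"
  let ?E = "\<lambda>\<phi> z. Determinant.det (Matrix.mat n n (\<lambda>(i, j). \<phi> j (z i)))"
  have p_int: "integrable M (\<lambda>z. \<phi> (p i) z * \<psi> j z)" if "p permutes {0..<n}" "i < n" "j < n" for p i j
    using that permutes_in_image[OF that(1), of i] by (intro int) auto
  have det_prod: "Determinant.det (Matrix.mat n n (\<lambda>(i, j). \<phi> (p i) (z i) * \<psi> j (z i))) =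
      (\<Prod>i=0..<n. \<phi> (p i) (z i)) * ?E \<psi> z" for p z
    using det_mat_scale[of n "\<lambda>i. \<phi> (p i) (z i)" "\<lambda>i j. \<psi> j (z i)" "\<lambda>_. 1"]
    by (simp add: lessThan_atLeast0)
  \<comment> \<open>One copy of \<open>?D\<close> for each permutation of the rows. The sign is
    inserted twice: one pays for permuting the rows, the other builds the Leibniz formula of the
    second determinant.\<close>
  have "(\<Sum>p\<in>?P. ?D) = (\<Sum>p\<in>?P. of_int (sign p) * (of_int (sign p) * ?D))"
    by (intro sum.cong) (auto simp: sign_def)
  also have "\<dots> = (\<Sum>p\<in>?P. of_int (sign p) *
      Determinant.det (Matrix.mat n n (\<lambda>(i, j). \<integral>z. \<phi> (p i) z * \<psi> j z \<partial>M)))"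
    by (intro sum.cong refl arg_cong[where f = "\<lambda>x. _ * x"]
        det_mat_permute_rows[symmetric, where a = "\<lambda>i j. \<integral>z. \<phi> i z * \<psi> j z \<partial>M"]) auto
  also have "\<dots> = (\<Sum>p\<in>?P. of_int (sign p) *
      (LINT z|?N. (\<Prod>i=0..<n. \<phi> (p i) (z i)) * ?E \<psi> z))"
  proof (intro sum.cong refl arg_cong[where f = "\<lambda>x. _ * x"])
    fix p assume p: "p \<in> ?P"
    show "Determinant.det (Matrix.mat n n (\<lambda>(i, j). \<integral>z. \<phi> (p i) z * \<psi> j z \<partial>M)) =
        (LINT z|?N. (\<Prod>i=0..<n. \<phi> (p i) (z i)) * ?E \<psi> z)"
      unfolding det_prod[symmetric]
      by (rule det_integral(2)[OF M, where g = "\<lambda>i j z. \<phi> (p i) z * \<psi> j z"]) (use p p_int in auto)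
  qed
  also have "\<dots> = (LINT z|?N. (\<Sum>p\<in>?P. of_int (sign p) * ((\<Prod>i=0..<n. \<phi> (p i) (z i)) * ?E \<psi> z)))"
  proof (subst Bochner_Integration.integral_sum)
    fix p assume p: "p \<in> ?P"
    show "integrable ?N (\<lambda>z. of_int (sign p) * ((\<Prod>i=0..<n. \<phi> (p i) (z i)) * ?E \<psi> z))"
      unfolding det_prod[symmetric]
      by (intro integrable_mult_right integrable_det[OF M, where g = "\<lambda>i j z. \<phi> (p i) z * \<psi> j z"])
         (use p p_int in auto)
  qed simp
  also have "\<dots> = (LINT z|?N. ?E \<phi> z * ?E \<psi> z)"
    unfolding det_mat_eq[of n "\<lambda>i j. \<phi> j (_ i)"] by (simp add: sum_distrib_right mult.assoc)
  also have "\<dots> \<ge> 0"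
    by (intro Bochner_Integration.integral_nonneg det_product_nonneg assms)
  finally have "0 \<le> real (card ?P) * ?D" by simp
  moreover have "card ?P > 0" by (simp add: card_permutations)
  ultimately show ?thesis by (simp add: zero_le_mult_iff)
qed

section \<open>Polya frequency functions with reciprocal Laplace transform\<close>

lemma sigma_finite_lebesgue: "sigma_finite_measure (lebesgue :: 'a::euclidean_space measure)"
proof -
  obtain A :: "'a set set" where A: "countable A" "A \<subseteq> sets lborel" "\<Union>A = space lborel"
      "\<forall>a\<in>A. emeasure lborel a \<noteq> \<infinity>"
    using sigma_finite_measure.sigma_finite_countable[OF sigma_finite_lborel] by blast
  then show ?thesis
    by (intro sigma_finite_measure.intro exI[of _ A]) (auto simp: subset_iff)
qed

text \<open>The index labels the interval between consecutive distinct roots that contains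
  \<open>t\<close>, a root belonging to the interval on its left. It grows with \<open>t\<close>, so
  intervals with increasing labels lie in increasing order on the line.\<close>

definition root_index :: "real poly \<Rightarrow> real \<Rightarrow> nat" where
  "root_index P t = card {r. poly P r = 0 \<and> r < t}"

lemma root_index_mono:
  assumes "P \<noteq> 0" "s \<le> t"
  shows "root_index P s \<le> root_index P t"
  unfolding root_index_def
  by (rule card_mono) (use assms in \<open>auto intro: finite_subset[OF _ poly_roots_finite]\<close>)

lemma root_index_le:
  assumes "P \<noteq> 0" shows "root_index P t \<le> card {r. poly P r = 0}"
  unfolding root_index_def by (rule card_mono) (use assms poly_roots_finite in auto)

text \<open>A sign change would force a root strictly between the two points, counted at
  \<open>t\<close> but not at \<open>s\<close>.\<close>

lemma same_root_index_same_sign: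
  assumes P: "P \<noteq> 0" and idx: "root_index P s = root_index P t" and le: "s \<le> t"
    and nz: "poly P s \<noteq> 0" "poly P t \<noteq> 0"
  shows "sgn (poly P s) = sgn (poly P t)"
proof (rule ccontr)
  assume ne: "sgn (poly P s) \<noteq> sgn (poly P t)"
  then have "s < t" using le by (cases "s = t") auto
  moreover have "poly P s * poly P t < 0"
    using ne nz by (auto simp: sgn_if mult_less_0_iff split: if_splits)
  ultimately obtain r where r: "s < r" "r < t" "poly P r = 0" using poly_IVT by blast
  have "card {r. poly P r = 0 \<and> r < s} < card {r. poly P r = 0 \<and> r < t}"
  proof (rule psubset_card_mono)
    show "finite {r. poly P r = 0 \<and> r < t}"
      using P by (auto intro: finite_subset[OF _ poly_roots_finite])
    have "r \<in> {r. poly P r = 0 \<and> r < t} - {r. poly P r = 0 \<and> r < s}" using r by auto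
    then show "{r. poly P r = 0 \<and> r < s} \<subset> {r. poly P r = 0 \<and> r < t}" using \<open>s < t\<close> by auto
  qed
  then show False using idx by (simp add: root_index_def)
qed

lemma totally_positive_nonneg:
  assumes "totally_positive \<Lambda>" shows "0 \<le> \<Lambda> x"
proof -
  have "0 \<le> Determinant.det (Matrix.mat 1 1 (\<lambda>(j, k). \<Lambda> ((\<lambda>_. x) j - (\<lambda>_. 0) k)))"
    by (rule assms[unfolded totally_positive_def, THEN conjunct2, rule_format])
       (auto simp: strict_mono_on_def)
  then show ?thesis by (subst (asm) det_single) auto
qed

lemma totally_positive_det:
  assumes "totally_positive \<Lambda>" "strict_mono_on {..<n} x" "strict_mono_on {..<n} y"
  shows "0 \<le> Determinant.det (Matrix.mat n n (\<lambda>(j, k). \<Lambda> (x j - y k)))"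
proof (cases "n = 0")
  case True
  then show ?thesis by (simp add: det_dim_zero)
next
  case False
  then show ?thesis using assms unfolding totally_positive_def by simp
qed

text \<open>Cutting the integral of \<open>P\<close> at its roots writes the convolution as a combination of the columns
  of a totally positive matrix, one for each interval between roots.\<close>

lemma convolution_alternations:
  fixes P :: "real poly" and x :: "nat \<Rightarrow> real"
  assumes TP: "totally_positive \<Lambda>" and P: "P \<noteq> 0"
    and int: "\<And>x. integrable lebesgue (\<lambda>t. \<Lambda> (x - t) * poly P t)"
    and k: "k = Suc (card {r. poly P r = 0})"
    and x: "strict_mono x"
    and alt: "\<And>i. i \<le> k \<Longrightarrow> 0 < \<sigma> * (-1) ^ i * (\<integral>t. \<Lambda> (x i - t) * poly P t \<partial>lebesgue)"
  shows False
proof -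
  define S where "S = (\<lambda>j. {t. root_index P t = j})"
  define w where "w = (\<lambda>j t. indicator (S j) t * \<bar>poly P t\<bar>)"
  define u where "u = (\<lambda>i j. \<integral>t. \<Lambda> (x i - t) * w j t \<partial>lebesgue)"
  have nn: "0 \<le> \<Lambda> t" for t by (rule totally_positive_nonneg[OF TP])
  have "mono (\<lambda>t. real (root_index P t))"
    by (intro monoI) (use root_index_mono[OF P] in auto)
  then have "(\<lambda>t. real (root_index P t)) \<in> borel_measurable borel" by (rule borel_measurable_mono)
  then have "(\<lambda>t. real (root_index P t)) -` {real j} \<inter> space borel \<in> sets borel" for j
    by (rule measurable_sets) auto
  moreover have "(\<lambda>t. real (root_index P t)) -` {real j} \<inter> space borel = S j" for j
    by (auto simp: S_def)
  ultimately have "S j \<in> sets borel" for j by metis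
  then have S: "S j \<in> sets lebesgue" for j by simp
  have w_int: "integrable lebesgue (\<lambda>t. \<Lambda> (y - t) * w j t)" for y j
  proof -
    have "integrable lebesgue (\<lambda>t. indicator (S j) t *\<^sub>R \<bar>\<Lambda> (y - t) * poly P t\<bar>)"
      by (intro integrable_mult_indicator S integrable_abs int)
    moreover have "indicator (S j) t *\<^sub>R \<bar>\<Lambda> (y - t) * poly P t\<bar> = \<Lambda> (y - t) * w j t" for t
      using nn[of "y - t"] by (simp add: w_def abs_mult)
    ultimately show ?thesis by simp
  qed
  \<comment> \<open>On one piece \<open>P\<close> keeps its sign, which serves as the coefficient;
    where \<open>P\<close> takes no nonzero value, any number does.\<close>
  have ex: "\<exists>\<epsilon>. \<forall>t\<in>S j. poly P t = \<epsilon> * \<bar>poly P t\<bar>" for j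
  proof (cases "\<exists>s\<in>S j. poly P s \<noteq> 0")
    case True
    then obtain s where s: "s \<in> S j" "poly P s \<noteq> 0" by blast
    have "poly P t = sgn (poly P s) * \<bar>poly P t\<bar>" if "t \<in> S j" for t
    proof (cases "poly P t = 0")
      case False
      have "sgn (poly P s) = sgn (poly P t)"
      proof (cases "s \<le> t")
        case True
        then show ?thesis using same_root_index_same_sign[OF P, of s t] s that False by (simp add: S_def)
      next
        case False
        then show ?thesis
          using same_root_index_same_sign[OF P, of t s] s that \<open>poly P t \<noteq> 0\<close> by (simp add: S_def)
      qed
      then show ?thesis by (simp add: sgn_mult_abs)
    qed simp
    then show ?thesis by blast
  qed auto
  define \<epsilon> where "\<epsilon> = (\<lambda>j. SOME \<epsilon>. \<forall>t\<in>S j. poly P t = \<epsilon> * \<bar>poly P t\<bar>)"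
  have \<epsilon>: "poly P t = \<epsilon> j * \<bar>poly P t\<bar>" if "t \<in> S j" for j t
    using someI_ex[OF ex[of j]] that unfolding \<epsilon>_def by blast
  have P_eq: "poly P t = (\<Sum>j<k. \<epsilon> j * w j t)" for t
  proof -
    have "root_index P t < k" using root_index_le[OF P, of t] k by simp
    then have "(\<Sum>j<k. \<epsilon> j * w j t) = (\<Sum>j\<in>{root_index P t}. \<epsilon> j * w j t)"
      by (intro sum.mono_neutral_right) (auto simp: w_def S_def)
    also have "\<dots> = \<epsilon> (root_index P t) * \<bar>poly P t\<bar>" by (simp add: w_def S_def)
    also have "\<dots> = poly P t" by (rule \<epsilon>[symmetric]) (simp add: S_def)
    finally show ?thesis by simp
  qed
  have conv: "(\<integral>t. \<Lambda> (x i - t) * poly P t \<partial>lebesgue) = (\<Sum>j<k. u i j * \<epsilon> j)" for i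
  proof -
    have "(\<integral>t. \<Lambda> (x i - t) * poly P t \<partial>lebesgue) =
        (\<integral>t. (\<Sum>j<k. \<epsilon> j * (\<Lambda> (x i - t) * w j t)) \<partial>lebesgue)"
      unfolding P_eq by (simp add: sum_distrib_left mult_ac)
    also have "\<dots> = (\<Sum>j<k. \<epsilon> j * u i j)"
      unfolding u_def using w_int by (subst Bochner_Integration.integral_sum) auto
    finally show ?thesis by (simp add: mult_ac)
  qed
  show False
  proof (rule tp_no_full_alternation[of k u "\<lambda>j. \<sigma> * \<epsilon> j"])
    fix i assume "i \<le> k"
    then show "0 < (- 1) ^ i * (\<Sum>j<k. u i j * (\<sigma> * \<epsilon> j))"
      using alt[of i] unfolding conv by (simp add: sum_distrib_left mult_ac)
  next
    fix n and r c :: "nat \<Rightarrow> nat"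
    assume r: "strict_mono_on {..<n} r" and c: "strict_mono_on {..<n} c"
      and "\<And>i. i < n \<Longrightarrow> r i \<le> k \<and> c i < k"
    have xr: "strict_mono_on {..<n} (x \<circ> r)"
      using r x by (auto simp: strict_mono_on_def strict_mono_def)
    \<comment> \<open>After transposition every row belongs to one piece, and its entries can share
      one variable of integration.\<close>
    have "Determinant.det (Matrix.mat n n (\<lambda>(i, j). u (r i) (c j))) =
        Determinant.det (Matrix.mat n n (\<lambda>(i, j). u (r j) (c i)))"
      by (rule det_mat_transpose[symmetric])
    also have "\<dots> = (LINT z|Pi\<^sub>M {0..<n} (\<lambda>_. lebesgue).
        Determinant.det (Matrix.mat n n (\<lambda>(i, j). \<Lambda> (x (r j) - z i) * w (c i) (z i))))"
      unfolding u_def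
      by (rule det_integral(2)[OF sigma_finite_lebesgue, where g = "\<lambda>i j t. \<Lambda> (x (r j) - t) * w (c i) t"])
         (rule w_int)
    also have "\<dots> \<ge> 0"
    proof (rule Bochner_Integration.integral_nonneg)
      fix z :: "nat \<Rightarrow> real"
      have eq: "Determinant.det (Matrix.mat n n (\<lambda>(i, j). \<Lambda> (x (r j) - z i) * w (c i) (z i))) =
          (\<Prod>i<n. w (c i) (z i)) * Determinant.det (Matrix.mat n n (\<lambda>(i, j). \<Lambda> ((x \<circ> r) i - z j)))"
        using det_mat_scale[of n "\<lambda>i. w (c i) (z i)" "\<lambda>i j. \<Lambda> (x (r j) - z i)" "\<lambda>_. 1"]
          det_mat_transpose[of n "\<lambda>i j. \<Lambda> (x (r i) - z j)"]
        by (simp add: mult_ac)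
      show "0 \<le> Determinant.det (Matrix.mat n n (\<lambda>(i, j). \<Lambda> (x (r j) - z i) * w (c i) (z i)))"
      \<comment> \<open>The weights vanish unless every \<open>z i\<close> lies in piece
        \<open>c i\<close>. In that case the order of the pieces forces \<open>z\<close> to
        increase, and what remains is a minor of \<open>\<Lambda>\<close>.\<close>
      proof (cases "\<forall>i<n. root_index P (z i) = c i")
        case True
        have "strict_mono_on {..<n} z"
        proof (rule strict_mono_onI)
          fix i j assume ij: "i \<in> {..<n}" "j \<in> {..<n}" "i < j"
          then have "c i < c j" using c by (auto simp: strict_mono_on_def)
          then have "\<not> root_index P (z j) \<le> root_index P (z i)" using True ij by simp
          then show "z i < z j" using root_index_mono[OF P] by (meson not_le)
        qed
        then show ?thesis unfolding eq
          by (intro mult_nonneg_nonneg prod_nonneg totally_positive_det TP xr) (auto simp: w_def)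
      next
        case False
        then obtain i where "i < n" "w (c i) (z i) = 0" by (auto simp: w_def S_def)
        then show ?thesis unfolding eq by (subst prod_zero) auto
      qed
    qed
    finally show "0 \<le> Determinant.det (Matrix.mat n n (\<lambda>(i, j). u (r i) (c j)))" .
  qed
qed

section \<open>Power series in the derivative, acting on polynomials\<close>

lemma sum_triangle:
  fixes g :: "nat \<Rightarrow> nat \<Rightarrow> 'a::comm_monoid_add"
  assumes "\<And>k l. k + l > N \<Longrightarrow> g k l = 0"
  shows "(\<Sum>k\<le>N. \<Sum>l\<le>N. g k l) = (\<Sum>m\<le>N. \<Sum>k\<le>m. g k (m - k))"
proof -
  have "(\<Sum>k\<le>N. \<Sum>l\<le>N. g k l) = (\<Sum>(k, l)\<in>{..N} \<times> {..N}. g k l)"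
    by (simp add: sum.cartesian_product)
  also have "\<dots> = (\<Sum>(k, l)\<in>{(k, l). k + l \<le> N}. g k l)"
    by (intro sum.mono_neutral_right) (auto, metis assms not_le)
  also have "\<dots> = (\<Sum>m\<le>N. \<Sum>k\<le>m. g k (m - k))"
    by (rule sum.triangle_reindex_eq)
  finally show ?thesis .
qed

text \<open>The operator \<open>a(D)\<close> on polynomials, for the formal power series \<open>a\<close> in the derivation \<open>D\<close>.\<close>

definition appell :: "(nat \<Rightarrow> real) \<Rightarrow> real poly \<Rightarrow> real poly" where
  "appell a q = (\<Sum>i\<le>degree q. monom ((\<Sum>k\<le>degree q. a k * fact (i + k) * poly.coeff q (i + k)) / fact i) i)"

lemma coeff_appell:
  assumes "degree q \<le> N"
  shows "poly.coeff (appell a q) i = (\<Sum>k\<le>N. a k * fact (i + k) * poly.coeff q (i + k)) / fact i"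
proof -
  have eq: "(\<Sum>k\<le>N. a k * fact (i + k) * poly.coeff q (i + k)) =
      (\<Sum>k\<le>degree q. a k * fact (i + k) * poly.coeff q (i + k))"
    using assms by (intro sum.mono_neutral_right) (auto simp: coeff_eq_0)
  show ?thesis
  proof (cases "i \<le> degree q")
    case True
    then show ?thesis unfolding appell_def eq by (simp add: coeff_sum)
  next
    case False
    then have "(\<Sum>k\<le>N. a k * fact (i + k) * poly.coeff q (i + k)) = 0"
      by (intro sum.neutral) (auto simp: coeff_eq_0)
    with False show ?thesis unfolding appell_def by (simp add: coeff_sum)
  qed
qed

lemma degree_appell_le: "degree (appell a q) \<le> degree q"
  by (intro degree_le allI impI, subst coeff_appell[OF order.refl])
     (auto intro!: sum.neutral simp: coeff_eq_0)

lemma appell_0 [simp]: "appell a 0 = 0"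
  by (simp add: appell_def)

text \<open>On the rescaled coefficients \<open>fact i * coeff q i\<close> the derivative is a
  shift, so composing two such operators multiplies their symbols as power series; by hypothesis the
  product is 1.\<close>

lemma appell_inverse:
  assumes inv: "\<And>m. (\<Sum>k\<le>m. c k * a (m - k)) = (if m = 0 then 1 else (0::real))"
  shows "appell c (appell a q) = q"
proof (rule poly_eqI)
  fix j
  let ?N = "degree q"
  define g where "g = (\<lambda>m. fact (j + m) * poly.coeff q (j + m))"
  have g0: "g m = 0" if "m > ?N" for m using that by (simp add: g_def coeff_eq_0)
  have "poly.coeff (appell c (appell a q)) j =
      (\<Sum>k\<le>?N. c k * fact (j + k) * ((\<Sum>l\<le>?N. a l * fact (j + k + l) * poly.coeff q (j + k + l)) / fact (j + k))) / fact j"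
    by (subst coeff_appell[OF degree_appell_le]) (simp add: coeff_appell[OF order.refl])
  also have "\<dots> = (\<Sum>k\<le>?N. \<Sum>l\<le>?N. c k * a l * g (k + l)) / fact j"
  proof -
    have "c k * fact (j + k) * (S / fact (j + k)) = c k * S" for k S by simp
    then show ?thesis by (simp only:) (simp add: sum_distrib_left g_def mult_ac add_ac)
  qed
  also have "(\<Sum>k\<le>?N. \<Sum>l\<le>?N. c k * a l * g (k + l)) =
      (\<Sum>m\<le>?N. \<Sum>k\<le>m. c k * a (m - k) * g (k + (m - k)))"
    by (rule sum_triangle) (simp add: g0)
  also have "\<dots> = (\<Sum>m\<le>?N. (if m = 0 then 1 else 0) * g m)"
    by (simp add: inv[symmetric] sum_distrib_right)
  also have "\<dots> = g 0" by (simp add: if_distrib[of "\<lambda>x. x * _"] cong: if_cong)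
  finally show "poly.coeff (appell c (appell a q)) j = poly.coeff q j" by (simp add: g_def)
qed

text \<open>Expanding \<open>P (x - u)\<close> in powers of \<open>u\<close> leaves the sum of
  \<open>(-1) ^ k * m k / fact k\<close> times the \<open>k\<close>-th derivative of
  \<open>P\<close> at \<open>x\<close>. Convolution is thus the operator with symbol
  \<open>c\<close>.\<close>

lemma convolution_polynomial:
  fixes \<Lambda> :: "real \<Rightarrow> real"
  assumes mom: "\<And>k. has_bochner_integral lebesgue (\<lambda>u. \<Lambda> u * u ^ k) (m k)"
    and c: "\<And>k. c k = (-1) ^ k * m k / fact k"
  shows "has_bochner_integral lebesgue (\<lambda>t. \<Lambda> (x - t) * poly P t) (poly (appell c P) x)"
proof -
  let ?N = "degree P"
  have eq: "\<Lambda> u * poly P (x - u) =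
      (\<Sum>i\<le>?N. \<Sum>k\<le>i. (poly.coeff P i * (i choose k) * (-1) ^ k * x ^ (i - k)) * (\<Lambda> u * u ^ k))" for u
  proof -
    have "(x - u) ^ i = (\<Sum>k\<le>i. (i choose k) * ((-1) ^ k * u ^ k) * x ^ (i - k))" for i
      using binomial_ring[of "-u" x i] by (simp add: power_minus[of u])
    then show ?thesis by (simp add: poly_altdef sum_distrib_left mult_ac)
  qed
  have "has_bochner_integral lebesgue (\<lambda>u. \<Lambda> u * poly P (x - u))
      (\<Sum>i\<le>?N. \<Sum>k\<le>i. (poly.coeff P i * (i choose k) * (-1) ^ k * x ^ (i - k)) * m k)"
    unfolding eq by (intro has_bochner_integral_sum has_bochner_integral_mult_right mom)
  also have "(\<Sum>i\<le>?N. \<Sum>k\<le>i. (poly.coeff P i * (i choose k) * (-1) ^ k * x ^ (i - k)) * m k) =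
      (\<Sum>i\<le>?N. \<Sum>k\<le>i. poly.coeff P (k + (i - k)) * (k + (i - k) choose k) * (-1) ^ k * x ^ (i - k) * m k)"
    by (intro sum.cong refl) auto
  also have "\<dots> = (\<Sum>k\<le>?N. \<Sum>j\<le>?N. poly.coeff P (k + j) * (k + j choose k) * (-1) ^ k * x ^ j * m k)"
    by (rule sum_triangle[symmetric]) (simp add: coeff_eq_0)
  also have "\<dots> = (\<Sum>j\<le>?N. \<Sum>k\<le>?N. poly.coeff P (k + j) * (k + j choose k) * (-1) ^ k * x ^ j * m k)"
    by (rule sum.swap)
  also have "\<dots> = (\<Sum>j\<le>?N. poly.coeff (appell c P) j * x ^ j)"
  proof (intro sum.cong refl)
    fix j
    have "real (k + j choose k) = fact (j + k) / (fact k * fact j)" for k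
      using binomial_fact[of k "k + j", where 'a = real] by (simp add: add_ac)
    then show "(\<Sum>k\<le>?N. poly.coeff P (k + j) * (k + j choose k) * (-1) ^ k * x ^ j * m k) =
        poly.coeff (appell c P) j * x ^ j"
      by (simp add: coeff_appell[OF order.refl] c sum_distrib_left sum_distrib_right sum_divide_distrib add_ac mult_ac)
  qed
  also have "\<dots> = poly (appell c P) x"
  proof -
    have "(\<Sum>j\<le>?N. poly.coeff (appell c P) j * x ^ j) =
        (\<Sum>j\<le>degree (appell c P). poly.coeff (appell c P) j * x ^ j)"
      using degree_appell_le[of c P] by (intro sum.mono_neutral_right) (auto simp: coeff_eq_0)
    then show ?thesis by (simp add: poly_altdef)
  qed
  finally have "has_bochner_integral lebesgue (\<lambda>u. \<Lambda> u * poly P (x - u)) (poly (appell c P) x)" .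
  then show ?thesis
    using has_bochner_integral_lebesgue_real_affine_iff[of "-1"
        "\<lambda>u. \<Lambda> u * poly P (x - u)" "poly (appell c P) x" x] by simp
qed

section \<open>Real zeros of Appell polynomials\<close>

definition newton_poly :: "real \<Rightarrow> nat \<Rightarrow> real poly" where
  "newton_poly \<epsilon> n = (\<Prod>j<n. [:- (\<epsilon> * real j), 1:])"

lemma degree_newton_poly: "degree (newton_poly \<epsilon> n) = n"
  unfolding newton_poly_def by (subst degree_prod_eq_sum_degree) auto

lemma lead_coeff_newton_poly: "poly.coeff (newton_poly \<epsilon> n) n = 1"
proof -
  have "lead_coeff (newton_poly \<epsilon> n) = 1"
    unfolding newton_poly_def by (subst lead_coeff_prod) simp
  then show ?thesis by (simp add: degree_newton_poly)
qed

lemma newton_poly_neq_0: "newton_poly \<epsilon> n \<noteq> 0"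
  using lead_coeff_newton_poly[of \<epsilon> n] by auto

text \<open>The zeros \<open>0, \<epsilon>, ..., (n - 1) * \<epsilon>\<close> separate the
  \<open>n + 1\<close> sample points: factors with \<open>j < i\<close> are positive, the other
  \<open>n - i\<close> are negative. For \<open>n > 1\<close> the power \<open>x ^ n\<close>, which
  is the limit for \<open>\<epsilon>\<close> to 0, offers no such alternation.\<close>

lemma newton_poly_alternates:
  assumes "0 < \<epsilon>" "i \<le> n"
  shows "0 < (-1) ^ n * (-1) ^ i * poly (newton_poly \<epsilon> n) (\<epsilon> * (real i - 1/2))"
proof -
  have "(\<Prod>j<n. \<epsilon> * (real i - 1/2) - \<epsilon> * real j) = (\<Prod>j<i. \<epsilon> * (real i - 1/2) - \<epsilon> * real j) *
      (\<Prod>j=i..<n. \<epsilon> * (real i - 1/2) - \<epsilon> * real j)"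
    using assms(2) by (subst prod.union_disjoint[symmetric]) (auto intro!: prod.cong)
  also have "(\<Prod>j=i..<n. \<epsilon> * (real i - 1/2) - \<epsilon> * real j) =
      (\<Prod>j=i..<n. (-1) * (\<epsilon> * real j - \<epsilon> * (real i - 1/2)))" by simp
  also have "\<dots> = (-1) ^ (n - i) * (\<Prod>j=i..<n. \<epsilon> * real j - \<epsilon> * (real i - 1/2))"
    by (subst prod.distrib) simp
  finally have "(-1) ^ n * (-1) ^ i * (\<Prod>j<n. \<epsilon> * (real i - 1/2) - \<epsilon> * real j) =
      ((-1) ^ n * (-1) ^ i * (-1) ^ (n - i)) * ((\<Prod>j<i. \<epsilon> * (real i - 1/2) - \<epsilon> * real j) *
      (\<Prod>j=i..<n. \<epsilon> * real j - \<epsilon> * (real i - 1/2)))" by simp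
  also have "(-1::real) ^ n * (-1) ^ i * (-1) ^ (n - i) = 1"
    using assms(2) by (simp add: power_add[symmetric] mult.assoc)
  also have "1 * ((\<Prod>j<i. \<epsilon> * (real i - 1/2) - \<epsilon> * real j) *
      (\<Prod>j=i..<n. \<epsilon> * real j - \<epsilon> * (real i - 1/2))) > 0"
    using assms(1) by (intro mult_pos_pos prod_pos ballI) (auto simp: right_diff_distrib[symmetric])
  finally show ?thesis by (simp add: newton_poly_def poly_prod algebra_simps)
qed

lemma tendsto_coeff_newton_poly:
  assumes "(\<epsilon> \<longlongrightarrow> 0) F"
  shows "((\<lambda>N. poly.coeff (newton_poly (\<epsilon> N) n) i) \<longlongrightarrow> (if i = n then 1 else 0)) F"
proof (induction n arbitrary: i)
  case 0
  then show ?case by (auto simp: newton_poly_def)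
next
  case (Suc n)
  have eq: "newton_poly (\<epsilon> N) (Suc n) = [:- (\<epsilon> N * real n), 1:] * newton_poly (\<epsilon> N) n" for N
    by (simp add: newton_poly_def mult.commute)
  have *: "((\<lambda>N. - (\<epsilon> N * real n) * poly.coeff (newton_poly (\<epsilon> N) n) i +
      (case i of 0 \<Rightarrow> 0 | Suc j \<Rightarrow> poly.coeff (newton_poly (\<epsilon> N) n) j)) \<longlongrightarrow>
      - (0 * real n) * (if i = n then 1 else 0) + (case i of 0 \<Rightarrow> 0 | Suc j \<Rightarrow> if j = n then 1 else 0)) F"
    by (cases i) (auto intro!: tendsto_eq_intros assms Suc.IH simp del: mult_zero_left)
  then show ?case
    unfolding eq by (auto simp: coeff_pCons split: nat.splits)
qed

text \<open>Convolution with \<open>\<Lambda>\<close> undoes the operator and returns a polynomial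
  whose values alternate in sign at \<open>n + 1\<close> points. With fewer than \<open>n\<close>
  distinct real roots before the convolution, so many sign changes cannot arise after it.\<close>

lemma appell_newton_roots:
  fixes \<Lambda> :: "real \<Rightarrow> real"
  assumes TP: "totally_positive \<Lambda>"
    and mom: "\<And>k. has_bochner_integral lebesgue (\<lambda>u. \<Lambda> u * u ^ k) (m k)"
    and c: "\<And>k. c k = (-1) ^ k * m k / fact k"
    and inv: "\<And>m. (\<Sum>k\<le>m. c k * a (m - k)) = (if m = 0 then 1 else (0::real))"
    and \<epsilon>: "0 < \<epsilon>"
  shows "appell a (newton_poly \<epsilon> n) \<noteq> 0" "n \<le> card {r. poly (appell a (newton_poly \<epsilon> n)) r = 0}"
proof -
  let ?P = "appell a (newton_poly \<epsilon> n)"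
  note conv = convolution_polynomial[OF mom c, of _ ?P, unfolded appell_inverse[OF inv]]
  show nz: "?P \<noteq> 0"
    using appell_inverse[OF inv, of "newton_poly \<epsilon> n"] newton_poly_neq_0[of \<epsilon> n] by auto
  show "n \<le> card {r. poly ?P r = 0}"
  proof (rule ccontr)
    assume "\<not> n \<le> card {r. poly ?P r = 0}"
    then have less: "Suc (card {r. poly ?P r = 0}) \<le> n" by simp
    show False
    proof (rule convolution_alternations[OF TP nz _ refl, where \<sigma> = "(-1) ^ n" and x = "\<lambda>i. \<epsilon> * (real i - 1/2)"])
      show "integrable lebesgue (\<lambda>t. \<Lambda> (x - t) * poly ?P t)" for x
        using conv by (rule integrable.intros)
      show "strict_mono (\<lambda>i. \<epsilon> * (real i - 1/2))" using \<epsilon> by (auto simp: strict_mono_def)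
      fix i assume "i \<le> Suc (card {r. poly ?P r = 0})"
      then have "i \<le> n" using less by simp
      then show "0 < (-1) ^ n * (-1) ^ i * (\<integral>t. \<Lambda> (\<epsilon> * (real i - 1/2) - t) * poly ?P t \<partial>lebesgue)"
        using newton_poly_alternates[OF \<epsilon>] has_bochner_integral_integral_eq[OF conv] by simp
    qed
  qed
qed

text \<open>The polynomial is a product of real linear factors, and
  \<open>\<bar>Im w\<bar> \<le> norm (w - r)\<close> for each. In this quantitative form
  real-rootedness survives a limit of the coefficients in which roots may coalesce.\<close>

lemma norm_real_rooted_poly_ge:
  fixes P :: "real poly" and w :: complex
  assumes "P \<noteq> 0" "degree P \<le> n" "n \<le> card {r. poly P r = 0}"
  shows "\<bar>poly.coeff P n\<bar> * \<bar>Im w\<bar> ^ n \<le> norm (\<Sum>i\<le>n. of_real (poly.coeff P i) * w ^ i)"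
  using assms
proof (induction n arbitrary: P)
  case 0
  then show ?case by simp
next
  case (Suc n)
  then have "{r. poly P r = 0} \<noteq> {}" by (intro notI) simp
  then obtain r where "poly P r = 0" by blast
  then obtain R where R: "P = [:- r, 1:] * R" by (metis dvdE poly_eq_0_iff_dvd)
  have "R \<noteq> 0" using Suc.prems R by auto
  then have "degree P = Suc (degree R)" unfolding R by (subst degree_mult_eq) auto
  then have deg: "degree R \<le> n" using Suc.prems by simp
  have "card {x. poly P x = 0} \<le> card (insert r {x. poly R x = 0})"
    using poly_roots_finite[OF \<open>R \<noteq> 0\<close>] by (intro card_mono) (auto simp: R)
  also have "\<dots> \<le> Suc (card {x. poly R x = 0})" by (simp add: card_insert_if poly_roots_finite[OF \<open>R \<noteq> 0\<close>])
  finally have "n \<le> card {x. poly R x = 0}" using Suc.prems by simp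
  note IH = Suc.IH[OF \<open>R \<noteq> 0\<close> deg this]
  have coeff: "poly.coeff P i = - r * poly.coeff R i + (case i of 0 \<Rightarrow> 0 | Suc j \<Rightarrow> poly.coeff R j)" for i
    by (auto simp: R coeff_pCons split: nat.splits)
  have R0: "poly.coeff R (Suc n) = 0" using deg by (simp add: coeff_eq_0)
  have "(\<Sum>i\<le>Suc n. of_real (poly.coeff P i) * w ^ i) =
      (\<Sum>i\<le>Suc n. of_real (- r * poly.coeff R i) * w ^ i) +
      (\<Sum>i\<le>Suc n. of_real (case i of 0 \<Rightarrow> 0 | Suc j \<Rightarrow> poly.coeff R j) * w ^ i)"
    unfolding coeff sum.distrib[symmetric] by (simp only: of_real_add distrib_right)
  also have "(\<Sum>i\<le>Suc n. of_real (- r * poly.coeff R i) * w ^ i) =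
      - of_real r * (\<Sum>i\<le>n. of_real (poly.coeff R i) * w ^ i)"
    using R0 by (simp add: sum_distrib_left sum_negf mult_ac)
  also have "(\<Sum>i\<le>Suc n. of_real (case i of 0 \<Rightarrow> 0 | Suc j \<Rightarrow> poly.coeff R j) * w ^ i) =
      w * (\<Sum>i\<le>n. of_real (poly.coeff R i) * w ^ i)"
    by (subst sum.atMost_Suc_shift) (simp add: sum_distrib_left mult_ac)
  finally have "(\<Sum>i\<le>Suc n. of_real (poly.coeff P i) * w ^ i) =
      (w - of_real r) * (\<Sum>i\<le>n. of_real (poly.coeff R i) * w ^ i)"
    by (simp add: left_diff_distrib)
  then have "norm (\<Sum>i\<le>Suc n. of_real (poly.coeff P i) * w ^ i) =
      norm (w - of_real r) * norm (\<Sum>i\<le>n. of_real (poly.coeff R i) * w ^ i)"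
    by (simp only: norm_mult)
  moreover have "\<bar>Im w\<bar> \<le> norm (w - of_real r)" using abs_Im_le_cmod[of "w - of_real r"] by simp
  moreover have "poly.coeff P (Suc n) = poly.coeff R n" using R0 by (simp add: coeff)
  ultimately show ?case
    using mult_mono[OF _ IH, of "\<bar>Im w\<bar>" "norm (w - of_real r)"] by (simp add: mult_ac)
qed

text \<open>As \<open>\<epsilon>\<close> tends to 0 the coefficients tend to those of the operator
  applied to \<open>x ^ n\<close>, while the leading one equals \<open>a 0\<close> throughout. The
  lower bound \<open>\<bar>a 0\<bar> * \<bar>Im w\<bar> ^ n\<close> therefore passes to the
  limit.\<close>

lemma appell_monomial_zero_free:
  fixes a :: "nat \<Rightarrow> real" and w :: complex
  assumes roots: "\<And>\<epsilon>. 0 < \<epsilon> \<Longrightarrow> appell a (newton_poly \<epsilon> n) \<noteq> 0"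
      "\<And>\<epsilon>. 0 < \<epsilon> \<Longrightarrow> n \<le> card {r. poly (appell a (newton_poly \<epsilon> n)) r = 0}"
    and a0: "a 0 \<noteq> 0" and w: "Im w \<noteq> 0"
  shows "(\<Sum>i\<le>n. of_real (a (n - i) * fact n / fact i) * w ^ i) \<noteq> 0"
proof -
  define e where "e = (\<lambda>N. 1 / real (Suc N))"
  have e: "0 < e N" for N by (simp add: e_def)
  have e0: "e \<longlonglongrightarrow> 0" unfolding e_def using LIMSEQ_inverse_real_of_nat by (simp add: inverse_eq_divide)
  have deg: "degree (newton_poly (e N) n) \<le> n" for N by (simp add: degree_newton_poly)
  have "(\<lambda>N. poly.coeff (appell a (newton_poly (e N) n)) i) \<longlonglongrightarrow> a (n - i) * fact n / fact i" if "i \<le> n" for i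
  proof -
    have "(\<lambda>N. poly.coeff (appell a (newton_poly (e N) n)) i) \<longlonglongrightarrow>
        (\<Sum>k\<le>n. a k * fact (i + k) * (if i + k = n then 1 else 0)) / fact i"
      unfolding coeff_appell[OF deg] by (intro tendsto_intros tendsto_coeff_newton_poly e0) auto
    also have "(\<Sum>k\<le>n. a k * fact (i + k) * (if i + k = n then 1 else 0)) =
        (\<Sum>k\<in>{n - i}. a k * fact (i + k) * (if i + k = n then 1 else 0))"
      using that by (intro sum.mono_neutral_right) auto
    finally show ?thesis using that by simp
  qed
  then have lim: "(\<lambda>N. norm (\<Sum>i\<le>n. of_real (poly.coeff (appell a (newton_poly (e N) n)) i) * w ^ i)) \<longlonglongrightarrow>
      norm (\<Sum>i\<le>n. of_real (a (n - i) * fact n / fact i) * w ^ i)"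
    by (intro tendsto_intros) auto
  have "poly.coeff (appell a (newton_poly (e N) n)) n = a 0" for N
  proof -
    have "(\<Sum>k\<le>n. a k * fact (n + k) * poly.coeff (newton_poly (e N) n) (n + k)) =
        (\<Sum>k\<in>{0}. a k * fact (n + k) * poly.coeff (newton_poly (e N) n) (n + k))"
      by (intro sum.mono_neutral_right) (auto simp: coeff_eq_0 degree_newton_poly)
    then show ?thesis by (simp add: coeff_appell[OF deg] lead_coeff_newton_poly)
  qed
  then have "\<bar>a 0\<bar> * \<bar>Im w\<bar> ^ n \<le> norm (\<Sum>i\<le>n. of_real (poly.coeff (appell a (newton_poly (e N) n)) i) * w ^ i)" for N
    using norm_real_rooted_poly_ge[OF roots(1)[OF e] _ roots(2)[OF e], of N w] degree_appell_le[of a "newton_poly (e N) n"]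
    by (simp add: degree_newton_poly)
  then have "\<bar>a 0\<bar> * \<bar>Im w\<bar> ^ n \<le> norm (\<Sum>i\<le>n. of_real (a (n - i) * fact n / fact i) * w ^ i)"
    by (intro LIMSEQ_le_const[OF lim]) auto
  moreover have "0 < \<bar>a 0\<bar> * \<bar>Im w\<bar> ^ n" using a0 w by simp
  ultimately show ?thesis by auto
qed

section \<open>Jensen polynomials\<close>

definition jensen_weight :: "nat \<Rightarrow> nat \<Rightarrow> real" where
  "jensen_weight n k = (\<Prod>j<k. 1 - real j / real n)"

text \<open>This is the factor of the \<open>k\<close>-th Taylor coefficient in the
  \<open>n\<close>-th Jensen polynomial taken at \<open>z / n\<close>. The factorial form is what
  reversing the Appell polynomial produces; the product form shows the bounds 0 and 1 and the limit
  1.\<close>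

lemma jensen_weight_eq:
  assumes "k \<le> n"
  shows "jensen_weight n k = fact n / (fact (n - k) * real n ^ k)"
  using assms
proof (induction k)
  case 0
  then show ?case by (simp add: jensen_weight_def)
next
  case (Suc k)
  then have "n - k = Suc (n - Suc k)" by simp
  define d where "d = real n - real k"
  have d: "d \<noteq> 0" "real n \<noteq> 0" using Suc.prems by (auto simp: d_def)
  have "fact (n - k) = d * (fact (n - Suc k) :: real)"
    using \<open>n - k = _\<close> Suc.prems unfolding d_def by (metis fact_Suc of_nat_diff Suc_leD)
  moreover have "jensen_weight n (Suc k) = jensen_weight n k * (d / real n)"
    using d by (simp add: jensen_weight_def d_def mult.commute diff_divide_distrib)
  moreover have "jensen_weight n k = fact n / (fact (n - k) * real n ^ k)"
    using Suc by simp
  ultimately show ?case using d(1) by (simp only: power_Suc) (simp add: divide_simps)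
qed

lemma jensen_weight_eq_0:
  assumes "0 < n" "n < k" shows "jensen_weight n k = 0"
  unfolding jensen_weight_def using assms by (intro prod_zero bexI[of _ n]) auto

lemma jensen_weight_bounds:
  assumes "0 < n" shows "0 \<le> jensen_weight n k" "jensen_weight n k \<le> 1"
proof -
  have "0 \<le> jensen_weight n k \<and> jensen_weight n k \<le> 1"
  proof (cases "k \<le> n")
    case True
    then show ?thesis unfolding jensen_weight_def
      by (intro conjI prod_nonneg prod_le_1) (use assms in auto)
  qed (use jensen_weight_eq_0[OF assms] in auto)
  then show "0 \<le> jensen_weight n k" "jensen_weight n k \<le> 1" by auto
qed

lemma tendsto_jensen_weight: "(\<lambda>n. jensen_weight n k) \<longlonglongrightarrow> 1"
proof -
  have "(\<lambda>n. \<Prod>j<k. 1 - real j / real n) \<longlonglongrightarrow> (\<Prod>j<k. 1 - 0)"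
    by (intro tendsto_intros lim_const_over_n)
  then show ?thesis by (simp add: jensen_weight_def)
qed

text \<open>The substitution \<open>w = n / z\<close> preserves being nonreal and reverses the order
  of the coefficients; up to the factor \<open>(z / n) ^ n\<close> it carries the Appell polynomial
  into the Jensen polynomial.\<close>

lemma jensen_poly_zero_free:
  fixes z :: complex
  assumes "\<And>w. Im w \<noteq> 0 \<Longrightarrow> (\<Sum>i\<le>n. of_real (a (n - i) * fact n / fact i) * w ^ i) \<noteq> 0"
    and n: "0 < n" and z: "Im z \<noteq> 0"
  shows "(\<Sum>k\<le>n. of_real (a k * jensen_weight n k) * z ^ k) \<noteq> 0"
proof -
  have z0: "z \<noteq> 0" using z by auto
  define w where "w = of_nat n / z"
  have "Im w \<noteq> 0" using z n z0 by (simp add: w_def Im_divide sum_power2_eq_zero_iff complex_eq_iff)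
  then have nz: "(\<Sum>i\<le>n. of_real (a (n - i) * fact n / fact i) * w ^ i) \<noteq> 0" by (rule assms)
  have "(\<Sum>k\<le>n. of_real (a k * jensen_weight n k) * z ^ k) =
      (\<Sum>i\<le>n. of_real (a (n - i) * jensen_weight n (n - i)) * z ^ (n - i))"
    by (rule sum.nat_diff_reindex[symmetric, where n = "Suc n", simplified lessThan_Suc_atMost, simplified])
  also have "\<dots> = (\<Sum>i\<le>n. (z / of_nat n) ^ n * (of_real (a (n - i) * fact n / fact i) * w ^ i))"
  proof (intro sum.cong refl)
    fix i assume i: "i \<in> {..n}"
    have "(z / of_nat n) ^ n = (z / of_nat n) ^ (n - i) * (z / of_nat n) ^ i"
      using i by (simp add: power_add[symmetric])
    moreover have "(z / of_nat n) ^ i * w ^ i = 1"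
      using n z0 by (simp add: w_def power_mult_distrib[symmetric])
    ultimately have "(z / of_nat n) ^ n * w ^ i = (z / of_nat n) ^ (n - i)" by simp
    then have "(z / of_nat n) ^ n * (of_real (a (n - i) * fact n / fact i) * w ^ i) =
        of_real (a (n - i) * fact n / fact i) * (z / of_nat n) ^ (n - i)"
      by (metis mult.left_commute)
    also have "\<dots> = of_real (a (n - i) * jensen_weight n (n - i)) * z ^ (n - i)"
      using i by (subst jensen_weight_eq) (auto simp: power_divide)
    finally show "of_real (a (n - i) * jensen_weight n (n - i)) * z ^ (n - i) =
        (z / of_nat n) ^ n * (of_real (a (n - i) * fact n / fact i) * w ^ i)" ..
  qed
  also have "\<dots> = (z / of_nat n) ^ n * (\<Sum>i\<le>n. of_real (a (n - i) * fact n / fact i) * w ^ i)"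
    by (rule sum_distrib_left[symmetric])
  finally show ?thesis using nz n z0 by simp
qed

text \<open>The Jensen polynomials of an entire function converge to it locally uniformly.\<close>

lemma jensen_zero_free:
  fixes f :: "complex \<Rightarrow> complex"
  assumes f: "f holomorphic_on UNIV" and sums: "\<And>z. (\<lambda>k. of_real (a k) * z ^ k) sums f z"
    and zf: "\<And>n z. 0 < n \<Longrightarrow> Im z \<noteq> 0 \<Longrightarrow> (\<Sum>k\<le>n. of_real (a k * jensen_weight n k) * z ^ k) \<noteq> 0"
    and f0: "f 0 \<noteq> 0" and z: "f z = 0"
  shows "Im z = 0"
proof (rule ccontr)
  assume "Im z \<noteq> 0"
  \<comment> \<open>Hurwitz's theorem asks for a connected set, hence the open half-plane that
    contains \<open>z\<close>.\<close>
  define S where "S = (if Im z > 0 then {w. Im w > 0} else {w. Im w < 0})"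
  have S: "open S" "convex S" "z \<in> S"
    using \<open>Im z \<noteq> 0\<close> by (auto simp: S_def open_halfspace_Im_gt open_halfspace_Im_lt
        convex_halfspace_Im_gt convex_halfspace_Im_lt)
  have S_Im: "Im w \<noteq> 0" if "w \<in> S" for w using that by (auto simp: S_def split: if_splits)
  \<comment> \<open>The index is shifted because at \<open>n = 0\<close> the weights divide by zero;
    the facts about them start at 1.\<close>
  define J where "J = (\<lambda>n z. \<Sum>k\<le>Suc n. of_real (a k * jensen_weight (Suc n) k) * z ^ k :: complex)"
  have unif: "uniform_limit K J f sequentially" if K: "compact K" "K \<subseteq> S" for K
  proof -
    obtain r where r: "\<And>w. w \<in> K \<Longrightarrow> norm w \<le> r" "0 < r"
      using compact_imp_bounded[OF K(1)] by (auto simp: bounded_pos)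
    have "summable (\<lambda>k. norm (of_real (a k) * (of_real r :: complex) ^ k))"
      by (rule powser_insidea[of _ "of_real (r + 1)"]) (use sums r in \<open>auto simp: sums_iff\<close>)
    then have sumr: "summable (\<lambda>k. \<bar>a k\<bar> * r ^ k)" using r by (simp add: norm_mult norm_power)
    \<comment> \<open>The error of the \<open>k\<close>-th term, uniform on \<open>K\<close>. It
      tends to 0 for each \<open>k\<close> and stays below \<open>\<bar>a k\<bar> * r ^ k\<close>,
      so its sum over \<open>k\<close> tends to 0 by Tannery's theorem.\<close>
    define E where "E = (\<lambda>k n. \<bar>a k\<bar> * \<bar>jensen_weight (Suc n) k - 1\<bar> * r ^ k)"
    have Ebound: "E k n \<le> \<bar>a k\<bar> * r ^ k" for k n
      unfolding E_def using jensen_weight_bounds[of "Suc n" k] r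
      by (intro mult_right_mono mult_left_le) auto
    have Enn: "0 \<le> E k n" for k n using r by (simp add: E_def)
    have Elim: "E k \<longlonglongrightarrow> 0" for k
    proof -
      have "E k \<longlonglongrightarrow> \<bar>a k\<bar> * \<bar>1 - 1\<bar> * r ^ k"
        unfolding E_def by (intro tendsto_intros LIMSEQ_Suc[OF tendsto_jensen_weight])
      then show ?thesis by simp
    qed
    have Esum: "summable (\<lambda>k. E k n)" for n
      by (rule summable_comparison_test[OF _ sumr]) (use Ebound Enn in auto)
    have "\<forall>\<^sub>F (k, n) in sequentially \<times>\<^sub>F sequentially. norm (E k n) \<le> \<bar>a k\<bar> * r ^ k"
      by (rule always_eventually) (use Ebound Enn in auto)
    from tannerys_theorem[OF Elim this sumr sequentially_bot]
    have "((\<lambda>n. \<Sum>k. E k n) \<longlongrightarrow> suminf (\<lambda>_. 0 :: real)) sequentially" by blast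
    then have lim0: "(\<lambda>n. \<Sum>k. E k n) \<longlonglongrightarrow> 0" by simp
    have bound: "dist (J n w) (f w) \<le> (\<Sum>k. E k n)" if "w \<in> K" for n w
    proof -
      have "(\<lambda>k. of_real (a k * jensen_weight (Suc n) k) * w ^ k) sums J n w"
        unfolding J_def by (rule sums_finite) (auto simp: jensen_weight_eq_0)
      from sums_diff[OF this sums[of w]]
      have "(\<lambda>k. of_real (a k * (jensen_weight (Suc n) k - 1)) * w ^ k) sums (J n w - f w)"
        by (simp add: algebra_simps)
      moreover have le: "norm (of_real (a k * (jensen_weight (Suc n) k - 1)) * w ^ k) \<le> E k n" for k
        using power_mono[OF r(1)[OF that], of k] unfolding E_def
        by (simp only: norm_mult norm_power norm_of_real abs_mult) (intro mult_left_mono, auto)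
      ultimately show ?thesis
        unfolding dist_norm using norm_suminf_le[OF le Esum] by (simp only: sums_iff)
    qed
    show ?thesis
    proof (rule uniform_limitI)
      fix e :: real assume "0 < e"
      then have "\<forall>\<^sub>F n in sequentially. (\<Sum>k. E k n) < e" using lim0 by (intro order_tendstoD(2))
      then show "\<forall>\<^sub>F n in sequentially. \<forall>x\<in>K. dist (J n x) (f x) < e"
        by eventually_elim (intro ballI, rule le_less_trans[OF bound])
    qed
  qed
  \<comment> \<open>The constant could only be 0, and analytic continuation would then make
    \<open>f 0\<close> vanish.\<close>
  have nconst: "\<not> f constant_on S"
  proof
    assume "f constant_on S"
    then have "f w = 0" if "w \<in> S" for w using z S(3) that by (auto simp: constant_on_def)
    then have "f 0 = 0"
      using analytic_continuation_open[of S UNIV f "\<lambda>_. 0" 0] S f by auto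
    then show False using f0 by simp
  qed
  have "f z \<noteq> 0"
  proof (rule Hurwitz_no_zeros[of S J f z])
    show "J n holomorphic_on S" for n unfolding J_def by (intro holomorphic_intros)
    show "f holomorphic_on S" using f by (rule holomorphic_on_subset) simp
    show "J n w \<noteq> 0" if "w \<in> S" for n w unfolding J_def by (rule zf) (use S_Im[OF that] in auto)
  qed (use S nconst in \<open>auto intro: convex_connected unif\<close>)
  then show False using z by simp
qed

section \<open>Taylor coefficients of a two-sided Laplace transform\<close>

lemma abs_power_le_exp:
  fixes x :: real
  assumes "0 < \<sigma>"
  shows "\<bar>x\<bar> ^ k \<le> fact k / \<sigma> ^ k * exp (\<sigma> * \<bar>x\<bar>)"
proof -
  have "(\<sigma> * \<bar>x\<bar>) ^ k /\<^sub>R fact k \<le> (\<Sum>n. (\<sigma> * \<bar>x\<bar>) ^ n /\<^sub>R fact n)"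
    using sum_le_suminf[OF summable_exp_generic[of "\<sigma> * \<bar>x\<bar>"], of "{k}"] assms by auto
  then have "(\<sigma> * \<bar>x\<bar>) ^ k / fact k \<le> exp (\<sigma> * \<bar>x\<bar>)"
    by (simp add: exp_def field_simps)
  then show ?thesis using assms by (simp add: field_simps)
qed

lemma exp_abs_le: "exp (\<sigma> * \<bar>x\<bar>) \<le> exp (\<sigma> * x) + exp (- (\<sigma> * x))" for x :: real
  by (cases "x \<ge> 0") (auto simp: add_increasing add_increasing2)

text \<open>The strip is closed so that the transform is available at both ends
  \<open>\<sigma>\<close> and \<open>- \<sigma>\<close>. Together they control
  \<open>exp (\<sigma> * \<bar>x\<bar>)\<close>, which dominates all powers of \<open>x\<close> and
  all partial sums of the exponential series.\<close>

locale two_sided_laplace =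
  fixes \<Lambda> :: "real \<Rightarrow> real" and \<sigma> :: real and g :: "complex \<Rightarrow> complex"
  assumes nonneg: "0 \<le> \<Lambda> x" and meas: "\<Lambda> \<in> borel_measurable lebesgue" and \<sigma>: "0 < \<sigma>"
    and laplace: "\<bar>Re s\<bar> \<le> \<sigma> \<Longrightarrow> has_bochner_integral lebesgue (\<lambda>x. of_real (\<Lambda> x) * exp (- (s * of_real x))) (g s)"
begin

lemma integrable_exp_abs: "integrable lebesgue (\<lambda>x. \<Lambda> x * exp (\<sigma> * \<bar>x\<bar>))"
proof -
  have *: "integrable lebesgue (\<lambda>x. norm (of_real (\<Lambda> x) * exp (- (s * of_real x))))"
    if "\<bar>Re s\<bar> \<le> \<sigma>" for s using laplace[OF that] by (intro integrable_norm) (rule integrable.intros)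
  have "integrable lebesgue (\<lambda>x. \<Lambda> x * exp (- (r * x)))" if "\<bar>r\<bar> \<le> \<sigma>" for r
    using *[of "of_real r"] nonneg that by (simp add: norm_mult)
  from this[of \<sigma>] this[of "-\<sigma>"] have "integrable lebesgue (\<lambda>x. \<Lambda> x * exp (- (\<sigma> * x)) + \<Lambda> x * exp (\<sigma> * x))"
    using \<sigma> by (intro Bochner_Integration.integrable_add) auto
  then show ?thesis
  proof (rule Bochner_Integration.integrable_bound)
    show "AE x in lebesgue. norm (\<Lambda> x * exp (\<sigma> * \<bar>x\<bar>)) \<le> norm (\<Lambda> x * exp (- (\<sigma> * x)) + \<Lambda> x * exp (\<sigma> * x))"
    proof (intro AE_I2)
      fix x
      have "\<Lambda> x * exp (\<sigma> * \<bar>x\<bar>) \<le> \<Lambda> x * (exp (\<sigma> * x) + exp (- (\<sigma> * x)))"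
        by (intro mult_left_mono exp_abs_le nonneg)
      then show "norm (\<Lambda> x * exp (\<sigma> * \<bar>x\<bar>)) \<le> norm (\<Lambda> x * exp (- (\<sigma> * x)) + \<Lambda> x * exp (\<sigma> * x))"
        using nonneg[of x] by (simp add: algebra_simps)
    qed
    have "(\<lambda>x::real. exp (\<sigma> * \<bar>x\<bar>)) \<in> borel_measurable lebesgue" by (rule measurable_completion) simp
    with meas show "(\<lambda>x. \<Lambda> x * exp (\<sigma> * \<bar>x\<bar>)) \<in> borel_measurable lebesgue" by simp
  qed
qed

lemma integrable_moment: "integrable lebesgue (\<lambda>x. \<Lambda> x * x ^ k)"
proof (rule Bochner_Integration.integrable_bound)
  show "integrable lebesgue (\<lambda>x. fact k / \<sigma> ^ k * (\<Lambda> x * exp (\<sigma> * \<bar>x\<bar>)))"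
    by (intro integrable_mult_right integrable_exp_abs)
  show "AE x in lebesgue. norm (\<Lambda> x * x ^ k) \<le> norm (fact k / \<sigma> ^ k * (\<Lambda> x * exp (\<sigma> * \<bar>x\<bar>)))"
  proof (intro AE_I2)
    fix x
    have "\<Lambda> x * \<bar>x\<bar> ^ k \<le> \<Lambda> x * (fact k / \<sigma> ^ k * exp (\<sigma> * \<bar>x\<bar>))"
      by (intro mult_left_mono abs_power_le_exp nonneg \<sigma>)
    then show "norm (\<Lambda> x * x ^ k) \<le> norm (fact k / \<sigma> ^ k * (\<Lambda> x * exp (\<sigma> * \<bar>x\<bar>)))"
      using nonneg[of x] \<sigma> by (simp add: abs_mult power_abs mult_ac)
  qed
  have "(\<lambda>x::real. x ^ k) \<in> borel_measurable lebesgue" by (rule measurable_completion) simp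
  with meas show "(\<lambda>x. \<Lambda> x * x ^ k) \<in> borel_measurable lebesgue" by simp
qed

definition moment :: "nat \<Rightarrow> real" where "moment k = (\<integral>x. \<Lambda> x * x ^ k \<partial>lebesgue)"

lemma has_moment: "has_bochner_integral lebesgue (\<lambda>x. \<Lambda> x * x ^ k) (moment k)"
  unfolding moment_def by (rule has_bochner_integral_integrable[OF integrable_moment])

text \<open>The exponential is expanded under the integral sign; for
  \<open>norm s \<le> \<sigma>\<close> every partial sum is dominated by
  \<open>\<Lambda> x * exp (\<sigma> * \<bar>x\<bar>)\<close>.\<close>

lemma laplace_sums:
  assumes "norm s \<le> \<sigma>"
  shows "(\<lambda>k. of_real ((-1) ^ k * moment k / fact k) * s ^ k) sums g s"
proof -
  have Re: "\<bar>Re s\<bar> \<le> \<sigma>" using assms abs_Re_le_cmod[of s] by linarith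
  let ?f = "\<lambda>N x. (\<Sum>k<N. of_real (\<Lambda> x) * ((- (s * of_real x)) ^ k /\<^sub>R fact k))"
  have summand: "has_bochner_integral lebesgue (\<lambda>x. of_real (\<Lambda> x) * ((- (s * of_real x)) ^ k /\<^sub>R fact k))
      (of_real ((-1) ^ k * moment k / fact k) * s ^ k)" for k
  proof -
    have "has_bochner_integral lebesgue (\<lambda>x. (-1) ^ k * s ^ k / fact k * complex_of_real (\<Lambda> x * x ^ k))
      ((-1) ^ k * s ^ k / fact k * of_real (moment k))"
      by (intro has_bochner_integral_mult_right has_bochner_integral_of_real has_moment)
    moreover have "(-1) ^ k * s ^ k / fact k * complex_of_real (\<Lambda> x * x ^ k) =
        of_real (\<Lambda> x) * ((- (s * of_real x)) ^ k /\<^sub>R fact k)" for x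
      by (simp add: power_minus[of "s * _"] power_mult_distrib scaleR_conv_of_real divide_inverse)
    ultimately show ?thesis by (simp add: divide_inverse mult_ac)
  qed
  have "(\<lambda>N. \<integral>x. ?f N x \<partial>lebesgue) \<longlonglongrightarrow> (\<integral>x. of_real (\<Lambda> x) * exp (- (s * of_real x)) \<partial>lebesgue)"
  proof (rule integral_dominated_convergence[where w = "\<lambda>x. \<Lambda> x * exp (\<sigma> * \<bar>x\<bar>)"])
    show "(\<lambda>x. of_real (\<Lambda> x) * exp (- (s * of_real x))) \<in> borel_measurable lebesgue"
      using laplace[OF Re] by (rule borel_measurable_has_bochner_integral)
    show "?f N \<in> borel_measurable lebesgue" for N
      using summand by (intro borel_measurable_sum) (rule borel_measurable_has_bochner_integral)
    show "AE x in lebesgue. (\<lambda>N. ?f N x) \<longlonglongrightarrow> of_real (\<Lambda> x) * exp (- (s * of_real x))"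
    proof (intro AE_I2)
      fix x
      have "(\<lambda>k. of_real (\<Lambda> x) * ((- (s * of_real x)) ^ k /\<^sub>R fact k)) sums (of_real (\<Lambda> x) * exp (- (s * of_real x)))"
        by (intro sums_mult exp_converges)
      then show "(\<lambda>N. ?f N x) \<longlonglongrightarrow> of_real (\<Lambda> x) * exp (- (s * of_real x))" by (simp add: sums_def)
    qed
    show "AE x in lebesgue. norm (?f N x) \<le> \<Lambda> x * exp (\<sigma> * \<bar>x\<bar>)" for N
    proof (intro AE_I2)
      fix x
      have "norm (?f N x) \<le> (\<Sum>k<N. \<Lambda> x * ((\<sigma> * \<bar>x\<bar>) ^ k /\<^sub>R fact k))"
      proof (rule sum_norm_le)
        fix k
        have "(norm s * \<bar>x\<bar>) ^ k \<le> (\<sigma> * \<bar>x\<bar>) ^ k" using assms by (intro power_mono mult_right_mono) auto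
        then have "\<Lambda> x * ((norm s * \<bar>x\<bar>) ^ k / fact k) \<le> \<Lambda> x * ((\<sigma> * \<bar>x\<bar>) ^ k / fact k)"
          by (intro mult_left_mono divide_right_mono nonneg) auto
        then show "norm (of_real (\<Lambda> x) * ((- (s * of_real x)) ^ k /\<^sub>R fact k)) \<le> \<Lambda> x * ((\<sigma> * \<bar>x\<bar>) ^ k /\<^sub>R fact k)"
          using nonneg[of x] by (simp add: norm_mult norm_power divide_inverse mult_ac)
      qed
      also have "\<dots> = \<Lambda> x * (\<Sum>k<N. (\<sigma> * \<bar>x\<bar>) ^ k /\<^sub>R fact k)" by (simp add: sum_distrib_left)
      also have "\<dots> \<le> \<Lambda> x * (\<Sum>k. (\<sigma> * \<bar>x\<bar>) ^ k /\<^sub>R fact k)"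
        using \<sigma> by (intro mult_left_mono sum_le_suminf summable_exp_generic nonneg) auto
      finally show "norm (?f N x) \<le> \<Lambda> x * exp (\<sigma> * \<bar>x\<bar>)" by (simp add: exp_def)
    qed
  qed (rule integrable_exp_abs)
  moreover have "(\<integral>x. ?f N x \<partial>lebesgue) = (\<Sum>k<N. of_real ((-1) ^ k * moment k / fact k) * s ^ k)" for N
    by (rule has_bochner_integral_integral_eq[OF has_bochner_integral_sum[OF summand]])
  ultimately show ?thesis
    using has_bochner_integral_integral_eq[OF laplace[OF Re]] by (simp add: sums_def)
qed

end

lemma has_fps_expansion_of_sums:
  fixes f :: "complex \<Rightarrow> complex"
  assumes "0 < r" "\<And>s. norm s \<le> r \<Longrightarrow> (\<lambda>k. c k * s ^ k) sums f s"
  shows "f has_fps_expansion Abs_fps c"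
proof -
  have "0 < fps_conv_radius (Abs_fps c)"
  proof -
    have "ereal (norm (of_real r :: complex)) \<le> conv_radius c"
      by (rule conv_radius_geI) (use assms in \<open>auto simp: sums_iff\<close>)
    moreover have "0 < ereal (norm (of_real r :: complex))" using assms(1) by simp
    ultimately have "0 < conv_radius c" by (metis less_le_trans)
    then show ?thesis by (simp add: fps_conv_radius_def)
  qed
  moreover have "eventually (\<lambda>z. z \<in> ball 0 r) (nhds (0::complex))"
    using assms(1) by (intro eventually_nhds_in_open) auto
  then have "eventually (\<lambda>z. eval_fps (Abs_fps c) z = f z) (nhds 0)"
    by eventually_elim (use assms in \<open>auto simp: eval_fps_def sums_iff\<close>)
  ultimately show ?thesis by (simp add: has_fps_expansion_def)
qed

text \<open>The Taylor coefficients \<open>c\<close> of \<open>1 / f\<close> at 0 are signed moments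
  of \<open>\<Lambda>\<close> over factorials, hence real, and the formal reciprocal of this series
  is the Taylor series of \<open>f\<close>. So convolution with \<open>\<Lambda>\<close> inverts the
  operator whose symbol is \<open>f\<close>.\<close>

theorem laplace_reciprocal_real_zeros:
  fixes f :: "complex \<Rightarrow> complex"
  assumes PF: "polya_frequency_function \<Lambda>" and t: "0 < t" and f: "f holomorphic_on UNIV"
    and nz: "\<And>s. \<bar>Re s\<bar> < t \<Longrightarrow> f s \<noteq> 0"
    and lap: "\<And>s. \<bar>Re s\<bar> < t \<Longrightarrow>
      has_bochner_integral lebesgue (\<lambda>x. of_real (\<Lambda> x) * exp (- (s * of_real x))) (1 / f s)"
    and z: "f z = 0"
  shows "Im z = 0"
proof -
  have TP: "totally_positive \<Lambda>" using PF by (simp add: polya_frequency_function_def)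
  \<comment> \<open>The half width \<open>t / 2\<close> is one choice of a closed strip inside the
    open one.\<close>
  interpret two_sided_laplace \<Lambda> "t / 2" "\<lambda>s. 1 / f s"
  proof
    show "\<Lambda> \<in> borel_measurable lebesgue" using TP by (simp add: totally_positive_def)
  qed (use t lap TP in \<open>auto intro: totally_positive_nonneg\<close>)
  define c where "c = (\<lambda>k. (-1) ^ k * moment k / fact k)"
  define a where "a = fps_nth (inverse (Abs_fps c))"
  have "(\<lambda>k. of_real (c k) * (0::complex) ^ k) sums (1 / f 0)"
    unfolding c_def by (rule laplace_sums) (use t in simp)
  then have c0: "complex_of_real (c 0) = 1 / f 0"
    by (rule sums_unique2[OF powser_sums_zero])
  then have "c 0 \<noteq> 0" using nz[of 0] t by auto
  have "Abs_fps c * inverse (Abs_fps c) = 1"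
    by (rule inverse_mult_eq_1') (simp add: \<open>c 0 \<noteq> 0\<close>)
  then have "fps_nth (Abs_fps c * inverse (Abs_fps c)) m = fps_nth 1 m" for m by simp
  then have inv: "(\<Sum>k\<le>m. c k * a (m - k)) = (if m = 0 then 1 else 0)" for m
    by (simp add: fps_mult_nth a_def atLeast0AtMost)
  let ?C = "Abs_fps (\<lambda>k. complex_of_real (c k))" and ?A = "Abs_fps (\<lambda>k. complex_of_real (a k))"
  let ?F = "fps_expansion f 0"
  have CA: "?C * ?A = 1"
  proof (rule fps_ext)
    fix m
    have "fps_nth (?C * ?A) m = of_real (\<Sum>k\<le>m. c k * a (m - k))"
      by (simp add: fps_mult_nth atLeast0AtMost)
    then show "fps_nth (?C * ?A) m = fps_nth 1 m" unfolding inv by simp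
  qed
  have Fexp: "f has_fps_expansion ?F" by (rule has_fps_expansion_fps_expansion[of UNIV]) (use f in auto)
  have "(\<lambda>s. 1 / f s) has_fps_expansion ?C"
    by (rule has_fps_expansion_of_sums[of "t / 2"]) (use laplace_sums t in \<open>auto simp: c_def\<close>)
  with Fexp have "(\<lambda>s. f s * (1 / f s)) has_fps_expansion ?F * ?C" by (rule has_fps_expansion_mult)
  moreover have ev: "eventually (\<lambda>s. f s * (1 / f s) = 1) (nhds 0)"
  proof -
    have "eventually (\<lambda>s. s \<in> ball 0 t) (nhds (0::complex))" using t by (intro eventually_nhds_in_open) auto
    then show ?thesis
    proof eventually_elim
      case (elim s)
      then have "\<bar>Re s\<bar> < t" using abs_Re_le_cmod[of s] by simp
      then show ?case using nz by simp
    qed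
  qed
  ultimately have "(\<lambda>s. 1) has_fps_expansion ?F * ?C"
    using has_fps_expansion_cong[OF ev refl] by blast
  then have "?F * ?C = 1" by (rule fps_expansion_unique_complex) simp
  \<comment> \<open>Uniqueness of reciprocals: both \<open>?F\<close> and \<open>?A\<close> invert
    \<open>?C\<close>.\<close>
  have "?F = ?F * (?C * ?A)" unfolding CA by (rule mult_1_right[symmetric])
  also have "\<dots> = ?A" unfolding mult.assoc[symmetric] \<open>?F * ?C = 1\<close> by (rule mult_1_left)
  finally have "?F = ?A" .
  then have Fk: "(deriv ^^ k) f 0 / fact k = of_real (a k)" for k
  proof -
    have "fps_nth ?F k = fps_nth ?A k" using \<open>?F = ?A\<close> by (rule arg_cong)
    then show ?thesis by (simp add: fps_expansion_def)
  qed
  have sums: "(\<lambda>k. of_real (a k) * z ^ k) sums f z" for z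
  proof -
    have "f holomorphic_on ball 0 (norm z + 1)" using f by (rule holomorphic_on_subset) simp
    from holomorphic_power_series[OF this, of z] show ?thesis by (simp add: Fk)
  qed
  have "a 0 \<noteq> 0" using inv[of 0] by auto
  show ?thesis
  proof (rule jensen_zero_free[OF f sums _ _ z])
    fix n :: nat and z :: complex assume "0 < n" "Im z \<noteq> 0"
    note roots = appell_newton_roots[OF TP has_moment _ inv]
    have "(\<Sum>i\<le>n. of_real (a (n - i) * fact n / fact i) * w ^ i) \<noteq> 0" if "Im w \<noteq> 0" for w :: complex
      by (rule appell_monomial_zero_free[OF roots(1) roots(2) \<open>a 0 \<noteq> 0\<close> that]) (auto simp: c_def)
    then show "(\<Sum>k\<le>n. of_real (a k * jensen_weight n k) * z ^ k) \<noteq> 0"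
      using \<open>0 < n\<close> \<open>Im z \<noteq> 0\<close> by (rule jensen_poly_zero_free)
  qed (use nz[of 0] t in simp)
qed

section \<open>Convolutions of Laplace densities\<close>

definition tp_kernel :: "(real \<Rightarrow> real \<Rightarrow> real) \<Rightarrow> bool" where
  "tp_kernel K \<longleftrightarrow> (\<forall>n x y. strict_mono_on {..<n} x \<longrightarrow> strict_mono_on {..<n} y \<longrightarrow>
    0 \<le> Determinant.det (Matrix.mat n n (\<lambda>(i, j). K (x i) (y j))))"

lemma tp_kernelD:
  assumes "tp_kernel K" "strict_mono_on {..<n} x" "strict_mono_on {..<n} y"
  shows "0 \<le> Determinant.det (Matrix.mat n n (\<lambda>(i, j). K (x i) (y j)))"
  using assms unfolding tp_kernel_def by blast

lemma tp_kernel_transpose: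
  assumes "tp_kernel K" shows "tp_kernel (\<lambda>x y. K y x)"
  unfolding tp_kernel_def using tp_kernelD[OF assms] by (subst det_mat_transpose) blast

text \<open>By Andreief's identity a minor of the composition is, up to a factorial, the integral of
  products of a minor of \<open>K\<close> and a minor of \<open>L\<close> at common intermediate
  points. Kernels of two variables are the right setting because scaling rows and columns leaves the
  class of functions of \<open>x - y\<close>.\<close>

lemma tp_kernel_compose:
  assumes K: "tp_kernel K" and L: "tp_kernel L"
    and int: "\<And>x y. integrable lborel (\<lambda>z. K x z * L z y)"
  shows "tp_kernel (\<lambda>x y. \<integral>z. K x z * L z y \<partial>lborel)"
  unfolding tp_kernel_def
proof (intro allI impI)
  fix n and x y :: "nat \<Rightarrow> real" assume x: "strict_mono_on {..<n} x" and y: "strict_mono_on {..<n} y"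
  show "0 \<le> Determinant.det (Matrix.mat n n (\<lambda>(i, j). \<integral>z. K (x i) z * L z (y j) \<partial>lborel))"
  proof (rule det_integral_product_nonneg[OF sigma_finite_lborel, where \<phi> = "\<lambda>i. K (x i)" and \<psi> = "\<lambda>j z. L z (y j)"])
    fix z :: "nat \<Rightarrow> real" assume z: "strict_mono_on {..<n} z"
    show "0 \<le> Determinant.det (Matrix.mat n n (\<lambda>(i, j). K (x j) (z i)))"
      using tp_kernelD[OF tp_kernel_transpose[OF K] z x] .
    show "0 \<le> Determinant.det (Matrix.mat n n (\<lambda>(i, j). L (z i) (y j)))"
      using tp_kernelD[OF L z y] .
  qed (rule int)
qed

lemma tp_kernel_scale:
  assumes "tp_kernel K" "\<And>x. 0 \<le> u x" "\<And>y. 0 \<le> v y"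
  shows "tp_kernel (\<lambda>x y. u x * K x y * v y)"
  unfolding tp_kernel_def
proof (intro allI impI)
  fix n and x y :: "nat \<Rightarrow> real" assume "strict_mono_on {..<n} x" "strict_mono_on {..<n} y"
  then show "0 \<le> Determinant.det (Matrix.mat n n (\<lambda>(i, j). u (x i) * K (x i) (y j) * v (y j)))"
    using tp_kernelD[OF assms(1)] assms(2,3)
    by (subst det_mat_scale[of n "\<lambda>i. u (x i)" "\<lambda>i j. K (x i) (y j)" "\<lambda>j. v (y j)"])
       (auto intro!: mult_nonneg_nonneg prod_nonneg)
qed

text \<open>Either the last two rows coincide, or the last column vanishes off the diagonal.\<close>

lemma tp_kernel_heaviside: "tp_kernel (\<lambda>x y. if y \<le> x then 1 else 0)"
proof -
  have "0 \<le> Determinant.det (Matrix.mat n n (\<lambda>(i, j). if y j \<le> x i then 1 else (0::real)))"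
    if "strict_mono_on {..<n} x" "strict_mono_on {..<n} y" for n and x y :: "nat \<Rightarrow> real"
    using that
  proof (induction n)
    case 0
    then show ?case by (simp add: det_dim_zero)
  next
    case (Suc n)
    let ?A = "Matrix.mat (Suc n) (Suc n) (\<lambda>(i, j). if y j \<le> x i then 1 else (0::real))"
    have x_mono: "x i < x j" if "i < j" "j \<le> n" for i j
      using Suc.prems(1) that by (auto simp: strict_mono_on_def)
    have y_mono: "y i < y j" if "i < j" "j \<le> n" for i j
      using Suc.prems(2) that by (auto simp: strict_mono_on_def)
    have IH: "0 \<le> Determinant.det (Matrix.mat n n (\<lambda>(i, j). if y j \<le> x i then 1 else (0::real)))"
      using Suc.prems by (intro Suc.IH) (auto simp: strict_mono_on_def)
    show ?case
    proof (cases "\<exists>i<n. y n \<le> x i")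
      case True
      then obtain i where i: "i < n" "y n \<le> x i" by blast
      then have "i = n - 1 \<or> i < n - 1" by linarith
      then have "x i \<le> x (n - 1)" using x_mono[of i "n - 1"] by (auto simp: less_imp_le)
      then have *: "y j \<le> x (n - 1)" if "j \<le> n" for j
        using y_mono[of j n] i that by (cases "j = n") auto
      have "x (n - 1) < x n" using i by (intro x_mono) auto
      then have **: "y j \<le> x n" if "j \<le> n" for j using *[OF that] by simp
      have "Matrix.row ?A (n - 1) = Matrix.row ?A n"
        using i * ** by (intro eq_vecI) (auto simp: less_Suc_eq_le)
      then have "Determinant.det ?A = 0"
        using i by (intro det_identical_rows[of _ "Suc n" "n - 1" n]) auto
      then show ?thesis by simp
    next
      case False
      have "Determinant.det ?A = (\<Sum>i<Suc n. ?A $$ (i, n) * cofactor ?A i n)"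
        by (rule laplace_expansion_column) auto
      also have "\<dots> = (\<Sum>i\<in>{n}. ?A $$ (i, n) * cofactor ?A i n)"
        using False by (intro sum.mono_neutral_right) auto
      also have "\<dots> = ?A $$ (n, n) * Determinant.det (mat_delete ?A n n)"
        by (simp add: cofactor_def)
      also have "mat_delete ?A n n = Matrix.mat n n (\<lambda>(i, j). if y j \<le> x i then 1 else (0::real))"
        by (intro eq_matI) (auto simp: mat_delete_def)
      finally show ?thesis using IH by simp
    qed
  qed
  then show ?thesis unfolding tp_kernel_def by blast
qed

section \<open>The two-sided exponential density\<close>

lemma has_bochner_integral_exp_halfline:
  fixes c :: complex
  assumes "0 < Re c"
  shows "has_bochner_integral lborel (\<lambda>x. indicator {0<..} x *\<^sub>R exp (- (c * of_real x))) (1 / c)"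
proof -
  have "((\<lambda>x. exp (- Re c * x)) has_integral exp (- Re c * 0) / Re c) {0..}"
    by (rule has_integral_exp_minus_to_infinity[OF assms])
  then have "(\<lambda>x. exp (- Re c * x)) absolutely_integrable_on {0..}"
    by (intro nonnegative_absolutely_integrable_1) auto
  then have "set_integrable lebesgue {0<..} (\<lambda>x. exp (- Re c * x))"
    by (rule set_integrable_subset) auto
  then have "set_integrable lborel {0<..} (\<lambda>x. exp (- Re c * x))"
    unfolding set_integrable_def by (subst (asm) integrable_completion) auto
  then have int: "set_integrable lborel {0<..} (\<lambda>x. exp (- (c * of_real x)))"
    by (rule set_integrable_bound) (auto simp: set_borel_measurable_def)
  have "(LBINT x=0..\<infinity>. exp (- (c * of_real x))) = 0 - (- (1 / c))"
  proof (rule interval_integral_FTC_integrable[where F = "\<lambda>x. - exp (- (c * of_real x)) / c"])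
    fix x :: real
    show "((\<lambda>x. - exp (- (c * of_real x)) / c) has_vector_derivative exp (- (c * of_real x))) (at x)"
      using assms by (auto intro!: derivative_eq_intros has_vector_derivative_real_field)
    show "isCont (\<lambda>x. exp (- (c * complex_of_real x))) x" by (intro continuous_intros)
  next
    show "set_integrable lborel (einterval 0 \<infinity>) (\<lambda>x. exp (- (c * of_real x)))"
      using int by (simp add: zero_ereal_def)
    have "isCont (\<lambda>x. - exp (- (c * complex_of_real x)) / c) 0"
      using assms by (intro continuous_intros) auto
    then have "((\<lambda>x. - exp (- (c * complex_of_real x)) / c) \<longlongrightarrow> - (1 / c)) (at_right 0)"
      unfolding isCont_def by (auto intro: filterlim_at_split[THEN iffD1, THEN conjunct2])
    then show "(((\<lambda>x. - exp (- (c * complex_of_real x)) / c) \<circ> real_of_ereal) \<longlongrightarrow> - (1 / c)) (at_right 0)"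
      unfolding zero_ereal_def by (subst ereal_tendsto_simps)
    have "((\<lambda>x. exp (- (Re c * x)) / norm c) \<longlongrightarrow> 0) at_top"
    proof -
      have "filterlim (\<lambda>x. Re c * x) at_top at_top"
        by (rule filterlim_tendsto_pos_mult_at_top[OF tendsto_const assms filterlim_ident])
      then have "((\<lambda>x. exp (- (Re c * x))) \<longlongrightarrow> 0) at_top"
        by (intro filterlim_compose[OF exp_at_bot] filterlim_compose[OF filterlim_uminus_at_bot_at_top])
      then have "((\<lambda>x. exp (- (Re c * x)) / norm c) \<longlongrightarrow> 0 / norm c) at_top"
        using assms by (intro tendsto_intros) auto
      then show ?thesis by simp
    qed
    then have "((\<lambda>x. - exp (- (c * complex_of_real x)) / c) \<longlongrightarrow> 0) at_top"
      by (rule Lim_null_comparison[rotated]) (auto simp: norm_divide)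
    then show "(((\<lambda>x. - exp (- (c * complex_of_real x)) / c) \<circ> real_of_ereal) \<longlongrightarrow> 0) (at_left \<infinity>)"
      by (subst ereal_tendsto_simps)
  qed simp_all
  then have "(LINT x:{0<..}|lborel. exp (- (c * of_real x))) = 1 / c"
    by (simp add: interval_lebesgue_integral_def zero_ereal_def)
  then show ?thesis using int
    unfolding set_integrable_def set_lebesgue_integral_def by (simp add: has_bochner_integral_iff)
qed

definition laplace_density :: "real \<Rightarrow> real \<Rightarrow> real" where
  "laplace_density b x = b / 2 * exp (- (b * \<bar>x\<bar>))"

lemma laplace_density_measurable [measurable]: "laplace_density b \<in> borel_measurable borel"
  unfolding laplace_density_def[abs_def] by measurable

lemma laplace_density_nonneg: "0 < b \<Longrightarrow> 0 \<le> laplace_density b x"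
  by (simp add: laplace_density_def)

text \<open>The density splits at the origin into two exponentials with transforms
  \<open>1 / (b + s)\<close> and \<open>1 / (b - s)\<close>, and \<open>b / 2\<close> times their
  sum is \<open>b\<^sup>2 / (b\<^sup>2 - s\<^sup>2)\<close>. Both halves omit the point 0, hence the
  equality almost everywhere.\<close>

lemma laplace_transform_laplace_density:
  assumes b: "0 < b" and s: "\<bar>Re s\<bar> < b"
  shows "has_bochner_integral lborel (\<lambda>x. of_real (laplace_density b x) * exp (- (s * of_real x)))
    (1 / (1 - s\<^sup>2 / of_real (b\<^sup>2)))"
proof -
  define h where "h = (\<lambda>c x. indicator {0<..} x *\<^sub>R exp (- (c * complex_of_real x)))"
  have h1: "has_bochner_integral lborel (h (of_real b + s)) (1 / (of_real b + s))"
    unfolding h_def using s by (intro has_bochner_integral_exp_halfline) auto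
  have "has_bochner_integral lborel (h (of_real b - s)) (1 / (of_real b - s))"
    unfolding h_def using s by (intro has_bochner_integral_exp_halfline) auto
  then have h2: "has_bochner_integral lborel (\<lambda>x. h (of_real b - s) (- x)) (1 / (of_real b - s))"
    by (subst (asm) lborel_has_bochner_integral_real_affine_iff[of "-1" _ _ 0]) auto
  have A: "has_bochner_integral lborel (\<lambda>x. of_real (b / 2) * (h (of_real b + s) x + h (of_real b - s) (- x)))
      (of_real (b / 2) * (1 / (of_real b + s) + 1 / (of_real b - s)))"
    by (intro has_bochner_integral_mult_right has_bochner_integral_add h1 h2)
  have B: "of_real (b / 2) * (1 / (of_real b + s) + 1 / (of_real b - s)) = 1 / (1 - s\<^sup>2 / of_real (b\<^sup>2))"
  proof -
    have "of_real b + s \<noteq> 0" "of_real b - s \<noteq> 0" "complex_of_real b \<noteq> 0" using s b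
      by (auto simp: complex_eq_iff)
    moreover have "1 - s\<^sup>2 / of_real (b\<^sup>2) = (of_real b + s) * (of_real b - s) / of_real b ^ 2"
      using b by (simp add: field_simps power2_eq_square)
    ultimately show ?thesis by (simp add: field_simps power2_eq_square)
  qed
  have C: "AE x in lborel. of_real (b / 2) * (h (of_real b + s) x + h (of_real b - s) (- x)) =
      of_real (laplace_density b x) * exp (- (s * of_real x))"
  proof -
    have "AE x in lborel. x \<noteq> (0::real)" by (rule AE_lborel_singleton)
    then show ?thesis
    proof eventually_elim
      case (elim x)
      then show ?case
      proof (cases "x > 0")
        case True
        then show ?thesis by (simp add: h_def laplace_density_def exp_of_real[symmetric] exp_add[symmetric] algebra_simps)
      next
        case False
        with elim show ?thesis by (simp add: h_def laplace_density_def exp_of_real[symmetric] exp_add[symmetric] algebra_simps)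
      qed
    qed
  qed
  show ?thesis by (rule has_bochner_integralI_AE[OF A[unfolded B] _ C]) simp
qed

lemma laplace_density_exp_integral:
  assumes b: "0 < b" and \<sigma>: "\<bar>\<sigma>\<bar> < b"
  shows "has_bochner_integral lborel (\<lambda>x. laplace_density b x * exp (\<sigma> * x)) (1 / (1 - \<sigma>\<^sup>2 / b\<^sup>2))"
proof -
  have "has_bochner_integral lborel (\<lambda>x. of_real (laplace_density b x) * exp (- (of_real (-\<sigma>) * of_real x)))
    (1 / (1 - (of_real (-\<sigma>))\<^sup>2 / complex_of_real (b\<^sup>2)))"
    using assms by (intro laplace_transform_laplace_density) auto
  from has_bochner_integral_bounded_linear[OF bounded_linear_Re this]
  have "has_bochner_integral lborel (\<lambda>x. Re (of_real (laplace_density b x * exp (\<sigma> * x))))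
      (Re (of_real (1 / (1 - \<sigma>\<^sup>2 / b\<^sup>2))))"
    by (simp add: exp_of_real[symmetric] del: Re_complex_of_real)
  then show ?thesis by (simp only: Re_complex_of_real)
qed

text \<open>Up to the factor \<open>b\<^sup>2\<close> the density is the composition of the
  one-sided kernel \<open>exp (- b * (x - z))\<close> on \<open>z \<le> x\<close> with its
  transpose, and the one-sided kernel is the Heaviside kernel with rows and columns scaled by
  exponentials.\<close>

lemma tp_kernel_laplace_density:
  assumes b: "0 < b"
  shows "tp_kernel (\<lambda>x y. laplace_density b (x - y))"
proof -
  define K where "K = (\<lambda>x z. exp (- b * x) * (if z \<le> x then 1 else 0) * exp (b * z))"
  have K: "tp_kernel K"
    unfolding K_def by (intro tp_kernel_scale tp_kernel_heaviside) auto
  have prod: "has_bochner_integral lborel (\<lambda>z. K x z * K y z) (exp (- (b * \<bar>x - y\<bar>)) / (2 * b))" for x y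
  proof -
    \<comment> \<open>Both factors live on \<open>z \<le> min x y\<close>; reflection in this
      endpoint moves the integral to the positive half-line.\<close>
    let ?m = "min x y"
    have "has_bochner_integral lborel (\<lambda>z. indicator {0<..} z *\<^sub>R exp (- (of_real (2 * b) * of_real z))) (1 / complex_of_real (2 * b))"
      using b by (intro has_bochner_integral_exp_halfline) auto
    from has_bochner_integral_bounded_linear[OF bounded_linear_Re this]
    have "has_bochner_integral lborel (\<lambda>z. Re (of_real (indicator {0<..} z * exp (- (2 * b * z))))) (Re (of_real (1 / (2 * b))))"
      by (simp add: exp_of_real[symmetric] scaleR_conv_of_real del: Re_complex_of_real)
    then have "has_bochner_integral lborel (\<lambda>z. indicator {0<..} z * exp (- (2 * b * z))) (1 / (2 * b))"
      by (simp only: Re_complex_of_real)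
    then have "has_bochner_integral lborel (\<lambda>z. indicator {0<..} (?m + (-1) * z) * exp (- (2 * b * (?m + (-1) * z)))) (1 / (2 * b))"
      by (subst (asm) lborel_has_bochner_integral_real_affine_iff[of "-1" _ _ ?m]) auto
    then have *: "has_bochner_integral lborel (\<lambda>z. exp (- b * (x + y) + 2 * b * ?m) *
        (indicator {0<..} (?m + (-1) * z) * exp (- (2 * b * (?m + (-1) * z)))))
        (exp (- b * (x + y) + 2 * b * ?m) * (1 / (2 * b)))"
      by (rule has_bochner_integral_mult_right)
    have "AE z in lborel. z \<noteq> ?m" by (rule AE_lborel_singleton)
    then have ae: "AE z in lborel. exp (- b * (x + y) + 2 * b * ?m) *
        (indicator {0<..} (?m + (-1) * z) * exp (- (2 * b * (?m + (-1) * z)))) = K x z * K y z"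
    proof eventually_elim
      case (elim z)
      then show ?case
        by (cases "z < ?m") (auto simp: K_def exp_add[symmetric] algebra_simps mult_exp_exp)
    qed
    have "exp (- b * (x + y) + 2 * b * ?m) * (1 / (2 * b)) = exp (- (b * \<bar>x - y\<bar>)) / (2 * b)"
      by (auto simp: min_def abs_if algebra_simps)
    moreover have "(\<lambda>z. K x z * K y z) \<in> borel_measurable lborel" unfolding K_def by measurable
    ultimately show ?thesis using * ae by (auto intro: has_bochner_integralI_AE)
  qed
  have "tp_kernel (\<lambda>x y. \<integral>z. K x z * K y z \<partial>lborel)"
    using prod by (intro tp_kernel_compose[OF K tp_kernel_transpose[OF K]]) (auto simp: has_bochner_integral_iff)
  then have "tp_kernel (\<lambda>x y. b\<^sup>2 * (\<integral>z. K x z * K y z \<partial>lborel) * 1)"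
    by (rule tp_kernel_scale) auto
  moreover have "b\<^sup>2 * (\<integral>z. K x z * K y z \<partial>lborel) * 1 = laplace_density b (x - y)" for x y
    unfolding has_bochner_integral_integral_eq[OF prod] laplace_density_def
    using b by (simp add: power2_eq_square field_simps)
  ultimately show ?thesis by simp
qed

section \<open>Estimates preserved by convolution\<close>

lemma has_bochner_integral_convolution:
  fixes \<phi> g :: "real \<Rightarrow> complex"
  assumes \<phi>: "integrable lborel \<phi>" and g: "integrable lborel g"
  shows "has_bochner_integral lborel (\<lambda>x. \<integral>y. \<phi> y * g (x - y) \<partial>lborel) (integral\<^sup>L lborel \<phi> * integral\<^sup>L lborel g)"
proof -
  have [measurable]: "\<phi> \<in> borel_measurable borel" "g \<in> borel_measurable borel" using \<phi> g by auto
  have shift: "integrable lborel (\<lambda>x. g (x - y))" "(\<integral>x. g (x - y) \<partial>lborel) = integral\<^sup>L lborel g"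
    "(\<integral>x. norm (g (x - y)) \<partial>lborel) = (\<integral>x. norm (g x) \<partial>lborel)" for y
    using lborel_integrable_real_affine[OF g, of 1 "-y"] lborel_integral_real_affine[of 1 g "-y"]
      lborel_integral_real_affine[of 1 "\<lambda>x. norm (g x)" "-y"] by auto
  have int: "integrable (lborel \<Otimes>\<^sub>M lborel) (\<lambda>(y, x). \<phi> y * g (x - y))"
  proof (rule lborel_pair.Fubini_integrable)
    show "(\<lambda>(y, x). \<phi> y * g (x - y)) \<in> borel_measurable (lborel \<Otimes>\<^sub>M lborel)" by measurable
    show "integrable lborel (\<lambda>y. \<integral>x. norm (case (y, x) of (y, x) \<Rightarrow> \<phi> y * g (x - y)) \<partial>lborel)"
      using \<phi> by (simp add: norm_mult shift)
    show "AE y in lborel. integrable lborel (\<lambda>x. case (y, x) of (y, x) \<Rightarrow> \<phi> y * g (x - y))"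
      using shift by simp
  qed
  have "integrable lborel (\<lambda>x. \<integral>y. \<phi> y * g (x - y) \<partial>lborel)"
    using lborel_pair.integrable_snd[of "\<lambda>y x. \<phi> y * g (x - y)"] int by simp
  moreover have "(\<integral>x. (\<integral>y. \<phi> y * g (x - y) \<partial>lborel) \<partial>lborel) = (\<integral>y. (\<integral>x. \<phi> y * g (x - y) \<partial>lborel) \<partial>lborel)"
    by (rule lborel_pair.Fubini_integral[OF int])
  ultimately show ?thesis by (simp add: has_bochner_integral_iff shift)
qed

text \<open>The properties are chosen so as to be inherited by convolutions with further densities
  and to suffice for a limit: \<open>L\<close> gives equicontinuity, \<open>C\<close> gives
  dominating functions for the Laplace integrals, and \<open>R\<close> records the
  transform.\<close>

definition laplace_bounds ::
  "real \<Rightarrow> real \<Rightarrow> (real \<Rightarrow> real) \<Rightarrow> (complex \<Rightarrow> complex) \<Rightarrow> (real \<Rightarrow> real) \<Rightarrow> bool" where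
  "laplace_bounds a L C R f \<longleftrightarrow>
    (\<forall>x. 0 \<le> f x) \<and> (\<forall>x y. \<bar>f x - f y\<bar> \<le> L * \<bar>x - y\<bar>) \<and> tp_kernel (\<lambda>x y. f (x - y)) \<and>
    (\<forall>\<sigma> x. \<bar>\<sigma>\<bar> < a \<longrightarrow> f x * exp (\<sigma> * x) \<le> C \<sigma>) \<and>
    (\<forall>s. \<bar>Re s\<bar> < a \<longrightarrow> has_bochner_integral lborel (\<lambda>x. of_real (f x) * exp (- (s * of_real x))) (R s))"

lemma continuous_on_lipschitz_real:
  fixes f :: "real \<Rightarrow> real"
  assumes "\<And>x y. \<bar>f x - f y\<bar> \<le> L * \<bar>x - y\<bar>"
  shows "continuous_on UNIV f"
proof -
  have "L-lipschitz_on UNIV f"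
  proof (rule lipschitz_onI)
    show "0 \<le> L" using order_trans[OF abs_ge_zero assms[of 1 0]] by simp
  qed (use assms in \<open>simp add: dist_real_def\<close>)
  then show ?thesis by (rule lipschitz_on_continuous_on)
qed

lemma exp_minus_diff_le:
  fixes u v :: real assumes "0 \<le> u" "0 \<le> v"
  shows "\<bar>exp (- u) - exp (- v)\<bar> \<le> \<bar>u - v\<bar>"
proof -
  have *: "exp (- u) - exp (- v) \<le> v - u" if "0 \<le> u" "u \<le> v" for u v :: real
  proof -
    have "exp (- u) - exp (- v) = exp (- u) * (1 - exp (- (v - u)))"
      by (simp add: algebra_simps exp_add[symmetric])
    also have "\<dots> \<le> 1 * (1 - exp (- (v - u)))" using that by (intro mult_right_mono) auto
    also have "\<dots> \<le> v - u"
    proof -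
      have le: "1 + - (v - u) \<le> E \<Longrightarrow> 1 * (1 - E) \<le> v - u" for E :: real by simp
      show ?thesis by (rule le[OF exp_ge_add_one_self])
    qed
    finally show ?thesis .
  qed
  show ?thesis using *[of u v] *[of v u] assms by (cases "u \<le> v") (auto simp: abs_if)
qed

text \<open>The Lipschitz constant is the height \<open>a / 2\<close> times the slope
  \<open>a\<close> of the exponent; since \<open>\<sigma> * x \<le> a * \<bar>x\<bar>\<close>, the
  weighted values never exceed the height.\<close>

lemma laplace_bounds_laplace_density:
  assumes a: "0 < a"
  shows "laplace_bounds a (a\<^sup>2 / 2) (\<lambda>_. a / 2) (\<lambda>s. 1 / (1 - s\<^sup>2 / of_real (a\<^sup>2))) (laplace_density a)"
  unfolding laplace_bounds_def
proof (intro conjI allI impI)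
  fix x y
  have "\<bar>exp (- (a * \<bar>x\<bar>)) - exp (- (a * \<bar>y\<bar>))\<bar> \<le> \<bar>a * \<bar>x\<bar> - a * \<bar>y\<bar>\<bar>"
    using a by (intro exp_minus_diff_le) auto
  also have "\<dots> = a * \<bar>\<bar>x\<bar> - \<bar>y\<bar>\<bar>" using a by (simp add: abs_mult right_diff_distrib[symmetric])
  also have "\<dots> \<le> a * \<bar>x - y\<bar>" using a by (intro mult_left_mono) auto
  finally have "a / 2 * \<bar>exp (- (a * \<bar>x\<bar>)) - exp (- (a * \<bar>y\<bar>))\<bar> \<le> a / 2 * (a * \<bar>x - y\<bar>)"
    using a by (intro mult_left_mono) auto
  then show "\<bar>laplace_density a x - laplace_density a y\<bar> \<le> a\<^sup>2 / 2 * \<bar>x - y\<bar>"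
  proof -
    have "\<bar>laplace_density a x - laplace_density a y\<bar> = a / 2 * \<bar>exp (- (a * \<bar>x\<bar>)) - exp (- (a * \<bar>y\<bar>))\<bar>"
      unfolding laplace_density_def right_diff_distrib[symmetric] abs_mult using a by simp
    then show ?thesis using \<open>_ \<le> a / 2 * (a * \<bar>x - y\<bar>)\<close> by (simp add: power2_eq_square)
  qed
next
  fix \<sigma> x :: real assume \<sigma>: "\<bar>\<sigma>\<bar> < a"
  have "\<sigma> * x \<le> \<bar>\<sigma>\<bar> * \<bar>x\<bar>" unfolding abs_mult[symmetric] by (rule abs_ge_self)
  also have "\<dots> \<le> a * \<bar>x\<bar>" using \<sigma> by (intro mult_right_mono) auto
  finally have "\<sigma> * x \<le> a * \<bar>x\<bar>" .
  then have "exp (- (a * \<bar>x\<bar>) + \<sigma> * x) \<le> 1" by (subst exp_le_one_iff) linarith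
  then have "a / 2 * exp (- (a * \<bar>x\<bar>) + \<sigma> * x) \<le> a / 2 * 1" using a by (intro mult_left_mono) auto
  then show "laplace_density a x * exp (\<sigma> * x) \<le> a / 2"
    by (simp only: laplace_density_def exp_add mult.assoc mult_1_right)
qed (use a in \<open>auto intro: laplace_density_nonneg tp_kernel_laplace_density laplace_transform_laplace_density simp del: of_real_power\<close>)

definition laplace_conv :: "real \<Rightarrow> (real \<Rightarrow> real) \<Rightarrow> real \<Rightarrow> real" where
  "laplace_conv b f x = (\<integral>y. laplace_density b y * f (x - y) \<partial>lborel)"

text \<open>Averaging against a probability density keeps the Lipschitz constant. The weighted bound
  picks up the exponential moment \<open>1 / (1 - \<sigma>\<^sup>2 / b\<^sup>2)\<close>, finite
  because \<open>\<bar>\<sigma>\<bar> < a \<le> b\<close>, and the transforms multiply.\<close>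

lemma laplace_bounds_conv:
  assumes a: "0 < a" and ab: "a \<le> b" and f: "laplace_bounds a L C R f"
  shows "laplace_bounds a L (\<lambda>\<sigma>. C \<sigma> * (1 / (1 - \<sigma>\<^sup>2 / b\<^sup>2))) (\<lambda>s. (1 / (1 - s\<^sup>2 / of_real (b\<^sup>2))) * R s) (laplace_conv b f)"
proof -
  have b: "0 < b" using a ab by simp
  have nn: "0 \<le> f x" and lip: "\<bar>f x - f y\<bar> \<le> L * \<bar>x - y\<bar>" and tp: "tp_kernel (\<lambda>x y. f (x - y))"
    and C: "\<bar>\<sigma>\<bar> < a \<Longrightarrow> f x * exp (\<sigma> * x) \<le> C \<sigma>"
    and R: "\<bar>Re s\<bar> < a \<Longrightarrow> has_bochner_integral lborel (\<lambda>x. of_real (f x) * exp (- (s * of_real x))) (R s)"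
    for x y \<sigma> s using f by (auto simp: laplace_bounds_def)
  have "continuous_on UNIV f" using lip by (rule continuous_on_lipschitz_real)
  then have meas [measurable]: "f \<in> borel_measurable borel" by (rule borel_measurable_continuous_onI)
  have f_le: "f x \<le> C 0" for x using C[of 0 x] a by simp
  have dens: "has_bochner_integral lborel (laplace_density b) 1"
    using laplace_density_exp_integral[OF b, of 0] b by simp
  have dens_int: "integrable lborel (laplace_density b)" using dens by (rule integrable.intros)
  have int: "integrable lborel (\<lambda>y. laplace_density b y * f (x - y))" for x
  proof (rule Bochner_Integration.integrable_bound)
    show "integrable lborel (\<lambda>y. laplace_density b y * C 0)" using dens_int by simp
    show "AE y in lborel. norm (laplace_density b y * f (x - y)) \<le> norm (laplace_density b y * C 0)"
      using nn f_le b order_trans[OF nn f_le]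
      by (intro AE_I2) (auto simp: abs_mult laplace_density_nonneg intro!: mult_left_mono)
  qed measurable
  show ?thesis
    unfolding laplace_bounds_def
  proof (intro conjI allI impI)
    show "0 \<le> laplace_conv b f x" for x
      unfolding laplace_conv_def using nn b by (intro Bochner_Integration.integral_nonneg) (auto simp: laplace_density_nonneg)
  next
    fix x y
    have "\<bar>laplace_conv b f x - laplace_conv b f y\<bar> =
        norm (\<integral>z. laplace_density b z * f (x - z) - laplace_density b z * f (y - z) \<partial>lborel)"
      unfolding laplace_conv_def using int by (subst Bochner_Integration.integral_diff) auto
    also have "\<dots> \<le> (\<integral>z. laplace_density b z * (L * \<bar>x - y\<bar>) \<partial>lborel)"
    proof (rule Bochner_Integration.integral_norm_bound_integral)
      fix z
      have "\<bar>f (x - z) - f (y - z)\<bar> \<le> L * \<bar>x - y\<bar>" using lip[of "x - z" "y - z"] by simp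
      then show "norm (laplace_density b z * f (x - z) - laplace_density b z * f (y - z)) \<le> laplace_density b z * (L * \<bar>x - y\<bar>)"
        using laplace_density_nonneg[OF b, of z]
        by (simp add: right_diff_distrib[symmetric] abs_mult mult_left_mono)
    qed (use int dens_int in auto)
    also have "\<dots> = L * \<bar>x - y\<bar>" using dens by (simp add: has_bochner_integral_iff)
    finally show "\<bar>laplace_conv b f x - laplace_conv b f y\<bar> \<le> L * \<bar>x - y\<bar>" .
  next
    have shift: "has_bochner_integral lborel (\<lambda>z. laplace_density b (x - z) * f (z - y)) (laplace_conv b f (x - y))" for x y
    proof -
      have "has_bochner_integral lborel (\<lambda>u. laplace_density b u * f (x - y - u)) (laplace_conv b f (x - y))"
        unfolding laplace_conv_def by (rule has_bochner_integral_integrable[OF int])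
      then show ?thesis
        by (subst (asm) lborel_has_bochner_integral_real_affine_iff[of "-1" _ _ x]) (auto simp: algebra_simps)
    qed
    have "tp_kernel (\<lambda>x y. \<integral>z. laplace_density b (x - z) * f (z - y) \<partial>lborel)"
      using shift by (intro tp_kernel_compose tp_kernel_laplace_density b tp) (auto simp: has_bochner_integral_iff)
    then show "tp_kernel (\<lambda>x y. laplace_conv b f (x - y))"
      using has_bochner_integral_integral_eq[OF shift] by simp
  next
    fix \<sigma> x assume \<sigma>: "\<bar>\<sigma>\<bar> < a"
    then have "\<bar>\<sigma>\<bar> < b" using ab by simp
    note D = laplace_density_exp_integral[OF b this]
    have "laplace_conv b f x * exp (\<sigma> * x) = (\<integral>y. laplace_density b y * exp (\<sigma> * y) * (f (x - y) * exp (\<sigma> * (x - y))) \<partial>lborel)"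
      unfolding laplace_conv_def
      by (subst integral_mult_left_zero[symmetric])
         (simp add: algebra_simps mult_exp_exp exp_add[symmetric] exp_diff)
    also have "\<dots> \<le> (\<integral>y. laplace_density b y * exp (\<sigma> * y) * C \<sigma> \<partial>lborel)"
    proof (rule integral_mono_AE')
      show "integrable lborel (\<lambda>y. laplace_density b y * exp (\<sigma> * y) * C \<sigma>)"
        using D by (auto simp: has_bochner_integral_iff)
    qed (use C[OF \<sigma>] nn b order_trans[OF mult_nonneg_nonneg[OF nn exp_ge_zero] C[OF \<sigma>]] in \<open>auto intro!: AE_I2 mult_left_mono mult_nonneg_nonneg laplace_density_nonneg\<close>)
    also have "\<dots> = C \<sigma> * (1 / (1 - \<sigma>\<^sup>2 / b\<^sup>2))"
      using D by (simp add: has_bochner_integral_iff)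
    finally show "laplace_conv b f x * exp (\<sigma> * x) \<le> C \<sigma> * (1 / (1 - \<sigma>\<^sup>2 / b\<^sup>2))" .
  next
    fix s :: complex assume s: "\<bar>Re s\<bar> < a"
    then have "\<bar>Re s\<bar> < b" using ab by simp
    note D = laplace_transform_laplace_density[OF b this]
    let ?\<phi> = "\<lambda>x. of_real (laplace_density b x) * exp (- (s * of_real x))"
    let ?g = "\<lambda>x. of_real (f x) * exp (- (s * of_real x))"
    have "has_bochner_integral lborel (\<lambda>x. \<integral>y. ?\<phi> y * ?g (x - y) \<partial>lborel)
        (1 / (1 - s\<^sup>2 / of_real (b\<^sup>2)) * R s)"
      using has_bochner_integral_convolution[of ?\<phi> ?g] D R[OF s] by (simp add: has_bochner_integral_iff)
    moreover have "(\<integral>y. ?\<phi> y * ?g (x - y) \<partial>lborel) = of_real (laplace_conv b f x) * exp (- (s * of_real x))" for x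
    proof -
      have "?\<phi> y * ?g (x - y) = of_real (laplace_density b y * f (x - y)) * exp (- (s * of_real x))" for y
        by (simp add: algebra_simps exp_diff exp_minus field_simps)
      then have "(\<integral>y. ?\<phi> y * ?g (x - y) \<partial>lborel) =
          (\<integral>y. complex_of_real (laplace_density b y * f (x - y)) * exp (- (s * of_real x)) \<partial>lborel)"
        by (intro Bochner_Integration.integral_cong refl)
      also have "\<dots> = (\<integral>y. complex_of_real (laplace_density b y * f (x - y)) \<partial>lborel) * exp (- (s * of_real x))"
        by (rule integral_mult_left_zero)
      finally show ?thesis by (simp only: integral_complex_of_real laplace_conv_def)
    qed
    ultimately show "has_bochner_integral lborel (\<lambda>x. of_real (laplace_conv b f x) * exp (- (s * of_real x)))
        (1 / (1 - s\<^sup>2 / of_real (b\<^sup>2)) * R s)" by simp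
  qed
qed

text \<open>The density with parameter \<open>a\<close> starts the induction, so the Lipschitz
  constant does not depend on the list. Each \<open>w\<close> contributes a convolution with the
  density of parameter \<open>sqrt w\<close>.\<close>

lemma laplace_bounds_list:
  assumes a: "0 < a" and "\<And>w. w \<in> set ws \<Longrightarrow> a\<^sup>2 \<le> w"
  shows "\<exists>f. laplace_bounds a (a\<^sup>2 / 2) (\<lambda>\<sigma>. a / 2 * (\<Prod>w\<leftarrow>ws. 1 / (1 - \<sigma>\<^sup>2 / w)))
    (\<lambda>s. 1 / (1 - s\<^sup>2 / of_real (a\<^sup>2)) * (\<Prod>w\<leftarrow>ws. 1 / (1 - s\<^sup>2 / of_real w))) f"
  using assms(2)
proof (induction ws)
  case Nil
  then show ?case using laplace_bounds_laplace_density[OF a] by auto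
next
  case (Cons w ws)
  then obtain f where f: "laplace_bounds a (a\<^sup>2 / 2) (\<lambda>\<sigma>. a / 2 * (\<Prod>w\<leftarrow>ws. 1 / (1 - \<sigma>\<^sup>2 / w)))
    (\<lambda>s. 1 / (1 - s\<^sup>2 / of_real (a\<^sup>2)) * (\<Prod>w\<leftarrow>ws. 1 / (1 - s\<^sup>2 / of_real w))) f" by auto
  have w: "a\<^sup>2 \<le> w" using Cons.prems by simp
  moreover have "0 \<le> a\<^sup>2" by simp
  ultimately have "0 \<le> w" by linarith
  then have sq: "(sqrt w)\<^sup>2 = w" by simp
  have "a \<le> sqrt w" using w a by (simp add: real_le_rsqrt)
  from laplace_bounds_conv[OF a this f] show ?case
    unfolding sq by (intro exI[of _ "laplace_conv (sqrt w) f"]) (simp only: list.map prod_list.Cons mult_ac)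
qed

text \<open>A diagonal subsequence converges on the rationals, and by the common Lipschitz constant
  everywhere. The transforms converge along the whole sequence, so dominated convergence identifies
  the transform of the limit.\<close>

lemma laplace_bounds_limit:
  assumes a: "0 < a" and f: "\<And>n. laplace_bounds a L (C n) (R n) (f n)"
    and C: "\<And>\<sigma>. \<bar>\<sigma>\<bar> < a \<Longrightarrow> \<exists>B. \<forall>n. C n \<sigma> \<le> B"
    and R: "\<And>s. \<bar>Re s\<bar> < a \<Longrightarrow> (\<lambda>n. R n s) \<longlonglongrightarrow> S s"
  obtains g where "\<And>x. 0 \<le> g x" "continuous_on UNIV g" "tp_kernel (\<lambda>x y. g (x - y))"
    "\<And>s. \<bar>Re s\<bar> < a \<Longrightarrow> has_bochner_integral lborel (\<lambda>x. of_real (g x) * exp (- (s * of_real x))) (S s)"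
proof -
  have nn: "0 \<le> f n x" and lip: "\<bar>f n x - f n y\<bar> \<le> L * \<bar>x - y\<bar>" and tp: "tp_kernel (\<lambda>x y. f n (x - y))"
    and fC: "\<bar>\<sigma>\<bar> < a \<Longrightarrow> f n x * exp (\<sigma> * x) \<le> C n \<sigma>"
    and fR: "\<bar>Re s\<bar> < a \<Longrightarrow> has_bochner_integral lborel (\<lambda>x. of_real (f n x) * exp (- (s * of_real x))) (R n s)"
    for n x y \<sigma> s using f[of n] by (auto simp: laplace_bounds_def)
  have L: "0 \<le> L" using order_trans[OF abs_ge_zero lip[of 0 1 0]] by simp
  obtain B where B: "\<And>n. C n 0 \<le> B" using C[of 0] a by auto
  have fB: "norm (f n x) \<le> B" for n x using fC[of 0 n x] nn[of n x] B[of n] a by simp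
  obtain k :: "nat \<Rightarrow> nat" where k: "strict_mono k"
      and kq: "\<And>q. q \<in> \<rat> \<Longrightarrow> \<exists>l. (\<lambda>n. f (k n) q) \<longlonglongrightarrow> l"
    using function_convergent_subsequence[OF countable_rat, of f B] fB by blast
  have "convergent (\<lambda>n. f (k n) x)" for x
  proof (intro Cauchy_convergent metric_CauchyI)
    fix e :: real assume e: "0 < e"
    \<comment> \<open>The denominator has \<open>L + 1\<close> because \<open>L\<close> may be
      0.\<close>
    define d where "d = e / (3 * (L + 1))"
    have d: "0 < d" "L * d < e / 3" using e L by (auto simp: d_def field_simps)
    obtain q where q: "q \<in> \<rat>" "x < q" "q < x + d" using Rats_dense_in_real[of x "x + d"] d by auto
    have "Cauchy (\<lambda>n. f (k n) q)" using kq[OF q(1)] by (auto intro: LIMSEQ_imp_Cauchy)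
    then obtain M where M: "\<And>m n. M \<le> m \<Longrightarrow> M \<le> n \<Longrightarrow> dist (f (k m) q) (f (k n) q) < e / 3"
      using metric_CauchyD[of _ "e / 3"] e by (metis divide_pos_pos zero_less_numeral)
    have near: "\<bar>f n x - f n q\<bar> < e / 3" for n
    proof -
      have "L * \<bar>x - q\<bar> \<le> L * d" using q L by (intro mult_left_mono) auto
      then show ?thesis using lip[of n x q] d by linarith
    qed
    show "\<exists>M. \<forall>m\<ge>M. \<forall>n\<ge>M. dist (f (k m) x) (f (k n) x) < e"
    proof (intro exI allI impI)
      fix m n assume "M \<le> m" "M \<le> n"
      then show "dist (f (k m) x) (f (k n) x) < e"
        using M[of m n] near[of "k m"] near[of "k n"] unfolding dist_real_def by linarith
    qed
  qed
  then obtain g where g: "\<And>x. (\<lambda>n. f (k n) x) \<longlonglongrightarrow> g x" unfolding convergent_def by metis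
  have g_nn: "0 \<le> g x" for x by (rule LIMSEQ_le_const[OF g]) (use nn in auto)
  have "\<bar>g x - g y\<bar> \<le> L * \<bar>x - y\<bar>" for x y
    by (rule LIMSEQ_le_const2[OF tendsto_rabs[OF tendsto_diff[OF g g]]]) (use lip in auto)
  then have g_cont: "continuous_on UNIV g" by (rule continuous_on_lipschitz_real)
  have g_tp: "tp_kernel (\<lambda>x y. g (x - y))"
    unfolding tp_kernel_def
  proof (intro allI impI)
    fix n and x y :: "nat \<Rightarrow> real" assume xy: "strict_mono_on {..<n} x" "strict_mono_on {..<n} y"
    have "(\<lambda>m. Determinant.det (Matrix.mat n n (\<lambda>(i, j). f (k m) (x i - y j)))) \<longlonglongrightarrow>
        Determinant.det (Matrix.mat n n (\<lambda>(i, j). g (x i - y j)))"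
      unfolding det_mat_eq by (intro tendsto_intros g)
    then show "0 \<le> Determinant.det (Matrix.mat n n (\<lambda>(i, j). g (x i - y j)))"
      by (rule LIMSEQ_le_const) (use tp_kernelD[OF tp xy] in auto)
  qed
  have "has_bochner_integral lborel (\<lambda>x. of_real (g x) * exp (- (s * of_real x))) (S s)" if s: "\<bar>Re s\<bar> < a" for s
  proof -
    \<comment> \<open>A point strictly between \<open>\<bar>Re s\<bar>\<close> and \<open>a\<close>.
      The bounds at \<open>\<sigma>\<close> and \<open>- \<sigma>\<close> leave the decay
      \<open>exp (- (\<delta> * \<bar>x\<bar>))\<close> after multiplication by
      \<open>exp (- (Re s * x))\<close>.\<close>
    define \<sigma> where "\<sigma> = (\<bar>Re s\<bar> + a) / 2"
    define \<delta> where "\<delta> = \<sigma> - \<bar>Re s\<bar>"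
    have \<sigma>: "0 < \<sigma>" "\<sigma> < a" "0 < \<delta>" using s by (auto simp: \<sigma>_def \<delta>_def)
    obtain B1 where B1: "\<And>n. C n \<sigma> \<le> B1" using C[of \<sigma>] \<sigma> by auto
    obtain B2 where B2: "\<And>n. C n (- \<sigma>) \<le> B2" using C[of "- \<sigma>"] \<sigma> by auto
    define D where "D = max B1 B2"
    have dom: "f n x * exp (- (Re s * x)) \<le> D * exp (- (\<delta> * \<bar>x\<bar>))" for n x
    proof -
      have "f n x * exp (\<sigma> * \<bar>x\<bar>) \<le> D"
        using fC[of \<sigma> n x] fC[of "- \<sigma>" n x] B1[of n] B2[of n] \<sigma> by (cases "x \<ge> 0") (auto simp: D_def)
      then have "f n x * exp (\<sigma> * \<bar>x\<bar>) * exp (- (\<sigma> * \<bar>x\<bar>) - Re s * x) \<le> D * exp (- (\<sigma> * \<bar>x\<bar>) - Re s * x)"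
        by (rule mult_right_mono) simp
      also have "\<dots> \<le> D * exp (- (\<delta> * \<bar>x\<bar>))"
      proof (rule mult_left_mono)
        have "- (Re s * x) \<le> \<bar>Re s\<bar> * \<bar>x\<bar>" by (metis abs_ge_minus_self abs_mult)
        then show "exp (- (\<sigma> * \<bar>x\<bar>) - Re s * x) \<le> exp (- (\<delta> * \<bar>x\<bar>))"
          by (simp add: \<delta>_def left_diff_distrib)
        have "0 \<le> f n x * exp (\<sigma> * \<bar>x\<bar>)" using nn by simp
        then show "0 \<le> D" using \<open>f n x * exp (\<sigma> * \<bar>x\<bar>) \<le> D\<close> by linarith
      qed
      finally show ?thesis by (simp add: mult.assoc exp_add[symmetric])
    qed
    have int: "integrable lborel (\<lambda>x. D * exp (- (\<delta> * \<bar>x\<bar>)))"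
    proof -
      have "integrable lborel (\<lambda>x. D * (2 / \<delta>) * laplace_density \<delta> x)"
        using laplace_density_exp_integral[OF \<sigma>(3), of 0] \<sigma> by (auto simp: has_bochner_integral_iff)
      then show ?thesis using \<sigma> by (simp add: laplace_density_def)
    qed
    have gm [measurable]: "g \<in> borel_measurable borel" using g_cont by (rule borel_measurable_continuous_onI)
    have fm [measurable]: "f n \<in> borel_measurable borel" for n
      using continuous_on_lipschitz_real[OF lip] by (rule borel_measurable_continuous_onI)
    have lim: "AE x in lborel. (\<lambda>n. of_real (f (k n) x) * exp (- (s * of_real x))) \<longlonglongrightarrow> of_real (g x) * exp (- (s * of_real x))"
      by (intro AE_I2 tendsto_intros g)
    have bound: "AE x in lborel. norm (of_real (f (k n) x) * exp (- (s * of_real x))) \<le> D * exp (- (\<delta> * \<bar>x\<bar>))" for n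
      using dom nn by (intro AE_I2) (simp add: norm_mult)
    have dc: "integrable lborel (\<lambda>x. of_real (g x) * exp (- (s * of_real x)))"
      by (rule integrable_dominated_convergence[OF _ _ int lim bound]) measurable
    have "(\<lambda>n. \<integral>x. of_real (f (k n) x) * exp (- (s * of_real x)) \<partial>lborel) \<longlonglongrightarrow>
          (\<integral>x. of_real (g x) * exp (- (s * of_real x)) \<partial>lborel)"
      by (rule integral_dominated_convergence[OF _ _ int lim bound]) measurable
    then have dc2: "(\<lambda>n. R (k n) s) \<longlonglongrightarrow> (\<integral>x. of_real (g x) * exp (- (s * of_real x)) \<partial>lborel)"
      by (simp add: has_bochner_integral_integral_eq[OF fR[OF s]])
    have "(\<lambda>n. R (k n) s) \<longlonglongrightarrow> S s"
      using LIMSEQ_subseq_LIMSEQ[OF R[OF s] k] by (simp add: o_def)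
    then have "(\<integral>x. of_real (g x) * exp (- (s * of_real x)) \<partial>lborel) = S s"
      using dc2 by (rule LIMSEQ_unique[rotated])
    then show ?thesis using dc by (simp add: has_bochner_integral_iff)
  qed
  then show thesis using that[OF g_nn g_cont g_tp] by blast
qed

section \<open>Entire functions with prescribed zeros\<close>

lemma norm_ge_of_zeros_product:
  fixes ws :: "complex list"
  assumes "\<And>w. w \<in> set ws \<Longrightarrow> w \<noteq> 0 \<and> norm w \<le> R" "norm z = 4 * R"
  shows "3 ^ length ws \<le> norm (\<Prod>w\<leftarrow>ws. 1 - z / w)"
  using assms(1)
proof (induction ws)
  case (Cons w ws)
  then have w: "w \<noteq> 0" "norm w \<le> R" by auto
  have "4 \<le> norm (z / w)" using w assms(2) by (simp add: norm_divide field_simps)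
  then have "3 \<le> norm (1 - z / w)" using norm_triangle_ineq2[of "z / w" 1] by (simp add: norm_minus_commute)
  then have "3 * 3 ^ length ws \<le> norm (1 - z / w) * norm (\<Prod>w\<leftarrow>ws. 1 - z / w)"
    using Cons by (intro mult_mono) auto
  then show ?case by (simp add: norm_mult)
qed simp

text \<open>A list, not a set, so that multiplicities are recorded. Completeness of the list is no
  part of the notion; it will follow from maximal length.\<close>

definition zero_factorization ::
  "(complex \<Rightarrow> complex) \<Rightarrow> real \<Rightarrow> complex list \<Rightarrow> (complex \<Rightarrow> complex) \<Rightarrow> bool" where
  "zero_factorization F R ws G \<longleftrightarrow> G holomorphic_on UNIV \<and>
    (\<forall>w\<in>set ws. F w = 0 \<and> norm w \<le> R) \<and> (\<forall>z. F z = G z * (\<Prod>w\<leftarrow>ws. 1 - z / w))"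

lemma prod_list_const_1 [simp]: "(\<Prod>w\<leftarrow>ws. 1) = (1::'a::comm_semiring_1)"
  by (induction ws) auto

text \<open>On the circle of radius \<open>4 * R\<close> the quotient is smaller than
  \<open>F\<close> by the factor \<open>3 ^ length ws\<close>, and the maximum modulus principle
  carries this to the disc.\<close>

lemma zero_factorization_bound:
  assumes fact: "zero_factorization F R ws G" and F0: "F 0 \<noteq> 0" and R: "0 < R"
    and M: "\<And>z. norm z = 4 * R \<Longrightarrow> norm (F z) \<le> M" and z: "norm z \<le> 4 * R"
  shows "norm (G z) \<le> M / 3 ^ length ws"
proof (rule maximum_modulus_frontier[of G "cball 0 (4 * R)"])
  have G: "G holomorphic_on UNIV" using fact by (simp add: zero_factorization_def)
  then show "G holomorphic_on interior (cball 0 (4 * R))" by (rule holomorphic_on_subset) simp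
  show "continuous_on (closure (cball 0 (4 * R))) G"
    using holomorphic_on_imp_continuous_on[OF G] by (rule continuous_on_subset) simp
next
  fix z :: complex assume "z \<in> frontier (cball 0 (4 * R))"
  then have z: "norm z = 4 * R" using R by simp
  have "w \<noteq> 0 \<and> norm w \<le> R" if "w \<in> set ws" for w
    using fact that F0 by (auto simp: zero_factorization_def)
  from norm_ge_of_zeros_product[OF this z]
  have "norm (G z) * 3 ^ length ws \<le> norm (G z) * norm (\<Prod>w\<leftarrow>ws. 1 - z / w)"
    by (intro mult_left_mono) auto
  also have "\<dots> = norm (F z)"
    using fact unfolding zero_factorization_def by (metis norm_mult)
  also have "\<dots> \<le> M" using M[OF z] .
  finally show "norm (G z) \<le> M / 3 ^ length ws" by (simp add: field_simps)
qed (use z in auto)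

text \<open>Each factor \<open>1 - z / w\<close> with \<open>norm w \<le> R\<close> costs a factor 3 on the circle of radius \<open>4 * R\<close>, so zeros can
  be split off only finitely often.\<close>

lemma zero_factorization_exists:
  assumes F: "F holomorphic_on UNIV" and F0: "F 0 \<noteq> 0" and R: "0 < R"
  obtains ws G where "zero_factorization F R ws G" "\<And>z. norm z \<le> R \<Longrightarrow> G z \<noteq> 0"
proof -
  let ?P = "\<lambda>n. \<exists>ws G. length ws = n \<and> zero_factorization F R ws G"
  have "compact (F ` sphere 0 (4 * R))"
    using holomorphic_on_imp_continuous_on[OF F] by (intro compact_continuous_image) (auto intro: continuous_on_subset)
  from compact_imp_bounded[OF this] obtain M where "\<forall>y\<in>F ` sphere 0 (4 * R). norm y \<le> M"
    unfolding bounded_iff by blast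
  then have M: "norm (F z) \<le> M" if "norm z = 4 * R" for z using that by simp
  \<comment> \<open>Since \<open>G 0 = F 0\<close>, the bound at the origin reads
    \<open>norm (F 0) \<le> M / 3 ^ n\<close> and limits the length \<open>n\<close>.\<close>
  obtain b where b: "M / norm (F 0) < 3 ^ b" using real_arch_pow[of 3 "M / norm (F 0)"] by auto
  have bound: "n \<le> b" if Pn: "?P n" for n
  proof (rule ccontr)
    assume "\<not> n \<le> b"
    obtain ws G where ws: "length ws = n" "zero_factorization F R ws G" using Pn by blast
    have "norm (G 0) \<le> M / 3 ^ n"
      using zero_factorization_bound[OF ws(2) F0 R M, of 0] ws R by simp
    moreover have "F 0 = G 0" using ws by (simp add: zero_factorization_def)
    ultimately have "3 ^ n \<le> M / norm (F 0)" using F0 by (simp add: field_simps)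
    moreover have "(3::real) ^ b \<le> 3 ^ n" using \<open>\<not> n \<le> b\<close> by (intro power_increasing) auto
    ultimately show False using b by simp
  qed
  have P0: "?P 0" by (intro exI[of _ "[]"] exI[of _ F]) (simp add: zero_factorization_def F)
  have "\<forall>y. ?P y \<longrightarrow> id y < Suc b" using bound by (auto simp: less_Suc_eq_le)
  from ex_has_greatest_nat[of ?P 0 id, OF P0 this]
  obtain n where n: "?P n" "\<forall>m. ?P m \<longrightarrow> id m \<le> id n" by blast
  obtain ws G where ws: "length ws = n" "zero_factorization F R ws G" using n(1) by blast
  have "G z \<noteq> 0" if z: "norm z \<le> R" for z
  proof
    assume Gz: "G z = 0"
    have G: "G holomorphic_on UNIV" and FG: "F y = G y * (\<Prod>w\<leftarrow>ws. 1 - y / w)" for y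
      using ws by (auto simp: zero_factorization_def)
    have z0: "z \<noteq> 0" using FG[of 0] F0 Gz by auto
    \<comment> \<open>The quotient of \<open>G\<close> by \<open>1 - y / z\<close>, made holomorphic
      at \<open>z\<close> by the derivative there; it would belong to a longer list.\<close>
    define K where "K = (\<lambda>y. - z * (if y = z then deriv G z else (G y - G z) / (y - z)))"
    have "(\<lambda>y. if y = z then deriv G z else (G y - G z) / (y - z)) holomorphic_on UNIV"
      using pole_lemma_open[OF G open_UNIV, of z] by simp
    then have K: "K holomorphic_on UNIV" unfolding K_def by (intro holomorphic_intros)
    have GK: "G y = K y * (1 - y / z)" for y
      using z0 Gz by (cases "y = z") (auto simp: K_def field_simps)
    have "F z = 0" using FG[of z] Gz by simp
    have "\<forall>w\<in>set ws. F w = 0 \<and> norm w \<le> R" using ws(2) unfolding zero_factorization_def by blast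
    then have "\<forall>w\<in>set (z # ws). F w = 0 \<and> norm w \<le> R" using z \<open>F z = 0\<close> by simp
    moreover have "F y = K y * (\<Prod>w\<leftarrow>z # ws. 1 - y / w)" for y
      unfolding FG[of y] GK[of y] by (simp only: list.map prod_list.Cons mult.assoc)
    ultimately have "zero_factorization F R (z # ws) K"
      using K unfolding zero_factorization_def by blast
    then have "?P (Suc n)" using ws(1) by (intro exI[of _ "z # ws"] exI[of _ K]) simp
    then have "id (Suc n) \<le> id n" using n(2) by blast
    then show False by simp
  qed
  then show thesis using that ws by blast
qed

text \<open>The map \<open>u / (2 * A - u)\<close> takes the half-plane \<open>Re u < A\<close> into
  the unit disc and fixes 0. Schwarz's lemma bounds its composition with \<open>h\<close> by
  \<open>norm z / R\<close>, and solving for \<open>h z\<close> gives the estimate.\<close>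

lemma borel_caratheodory:
  assumes h: "h holomorphic_on ball 0 R" and h0: "h 0 = 0" and R: "0 < R"
    and Re: "\<And>z. norm z < R \<Longrightarrow> Re (h z) < A" and z: "norm z < R"
  shows "norm (h z) \<le> 2 * A * (norm z / R) / (1 - norm z / R)"
proof -
  have A: "0 < A" using Re[of 0] h0 R by simp
  define \<phi> where "\<phi> = (\<lambda>u. h (of_real R * u) / (2 * of_real A - h (of_real R * u)))"
  have nz: "2 * of_real A - h z \<noteq> 0" if "norm z < R" for z
  proof
    assume "2 * of_real A - h z = 0"
    then have "Re (h z) = 2 * A" by (auto simp: complex_eq_iff)
    then show False using Re[OF that] A by simp
  qed
  have mem: "norm (of_real R * u) < R" if "norm u < 1" for u :: complex
    using that R by (simp add: norm_mult)
  have norm_h: "norm (h z) < norm (2 * of_real A - h z)" if "norm z < R" for z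
  proof -
    have "0 < A * (A - Re (h z))" using Re[OF that] A by simp
    then have "(Re (h z))\<^sup>2 + (Im (h z))\<^sup>2 < (2 * A - Re (h z))\<^sup>2 + (Im (h z))\<^sup>2"
      by (simp add: power2_eq_square algebra_simps)
    then show ?thesis by (simp add: cmod_def)
  qed
  have hol: "(\<lambda>u. h (of_real R * u)) holomorphic_on ball 0 1"
    using mem by (intro holomorphic_on_compose_gen[OF _ h, unfolded o_def] holomorphic_intros) auto
  have "norm (\<phi> (z / of_real R)) \<le> norm (z / of_real R)"
  proof (rule Schwarz_Lemma(1))
    show "\<phi> holomorphic_on ball 0 1"
      unfolding \<phi>_def using nz mem by (intro holomorphic_intros hol) auto
    show "norm (\<phi> u) < 1" if "norm u < 1" for u
      using norm_h[OF mem[OF that]] nz[OF mem[OF that]] by (simp add: \<phi>_def norm_divide divide_less_eq)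
  qed (use z R in \<open>auto simp: \<phi>_def h0 norm_divide\<close>)
  then have \<phi>: "norm (h z / (2 * of_real A - h z)) \<le> norm z / R"
    using R by (simp add: \<phi>_def norm_divide)
  define q where "q = h z / (2 * of_real A - h z)"
  have t: "norm z / R < 1" using z R by simp
  have q: "norm q \<le> norm z / R" using \<phi> by (simp add: q_def)
  have "h z * (1 + q) = 2 * of_real A * q" using nz[OF z] by (simp add: q_def field_simps)
  then have "norm (h z * (1 + q)) = norm (2 * of_real A * q)" by simp
  then have "norm (h z) * norm (1 + q) = 2 * A * norm q" using A by (simp add: norm_mult)
  moreover have "1 - norm z / R \<le> norm (1 + q)"
    using norm_triangle_ineq2[of 1 "- q"] q by simp
  then have "norm (h z) * (1 - norm z / R) \<le> norm (h z) * norm (1 + q)" by (intro mult_left_mono) auto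
  moreover have "2 * A * norm q \<le> 2 * A * (norm z / R)" using q A by (intro mult_left_mono) auto
  ultimately have "norm (h z) * (1 - norm z / R) \<le> 2 * A * (norm z / R)" by linarith
  moreover have "0 < 1 - norm z / R" using t by simp
  ultimately show ?thesis by (simp only: pos_le_divide_eq)
qed

text \<open>As the products need only converge along
  some exhaustion, neither counting of zeros nor a convergent infinite product is required.\<close>

lemma hadamard_product_limit:
  assumes F: "F holomorphic_on UNIV" and F0: "F 0 \<noteq> 0"
    and growth: "\<And>\<epsilon>. 0 < \<epsilon> \<Longrightarrow> eventually (\<lambda>w. norm (F w) \<le> exp (\<epsilon> * norm w)) at_infinity"
  obtains ws :: "nat \<Rightarrow> complex list" where
    "\<And>n w. w \<in> set (ws n) \<Longrightarrow> F w = 0"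
    "\<And>n w. F w = 0 \<Longrightarrow> norm w \<le> real (Suc n) \<Longrightarrow> w \<in> set (ws n)"
    "\<And>z. (\<lambda>n. \<Prod>w\<leftarrow>ws n. 1 - z / w) \<longlonglongrightarrow> F z / F 0"
proof -
  have "\<forall>n. \<exists>ws G. zero_factorization F (real (Suc n)) ws G \<and> (\<forall>z. norm z \<le> real (Suc n) \<longrightarrow> G z \<noteq> 0)"
  proof
    fix n
    obtain ws G where "zero_factorization F (real (Suc n)) ws G" "\<And>z. norm z \<le> real (Suc n) \<Longrightarrow> G z \<noteq> 0"
      by (rule zero_factorization_exists[OF F F0, of "real (Suc n)"]) auto
    then show "\<exists>ws G. zero_factorization F (real (Suc n)) ws G \<and> (\<forall>z. norm z \<le> real (Suc n) \<longrightarrow> G z \<noteq> 0)"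
      by blast
  qed
  from choice[OF this] obtain ws where "\<forall>n. \<exists>G. zero_factorization F (real (Suc n)) (ws n) G \<and> (\<forall>z. norm z \<le> real (Suc n) \<longrightarrow> G z \<noteq> 0)"
    by blast
  from choice[OF this] obtain G where fact: "\<And>n. zero_factorization F (real (Suc n)) (ws n) (G n)"
      and nz: "\<And>n z. norm z \<le> real (Suc n) \<Longrightarrow> G n z \<noteq> 0" by blast
  have G: "G n holomorphic_on UNIV" and FG: "F z = G n z * (\<Prod>w\<leftarrow>ws n. 1 - z / w)" for n z
    using fact by (auto simp: zero_factorization_def)
  have G0: "G n 0 = F 0" for n using FG[of 0 n] by simp
  have lim1: "(\<lambda>n. G n z / F 0) \<longlonglongrightarrow> 1" for z
  proof -
    have "\<exists>h. \<forall>n\<ge>nat \<lceil>norm z\<rceil>. G n z / F 0 = exp (h n) \<and>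
      (\<forall>M. (\<forall>y. norm y = 4 * real (Suc n) \<longrightarrow> norm (F y) \<le> M) \<longrightarrow>
        norm (h n) \<le> 2 * (ln M - ln (norm (F 0)) + 1) * (norm z / real (Suc n)) / (1 - norm z / real (Suc n)))"
    proof (intro choice_iff'[THEN iffD1] allI impI)
      fix n assume "nat \<lceil>norm z\<rceil> \<le> n"
      then have zn: "norm z < real (Suc n)" by linarith
      obtain g where g: "g holomorphic_on ball 0 (real (Suc n))"
          "\<And>y. y \<in> ball 0 (real (Suc n)) \<Longrightarrow> G n y = exp (g y)"
        by (rule contractible_imp_holomorphic_log[of "G n" "ball 0 (real (Suc n))"])
           (use G nz in \<open>auto intro: holomorphic_on_subset convex_imp_contractible\<close>)
      have eg0: "exp (g 0) = F 0" using g(2)[of 0] G0 by simp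
      show "\<exists>h. G n z / F 0 = exp h \<and>
        (\<forall>M. (\<forall>y. norm y = 4 * real (Suc n) \<longrightarrow> norm (F y) \<le> M) \<longrightarrow>
          norm h \<le> 2 * (ln M - ln (norm (F 0)) + 1) * (norm z / real (Suc n)) / (1 - norm z / real (Suc n)))"
      proof (intro exI[of _ "g z - g 0"] conjI allI impI)
        show "G n z / F 0 = exp (g z - g 0)" using g(2)[of z] zn eg0 by (simp add: exp_diff)
        fix M assume M: "\<forall>y. norm y = 4 * real (Suc n) \<longrightarrow> norm (F y) \<le> M"
        show "norm (g z - g 0) \<le> 2 * (ln M - ln (norm (F 0)) + 1) * (norm z / real (Suc n)) / (1 - norm z / real (Suc n))"
        proof (rule borel_caratheodory[where h = "\<lambda>z. g z - g 0"])
          show "(\<lambda>z. g z - g 0) holomorphic_on ball 0 (real (Suc n))" by (intro holomorphic_intros g)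
          fix y :: complex assume y: "norm y < real (Suc n)"
          have "norm (G n y) \<le> M / 3 ^ length (ws n)"
            by (rule zero_factorization_bound[OF fact F0]) (use M y in auto)
          moreover have pos: "0 < norm (G n y)" using nz[of y n] y by simp
          ultimately have "norm (G n y) * 3 ^ length (ws n) \<le> M" by (simp add: field_simps)
          moreover have "norm (G n y) * 1 \<le> norm (G n y) * 3 ^ length (ws n)" by (intro mult_left_mono) auto
          ultimately have le: "norm (G n y) \<le> M" by simp
          then have "0 < M" using pos by linarith
          then have "ln (norm (G n y)) \<le> ln M" using pos le by (simp only: ln_le_cancel_iff)
          moreover have "ln (norm (G n y)) = Re (g y)" using g(2)[of y] y by simp
          moreover have "ln (norm (F 0)) = Re (g 0)" by (simp add: eg0[symmetric])
          \<comment> \<open>The added 1 makes the inequality strict.\<close>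
          ultimately show "Re (g y - g 0) < ln M - ln (norm (F 0)) + 1" by simp
        qed (use zn in auto)
      qed
    qed
    then obtain h where h: "\<And>n. nat \<lceil>norm z\<rceil> \<le> n \<Longrightarrow> G n z / F 0 = exp (h n)"
      and hM: "\<And>n M. nat \<lceil>norm z\<rceil> \<le> n \<Longrightarrow> (\<And>y. norm y = 4 * real (Suc n) \<Longrightarrow> norm (F y) \<le> M) \<Longrightarrow>
        norm (h n) \<le> 2 * (ln M - ln (norm (F 0)) + 1) * (norm z / real (Suc n)) / (1 - norm z / real (Suc n))"
      by blast
    define c where "c = 1 - ln (norm (F 0))"
    have "h \<longlonglongrightarrow> 0"
    proof (rule tendstoI)
      fix e :: real assume e: "0 < e"
      \<comment> \<open>On the circle of radius \<open>4 * N\<close> the growth hypothesis gives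
        \<open>ln M = 4 * \<epsilon> * N\<close>, and the bound for \<open>h\<close> tends to
        \<open>16 * \<epsilon> * norm z\<close>; the constant 32 makes this less than
        \<open>e / 2\<close>.\<close>
      define \<epsilon> where "\<epsilon> = e / (32 * (norm z + 1))"
      have \<epsilon>: "0 < \<epsilon>" using e by (simp add: \<epsilon>_def add_nonneg_pos)
      obtain B where B: "\<And>w. B \<le> norm w \<Longrightarrow> norm (F w) \<le> exp (\<epsilon> * norm w)"
        using growth[OF \<epsilon>] unfolding eventually_at_infinity by blast
      have "((\<lambda>n. 4 * norm z * (4 * \<epsilon> + c / real (Suc n))) \<longlongrightarrow> 4 * norm z * (4 * \<epsilon> + 0)) sequentially"
        by (intro tendsto_intros LIMSEQ_Suc[OF lim_const_over_n])
      moreover have "4 * norm z * (4 * \<epsilon> + 0) < e"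
      proof -
        have "norm z / (norm z + 1) < 1" by (simp add: add_nonneg_pos divide_less_eq)
        then have "e / 2 * (norm z / (norm z + 1)) < e / 2 * 1" using e by (intro mult_strict_left_mono) auto
        moreover have "4 * norm z * (4 * \<epsilon> + 0) = e / 2 * (norm z / (norm z + 1))"
          using norm_ge_zero[of z] unfolding \<epsilon>_def by (simp add: divide_simps)
        ultimately show ?thesis using e by linarith
      qed
      ultimately have ev: "eventually (\<lambda>n. 4 * norm z * (4 * \<epsilon> + c / real (Suc n)) < e) sequentially"
        by (intro order_tendstoD(2))
      have ev0: "eventually (\<lambda>n. 0 < 4 * \<epsilon> * real (Suc n) + c) sequentially"
      proof -
        have "filterlim (\<lambda>n. real (Suc n) * (4 * \<epsilon>)) at_top sequentially"
          using \<epsilon> by (intro filterlim_at_top_mult_tendsto_pos[OF tendsto_const]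
              filterlim_compose[OF filterlim_real_sequentially] filterlim_Suc) auto
        then have "eventually (\<lambda>n. - c < real (Suc n) * (4 * \<epsilon>)) sequentially"
          by (rule filterlim_at_top_dense[THEN iffD1, rule_format])
        then show ?thesis by eventually_elim (simp add: mult_ac)
      qed
      have evz: "eventually (\<lambda>n. max (2 * norm z) B \<le> real (Suc n)) sequentially"
      proof (rule eventually_sequentiallyI)
        fix n assume "nat \<lceil>max (2 * norm z) B\<rceil> \<le> n"
        then show "max (2 * norm z) B \<le> real (Suc n)" by linarith
      qed
      show "eventually (\<lambda>n. dist (h n) 0 < e) sequentially"
        using ev ev0 evz eventually_ge_at_top[of "nat \<lceil>norm z\<rceil>"]
      proof eventually_elim
        case (elim n)
        let ?N = "real (Suc n)"
        let ?t = "norm z / ?N"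
        have "norm (h n) \<le> 2 * (ln (exp (\<epsilon> * (4 * ?N))) - ln (norm (F 0)) + 1) * ?t / (1 - ?t)"
        proof (rule hM)
          fix y :: complex assume "norm y = 4 * real (Suc n)"
          then show "norm (F y) \<le> exp (\<epsilon> * (4 * ?N))" using B[of y] elim by auto
        qed (use elim in simp)
        also have "\<dots> = 2 * (4 * \<epsilon> * ?N + c) * ?t / (1 - ?t)" by (simp add: c_def algebra_simps)
        also have "\<dots> \<le> 2 * (4 * \<epsilon> * ?N + c) * ?t / (1 / 2)"
        proof (rule divide_left_mono)
          show "1 / 2 \<le> 1 - ?t" using elim by (simp add: field_simps)
          then show "0 < (1 - ?t) * (1 / 2)" by simp
          show "0 \<le> 2 * (4 * \<epsilon> * ?N + c) * ?t" using elim by (intro mult_nonneg_nonneg divide_nonneg_nonneg) auto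
        qed
        also have "\<dots> = 4 * norm z * (4 * \<epsilon> + c / ?N)" by (simp add: field_simps)
        also have "\<dots> < e" using elim by simp
        finally show ?case by simp
      qed
    qed
    then have "(\<lambda>n. exp (h n)) \<longlonglongrightarrow> exp 0" by (rule tendsto_exp)
    moreover have "eventually (\<lambda>n. exp (h n) = G n z / F 0) sequentially"
      using h by (intro eventually_sequentiallyI[of "nat \<lceil>norm z\<rceil>"]) simp
    ultimately have "(\<lambda>n. G n z / F 0) \<longlonglongrightarrow> exp 0" by (rule Lim_transform_eventually)
    then show ?thesis by simp
  qed
  show thesis
  proof (rule that)
    show "F w = 0" if "w \<in> set (ws n)" for n w using fact that by (auto simp: zero_factorization_def)
    show "w \<in> set (ws n)" if w: "F w = 0" "norm w \<le> real (Suc n)" for n w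
    proof -
      have "(\<Prod>v\<leftarrow>ws n. 1 - w / v) = 0" using FG[of w n] w nz by simp
      then obtain v where "v \<in> set (ws n)" "1 - w / v = 0" by (auto simp: prod_list_zero_iff)
      then show ?thesis by (cases "v = 0") auto
    qed
    show "(\<lambda>n. \<Prod>w\<leftarrow>ws n. 1 - z / w) \<longlonglongrightarrow> F z / F 0" for z
    proof -
      have "(\<lambda>n. F z / F 0 / (G n z / F 0)) \<longlonglongrightarrow> F z / F 0 / 1"
        by (intro tendsto_intros lim1) auto
      moreover have "eventually (\<lambda>n. F z / F 0 / (G n z / F 0) = (\<Prod>w\<leftarrow>ws n. 1 - z / w)) sequentially"
      proof (rule eventually_sequentiallyI)
        fix n assume "nat \<lceil>norm z\<rceil> \<le> n"
        then have "norm z \<le> real (Suc n)" by linarith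
        then show "F z / F 0 / (G n z / F 0) = (\<Prod>w\<leftarrow>ws n. 1 - z / w)"
          using nz[of z n] FG[of z n] F0 by simp
      qed
      ultimately have "(\<lambda>n. \<Prod>w\<leftarrow>ws n. 1 - z / w) \<longlonglongrightarrow> F z / F 0 / 1" by (rule Lim_transform_eventually)
      then show ?thesis by simp
    qed
  qed
qed

section \<open>Polya frequency functions from real zeros\<close>

lemma prod_list_map_remove1:
  fixes h :: "'a \<Rightarrow> 'b::comm_monoid_mult"
  assumes "x \<in> set xs"
  shows "(\<Prod>y\<leftarrow>xs. h y) = h x * (\<Prod>y\<leftarrow>remove1 x xs. h y)"
  using assms by (induction xs) (auto simp: mult_ac)

lemma prod_list_inverse:
  fixes h :: "'a \<Rightarrow> 'b::field"
  shows "(\<Prod>x\<leftarrow>xs. 1 / h x) = 1 / (\<Prod>x\<leftarrow>xs. h x)"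
  by (induction xs) auto

lemma of_real_prod_list:
  fixes h :: "'a \<Rightarrow> real"
  shows "(of_real (\<Prod>x\<leftarrow>xs. h x) :: 'b::real_field) = (\<Prod>x\<leftarrow>xs. of_real (h x))"
  by (induction xs) auto

lemma totally_positive_of_kernel:
  assumes "continuous_on UNIV g" "tp_kernel (\<lambda>x y. g (x - y))"
  shows "totally_positive g"
  unfolding totally_positive_def
proof (intro conjI allI impI)
  have "g \<in> borel_measurable borel" using assms(1) by (rule borel_measurable_continuous_onI)
  then show "g \<in> borel_measurable lebesgue" by (intro measurable_completion) simp
qed (rule tp_kernelD[OF assms(2)])

text \<open>The entry \<open>a\<^sup>2\<close>, present in every list, becomes the initial density,
  and the remaining entries become convolution factors. At \<open>\<sigma>\<^sup>2\<close> the
  products converge to a nonzero value, so their reciprocals are bounded in \<open>n\<close>; this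
  is the uniform bound needed for the limit.\<close>

lemma polya_frequency_function_of_products:
  fixes G :: "complex \<Rightarrow> complex" and ws :: "nat \<Rightarrow> real list"
  assumes a: "0 < a" and mem: "\<And>n. a\<^sup>2 \<in> set (ws n)" and ge: "\<And>n w. w \<in> set (ws n) \<Longrightarrow> a\<^sup>2 \<le> w"
    and lim: "\<And>w. (\<lambda>n. \<Prod>v\<leftarrow>ws n. 1 - w / of_real v) \<longlonglongrightarrow> G w"
    and nz: "\<And>s. \<bar>Re s\<bar> < a \<Longrightarrow> G (s\<^sup>2) \<noteq> 0"
  obtains \<Lambda> where "polya_frequency_function \<Lambda>"
    "\<And>s. \<bar>Re s\<bar> < a \<Longrightarrow> has_bochner_integral lebesgue (\<lambda>x. of_real (\<Lambda> x) * exp (- (s * of_real x))) (1 / G (s\<^sup>2))"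
proof -
  let ?C = "\<lambda>n \<sigma>. a / 2 * (\<Prod>w\<leftarrow>remove1 (a\<^sup>2) (ws n). 1 / (1 - \<sigma>\<^sup>2 / w))"
  let ?R = "\<lambda>n s. 1 / (1 - s\<^sup>2 / of_real (a\<^sup>2)) * (\<Prod>w\<leftarrow>remove1 (a\<^sup>2) (ws n). 1 / (1 - s\<^sup>2 / complex_of_real w))"
  have "\<exists>f. laplace_bounds a (a\<^sup>2 / 2) (?C n) (?R n) f" for n
    using ge[of _ n] notin_set_remove1 by (intro laplace_bounds_list[OF a]) fastforce
  then have "\<exists>f. \<forall>n. laplace_bounds a (a\<^sup>2 / 2) (?C n) (?R n) (f n)" by (intro choice allI)
  then obtain f where f: "\<And>n. laplace_bounds a (a\<^sup>2 / 2) (?C n) (?R n) (f n)" by blast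
  have R_eq: "?R n s = 1 / (\<Prod>v\<leftarrow>ws n. 1 - s\<^sup>2 / of_real v)" for n s
    unfolding prod_list_map_remove1[OF mem[of n], of "\<lambda>v. 1 - s\<^sup>2 / of_real v"] prod_list_inverse by simp
  have "\<exists>B. \<forall>n. ?C n \<sigma> \<le> B" if \<sigma>: "\<bar>\<sigma>\<bar> < a" for \<sigma>
  proof -
    define p where "p = (\<lambda>n. \<Prod>v\<leftarrow>ws n. 1 - \<sigma>\<^sup>2 / v)"
    have "(\<lambda>n. of_real (p n)) \<longlonglongrightarrow> G ((of_real \<sigma>)\<^sup>2)"
      using lim[of "(of_real \<sigma>)\<^sup>2"] by (simp add: p_def of_real_prod_list)
    then have "(\<lambda>n. 1 / complex_of_real (p n)) \<longlonglongrightarrow> 1 / G ((of_real \<sigma>)\<^sup>2)"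
      using \<sigma> by (intro tendsto_intros nz) auto
    then have "Bseq (\<lambda>n. 1 / complex_of_real (p n))" by (intro convergent_imp_Bseq convergentI)
    then obtain K where K: "\<And>n. norm (1 / complex_of_real (p n)) \<le> K" by (auto simp: Bseq_def)
    have "?C n \<sigma> \<le> a / 2 * (\<bar>1 - \<sigma>\<^sup>2 / a\<^sup>2\<bar> * K)" for n
    proof -
      have "\<sigma>\<^sup>2 < a\<^sup>2" using \<sigma> by (simp add: abs_square_less_1 power2_strict_mono)
      then have ne: "1 - \<sigma>\<^sup>2 / a\<^sup>2 \<noteq> 0" using a by (simp add: field_simps)
      then have "(\<Prod>w\<leftarrow>remove1 (a\<^sup>2) (ws n). 1 / (1 - \<sigma>\<^sup>2 / w)) = (1 - \<sigma>\<^sup>2 / a\<^sup>2) * (1 / p n)"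
        unfolding p_def prod_list_map_remove1[OF mem[of n], of "\<lambda>v. 1 - \<sigma>\<^sup>2 / v"] prod_list_inverse by simp
      also have "\<dots> \<le> \<bar>1 - \<sigma>\<^sup>2 / a\<^sup>2\<bar> * \<bar>1 / p n\<bar>" unfolding abs_mult[symmetric] by (rule abs_ge_self)
      also have "\<dots> \<le> \<bar>1 - \<sigma>\<^sup>2 / a\<^sup>2\<bar> * K"
        using K[of n] by (intro mult_left_mono) (auto simp: norm_divide)
      finally show ?thesis using a by (intro mult_left_mono) auto
    qed
    then show ?thesis by blast
  qed
  moreover have "(\<lambda>n. ?R n s) \<longlonglongrightarrow> 1 / G (s\<^sup>2)" if "\<bar>Re s\<bar> < a" for s
    unfolding R_eq by (intro tendsto_intros lim nz that)
  ultimately obtain g where g: "\<And>x. 0 \<le> g x" "continuous_on UNIV g" "tp_kernel (\<lambda>x y. g (x - y))"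
    "\<And>s. \<bar>Re s\<bar> < a \<Longrightarrow> has_bochner_integral lborel (\<lambda>x. of_real (g x) * exp (- (s * of_real x))) (1 / G (s\<^sup>2))"
    by (rule laplace_bounds_limit[OF a f, where S = "\<lambda>s. 1 / G (s\<^sup>2)"]) blast+
  have lap: "has_bochner_integral lebesgue (\<lambda>x. of_real (g x) * exp (- (s * of_real x))) (1 / G (s\<^sup>2))"
    if "\<bar>Re s\<bar> < a" for s
  proof -
    have m: "(\<lambda>x. of_real (g x) * exp (- (s * of_real x))) \<in> borel_measurable lborel"
      using g(4)[OF that] by (rule borel_measurable_has_bochner_integral)
    show ?thesis using g(4)[OF that]
      by (simp add: has_bochner_integral_iff integrable_completion[OF m] integral_completion[OF m])
  qed
  have "integrable lebesgue (\<lambda>x. norm (complex_of_real (g x) * exp (- (0 * of_real x))))"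
    using lap[of 0] a by (intro integrable_norm) (auto simp: has_bochner_integral_iff)
  then have "integrable lebesgue g" using g(1) by simp
  then have "polya_frequency_function g"
    using totally_positive_of_kernel g by (simp add: polya_frequency_function_def)
  then show thesis using that lap by blast
qed

theorem polya_frequency_function_of_real_zeros:
  fixes F :: "complex \<Rightarrow> complex"
  assumes F: "F holomorphic_on UNIV" and F0: "F 0 = of_real c" "0 < c"
    and growth: "\<And>\<epsilon>. 0 < \<epsilon> \<Longrightarrow> eventually (\<lambda>w. norm (F w) \<le> exp (\<epsilon> * norm w)) at_infinity"
    and zeros: "\<And>w. F w = 0 \<Longrightarrow> w \<in> \<real> \<and> t\<^sup>2 \<le> Re w"
    and t: "0 < t" "F (of_real (t\<^sup>2)) = 0"
  obtains \<Lambda> where "polya_frequency_function \<Lambda>"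
    "\<And>s. \<bar>Re s\<bar> < t \<Longrightarrow> has_bochner_integral lebesgue (\<lambda>x. of_real (\<Lambda> x) * exp (- (s * of_real x))) (1 / F (s\<^sup>2))"
proof -
  have nz0: "F 0 \<noteq> 0" using F0 by simp
  obtain vs :: "nat \<Rightarrow> complex list" where vs: "\<And>n w. w \<in> set (vs n) \<Longrightarrow> F w = 0"
      "\<And>n w. F w = 0 \<Longrightarrow> norm w \<le> real (Suc n) \<Longrightarrow> w \<in> set (vs n)"
      "\<And>z. (\<lambda>n. \<Prod>w\<leftarrow>vs n. 1 - z / w) \<longlonglongrightarrow> F z / F 0"
    using hadamard_product_limit[OF F nz0 growth] by blast
  \<comment> \<open>Starting the exhaustion at \<open>N\<close> puts the zero
    \<open>t\<^sup>2\<close> into every list.\<close>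
  obtain N :: nat where N: "t\<^sup>2 \<le> real N" using real_arch_simple by blast
  define ws where "ws = (\<lambda>n. map Re (vs (n + N)))"
  have eq: "(\<Prod>v\<leftarrow>ws n. 1 - z / of_real v) = (\<Prod>w\<leftarrow>vs (n + N). 1 - z / w)" for n z
    unfolding ws_def map_map o_def
    by (intro arg_cong[where f = prod_list] map_cong refl) (use vs(1) zeros in auto)
  \<comment> \<open>A zero would satisfy \<open>t\<^sup>2 \<le> Re (s\<^sup>2)\<close>, while
    \<open>Re (s\<^sup>2) \<le> (Re s)\<^sup>2\<close>.\<close>
  have strip: "F (s\<^sup>2) \<noteq> 0" if s: "\<bar>Re s\<bar> < t" for s
  proof
    assume "F (s\<^sup>2) = 0"
    then have "Im (s\<^sup>2) = 0" "t\<^sup>2 \<le> Re (s\<^sup>2)" using zeros complex_is_Real_iff by blast+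
    then have "t\<^sup>2 \<le> (Re s)\<^sup>2" by (simp add: power2_eq_square) (smt (verit) zero_le_square)
    then show False using s t(1) by (metis abs_le_square_iff abs_of_pos not_le)
  qed
  obtain \<Lambda> where \<Lambda>: "polya_frequency_function \<Lambda>"
    "\<And>s. \<bar>Re s\<bar> < t \<Longrightarrow> has_bochner_integral lebesgue (\<lambda>x. of_real (\<Lambda> x) * exp (- (s * of_real x))) (1 / (F (s\<^sup>2) / F 0))"
  proof (rule polya_frequency_function_of_products[OF t(1), of ws "\<lambda>w. F w / F 0"])
    show "t\<^sup>2 \<in> set (ws n)" for n
    proof -
      have "complex_of_real (t\<^sup>2) \<in> set (vs (n + N))"
        using N by (intro vs(2) t(2)) (simp add: norm_power)
      then have "Re (complex_of_real (t\<^sup>2)) \<in> Re ` set (vs (n + N))" by (rule imageI)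
      then show ?thesis by (simp add: ws_def)
    qed
    show "t\<^sup>2 \<le> w" if "w \<in> set (ws n)" for n w using that vs(1) zeros by (auto simp: ws_def)
    show "(\<lambda>n. \<Prod>v\<leftarrow>ws n. 1 - w / complex_of_real v) \<longlonglongrightarrow> F w / F 0" for w
      unfolding eq using vs(3)[of w] by (rule LIMSEQ_ignore_initial_segment)
    show "F (s\<^sup>2) / F 0 \<noteq> 0" if "\<bar>Re s\<bar> < t" for s using strip[OF that] \<open>F 0 \<noteq> 0\<close> by simp
  qed blast
  show thesis
  proof (rule that)
    have tp: "totally_positive \<Lambda>" and int: "integrable lebesgue \<Lambda>"
      using \<Lambda>(1) by (auto simp: polya_frequency_function_def)
    \<comment> \<open>The products are normalised to 1 at 0; dividing by \<open>c > 0\<close>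
      restores the value \<open>F 0\<close>.\<close>
    have "totally_positive (\<lambda>x. \<Lambda> x / c)"
      unfolding totally_positive_def
    proof (intro conjI allI impI)
      show "(\<lambda>x. \<Lambda> x / c) \<in> borel_measurable lebesgue" using tp by (auto simp: totally_positive_def)
      fix n :: nat and x y :: "nat \<Rightarrow> real"
      assume n: "1 \<le> n" and xy: "strict_mono_on {..<n} x" "strict_mono_on {..<n} y"
      have "0 \<le> Determinant.det (Matrix.mat n n (\<lambda>(j, k). \<Lambda> (x j - y k)))"
        using tp n xy unfolding totally_positive_def by blast
      then show "0 \<le> Determinant.det (Matrix.mat n n (\<lambda>(j, k). \<Lambda> (x j - y k) / c))"
        using F0(2) det_mat_scale[of n "\<lambda>_. 1" "\<lambda>j k. \<Lambda> (x j - y k)" "\<lambda>_. 1 / c"]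
        by (simp add: prod_nonneg)
    qed
    then show "polya_frequency_function (\<lambda>x. \<Lambda> x / c)"
      using int by (simp add: polya_frequency_function_def)
    fix s :: complex assume s: "\<bar>Re s\<bar> < t"
    have "has_bochner_integral lebesgue (\<lambda>x. 1 / of_real c * (of_real (\<Lambda> x) * exp (- (s * of_real x))))
        (1 / of_real c * (1 / (F (s\<^sup>2) / F 0)))"
      by (intro has_bochner_integral_mult_right \<Lambda>(2) s)
    then show "has_bochner_integral lebesgue (\<lambda>x. of_real (\<Lambda> x / c) * exp (- (s * of_real x))) (1 / F (s\<^sup>2))"
      using F0 by simp
  qed
qed

section \<open>The theta function\<close>

definition dirichlet_kernel :: "nat \<Rightarrow> real \<Rightarrow> real" where
  "dirichlet_kernel N t = 1 + 2 * (\<Sum>k=1..N. cos (2 * pi * real k * t))"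

lemma sin_dirichlet_kernel: "sin (pi * t) * dirichlet_kernel N t = sin (real (2 * N + 1) * pi * t)"
proof (induction N)
  case 0
  then show ?case by (simp add: dirichlet_kernel_def)
next
  case (Suc N)
  have "sin (pi * t) * dirichlet_kernel (Suc N) t =
      sin (pi * t) * dirichlet_kernel N t + 2 * (sin (pi * t) * cos (2 * pi * real (Suc N) * t))"
    by (simp add: dirichlet_kernel_def algebra_simps)
  also have "2 * (sin (pi * t) * cos (2 * pi * real (Suc N) * t)) =
      sin (pi * t + 2 * pi * real (Suc N) * t) + sin (pi * t - 2 * pi * real (Suc N) * t)"
    by (simp only: sin_add sin_diff)
  also have "pi * t - 2 * pi * real (Suc N) * t = - (real (2 * N + 1) * pi * t)" by (simp add: algebra_simps)
  also have "pi * t + 2 * pi * real (Suc N) * t = real (2 * Suc N + 1) * pi * t" by (simp add: algebra_simps)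
  finally show ?case using Suc by simp
qed

lemma cos_integral_symmetric:
  assumes "k \<ge> 1"
  shows "((\<lambda>t. cos (2 * pi * real k * t)) has_integral 0) {-1/2..1/2}"
proof -
  have "((\<lambda>t. cos (2 * pi * real k * t)) has_integral
      (sin (2 * pi * real k * (1/2)) / (2 * pi * real k) - sin (2 * pi * real k * (-1/2)) / (2 * pi * real k))) {-1/2..1/2}"
    by (rule fundamental_theorem_of_calculus)
       (use assms in \<open>auto intro!: derivative_eq_intros simp flip: has_real_derivative_iff_has_vector_derivative\<close>)
  then show ?thesis by (simp add: mult.commute)
qed

lemma dirichlet_kernel_integral: "(dirichlet_kernel N has_integral 1) {-1/2..1/2}"
proof -
  have "((\<lambda>t. 1 + 2 * (\<Sum>k=1..N. cos (2 * pi * real k * t))) has_integral (1 + 2 * (\<Sum>k=1..N. 0))) {-1/2..1/2}"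
    by (intro has_integral_add has_integral_mult_right has_integral_sum cos_integral_symmetric)
       (use has_integral_const_real[of "1::real" "-1/2" "1/2"] in auto)
  then show ?thesis by (simp add: dirichlet_kernel_def[abs_def])
qed

text \<open>Pointwise convergence of the Fourier series at 0: the difference quotient against \<open>sin\<close> is again
  holomorphic, so that one integration by parts gives a bound of order \<open>1 / N\<close>.\<close>

lemma dirichlet_kernel_tendsto:
  fixes G :: "complex \<Rightarrow> complex"
  assumes G: "G holomorphic_on ball 0 1"
  shows "(\<lambda>N. integral {-1/2..1/2} (\<lambda>t. G (of_real t) * of_real (dirichlet_kernel N t))) \<longlonglongrightarrow> G 0"
proof -
  \<comment> \<open>\<open>Q\<close> is \<open>(G z - G 0) / sin (pi * z)\<close> with its
    singularity removed: numerator and denominator are both divided by \<open>z\<close>, and 0 is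
    the only zero of \<open>sin (pi * z)\<close> in the unit disc.\<close>
  define K where "K = (\<lambda>z. if z = 0 then deriv G 0 else (G z - G 0) / (z - 0))"
  define S where "S = (\<lambda>z. sin (of_real pi * z) :: complex)"
  define E where "E = (\<lambda>z. if z = 0 then deriv S 0 else (S z - S 0) / (z - 0))"
  define Q where "Q = (\<lambda>z. K z / E z)"
  have K: "K holomorphic_on ball 0 1" unfolding K_def by (rule pole_lemma_open[OF G]) simp
  have "S holomorphic_on ball 0 1" unfolding S_def by (intro holomorphic_intros)
  then have E: "E holomorphic_on ball 0 1" unfolding E_def by (rule pole_lemma_open) simp
  have dS: "deriv S 0 = of_real pi"
    unfolding S_def by (rule DERIV_imp_deriv) (auto intro!: derivative_eq_intros)
  have E_nz: "E z \<noteq> 0" if "z \<in> ball 0 1" for z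
  proof (cases "z = 0")
    case False
    have "S z \<noteq> 0"
    proof
      assume "S z = 0"
      then obtain n :: int where n: "of_real pi * z = of_real (real_of_int n * pi)"
        unfolding S_def using sin_eq_0[of "of_real pi * z"] by auto
      then have "z = of_int n" by (simp add: field_simps)
      then have "\<bar>real_of_int n\<bar> < 1" using that by (simp add: norm_of_int)
      then have "n = 0" by linarith
      then show False using \<open>z = of_int n\<close> False by simp
    qed
    then show ?thesis using False by (simp add: E_def S_def)
  qed (simp add: E_def dS)
  have Q: "Q holomorphic_on ball 0 1" unfolding Q_def using K E E_nz by (intro holomorphic_intros)
  have QS: "G z - G 0 = Q z * sin (of_real pi * z)" if "z \<in> ball 0 1" for z
  proof -
    have "G z - G 0 = K z * z" by (simp add: K_def)
    moreover have "Q z * S z = K z * z"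
    proof -
      have "S z = E z * z" by (simp add: E_def S_def)
      then show ?thesis unfolding Q_def using E_nz[OF that] by simp
    qed
    ultimately show ?thesis by (simp only: S_def)
  qed
  have mem: "of_real t \<in> ball (0::complex) 1" if "t \<in> {-1/2..1/2}" for t :: real
    using that by (auto simp: dist_norm)
  have cont_Q: "continuous_on {-1/2..1/2} (\<lambda>t. Q (of_real t))"
    by (rule continuous_on_compose2[OF holomorphic_on_imp_continuous_on[OF Q]])
       (use mem in \<open>auto intro!: continuous_intros\<close>)
  have "deriv Q holomorphic_on ball 0 1" using Q by (intro holomorphic_deriv) auto
  then have "continuous_on (ball 0 1) (deriv Q)" by (rule holomorphic_on_imp_continuous_on)
  then have cont_dQ: "continuous_on {-1/2..1/2} (\<lambda>t. deriv Q (of_real t))"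
    by (rule continuous_on_compose2) (use mem in \<open>auto intro!: continuous_intros\<close>)
  have "compact ((\<lambda>t. deriv Q (of_real t)) ` {-1/2..1/2})" using cont_dQ by (intro compact_continuous_image) auto
  from compact_imp_bounded[OF this] obtain B where "\<forall>y\<in>(\<lambda>t. deriv Q (of_real t)) ` {-1/2..1/2}. norm y \<le> B"
    unfolding bounded_iff by blast
  then have B: "norm (deriv Q (of_real t)) \<le> B" if "t \<in> {-1/2..1/2}" for t
    using that by (rule bspec[OF _ imageI])
  define I where "I = (\<lambda>N. integral {-1/2..1/2} (\<lambda>t. Q (of_real t) * of_real (sin (real (2 * N + 1) * pi * t))))"
  have split: "integral {-1/2..1/2} (\<lambda>t. G (of_real t) * of_real (dirichlet_kernel N t)) = G 0 + I N" for N
  proof -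
    have i1: "((\<lambda>t. G 0 * complex_of_real (dirichlet_kernel N t)) has_integral (G 0 * of_real 1)) {-1/2..1/2}"
      by (intro has_integral_mult_right has_integral_of_real dirichlet_kernel_integral)
    have i2: "((\<lambda>t. Q (of_real t) * of_real (sin (real (2 * N + 1) * pi * t))) has_integral I N) {-1/2..1/2}"
      unfolding I_def by (intro integrable_integral integrable_continuous_real continuous_intros cont_Q)
    have "G 0 * complex_of_real (dirichlet_kernel N t) + Q (of_real t) * of_real (sin (real (2 * N + 1) * pi * t)) =
        G (of_real t) * of_real (dirichlet_kernel N t)" if "t \<in> {-1/2..1/2}" for t
    proof -
      have "G (of_real t) = G 0 + Q (of_real t) * of_real (sin (pi * t))"
        using QS[OF mem[OF that]] by (simp add: sin_of_real[symmetric] algebra_simps)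
      then show ?thesis unfolding sin_dirichlet_kernel[symmetric] by (simp add: algebra_simps)
    qed
    then have "((\<lambda>t. G (of_real t) * of_real (dirichlet_kernel N t)) has_integral (G 0 * of_real 1 + I N)) {-1/2..1/2}"
      by (intro has_integral_eq[OF _ has_integral_add[OF i1 i2]]) auto
    then show ?thesis by (simp add: integral_unique)
  qed
  have bound: "norm (I N) \<le> B / (real (2 * N + 1) * pi)" for N
  proof -
    define m where "m = real (2 * N + 1) * pi"
    have m: "0 < m" by (simp add: m_def)
    \<comment> \<open>\<open>m / 2\<close> is an odd multiple of \<open>pi / 2\<close>, so the
      boundary terms of the integration by parts vanish.\<close>
    have "cos (m * (1/2)) = 0"
      unfolding cos_zero_iff_int2 by (intro exI[of _ "int N"]) (simp add: m_def field_simps)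
    then have c0: "cos (m * (1/2)) = 0" "cos (m * (-1/2)) = 0" by auto
    have "((\<lambda>t. deriv Q (of_real t) * of_real (cos (m * t)) - of_real m * (Q (of_real t) * of_real (sin (m * t)))) has_integral
        (Q (of_real (1/2)) * of_real (cos (m * (1/2))) - Q (of_real (-1/2)) * of_real (cos (m * (-1/2))))) {-1/2..1/2}"
    proof (rule fundamental_theorem_of_calculus)
      fix t :: real assume t: "t \<in> {-1/2..1/2}"
      have "(Q has_field_derivative deriv Q (of_real t)) (at (of_real t))"
        using mem[OF t] by (intro holomorphic_derivI[OF Q]) auto
      then have "((\<lambda>t. Q (of_real t)) has_vector_derivative deriv Q (of_real t)) (at t within {-1/2..1/2})"
        by (rule has_vector_derivative_at_within[OF has_vector_derivative_real_field])
      moreover have "((\<lambda>t. complex_of_real (cos (m * t))) has_vector_derivative of_real (- m * sin (m * t))) (at t within {-1/2..1/2})"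
        by (intro has_vector_derivative_of_real) (auto intro!: derivative_eq_intros simp flip: has_real_derivative_iff_has_vector_derivative)
      ultimately show "((\<lambda>t. Q (of_real t) * of_real (cos (m * t))) has_vector_derivative
          deriv Q (of_real t) * of_real (cos (m * t)) - of_real m * (Q (of_real t) * of_real (sin (m * t)))) (at t within {-1/2..1/2})"
        by (rule has_vector_derivative_eq_rhs[OF has_vector_derivative_mult]) (simp add: algebra_simps)
    qed simp
    then have i0: "((\<lambda>t. deriv Q (of_real t) * of_real (cos (m * t)) - of_real m * (Q (of_real t) * of_real (sin (m * t)))) has_integral 0) {-1/2..1/2}"
      unfolding c0 by simp
    have "((\<lambda>t. of_real m * (Q (of_real t) * of_real (sin (m * t)))) has_integral (of_real m * I N)) {-1/2..1/2}"
      unfolding I_def m_def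
      by (intro has_integral_mult_right integrable_integral integrable_continuous_real continuous_intros cont_Q)
    from has_integral_add[OF i0 this]
    have "((\<lambda>t. deriv Q (of_real t) * of_real (cos (m * t))) has_integral (of_real m * I N)) {-1/2..1/2}" by simp
    then have "norm (of_real m * I N) \<le> B * measure lborel {-1/2..1/2::real}"
    proof (rule has_integral_bound_real[where S = "{}", rotated 2])
      fix t :: real assume t: "t \<in> {-1/2..1/2} - {}"
      then have Bt: "norm (deriv Q (of_real t)) \<le> B" by (intro B) simp
      have "norm (deriv Q (of_real t)) * \<bar>cos (m * t)\<bar> \<le> B * 1"
        using Bt order_trans[OF norm_ge_zero Bt] by (intro mult_mono) auto
      then show "norm (deriv Q (of_real t) * of_real (cos (m * t))) \<le> B" by (simp add: norm_mult)
    qed (use order_trans[OF norm_ge_zero B[of 0]] in auto)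
    then have "m * norm (I N) \<le> B" using m by (simp add: norm_mult)
    then show ?thesis unfolding m_def[symmetric] using m by (simp only: pos_le_divide_eq mult.commute)
  qed
  have "I \<longlonglongrightarrow> 0"
  proof (rule Lim_null_comparison[OF always_eventually[OF allI[OF bound]]])
    have "filterlim (\<lambda>N. real (2 * N + 1) * pi) at_top sequentially"
      by real_asymp
    then show "(\<lambda>N. B / (real (2 * N + 1) * pi)) \<longlonglongrightarrow> 0" by (rule tendsto_divide_0[OF tendsto_const filterlim_at_top_imp_at_infinity])
  qed
  then have "(\<lambda>N. G 0 + I N) \<longlonglongrightarrow> G 0 + 0" by (intro tendsto_intros)
  then show ?thesis unfolding split by simp
qed

section \<open>Fourier coefficients of the periodised Gaussian\<close>

lemma gaussian_fourier:
  fixes x :: real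
  assumes x: "0 < x"
  shows "has_bochner_integral lborel (\<lambda>v. exp (- (pi * x * v\<^sup>2)) * cos (2 * pi * k * v)) (exp (- (pi * k\<^sup>2 / x)) / sqrt x)"
proof -
  \<comment> \<open>Under \<open>y = sqrt (2 * pi * x) * v\<close> the standard normal density
    becomes a multiple of the Gaussian, and the frequency \<open>s\<close> becomes
    \<open>2 * pi * k\<close>. The integral is then a value of the normal characteristic
    function.\<close>
  define s where "s = 2 * pi * k / sqrt (2 * pi * x)"
  have sq: "(sqrt (2 * pi * x))\<^sup>2 = 2 * pi * x" "0 < sqrt (2 * pi * x)" using x by simp_all
  have "char std_normal_distribution s = of_real (exp (- s\<^sup>2 / 2))"
    by (simp add: char_std_normal_distribution)
  moreover have "char std_normal_distribution s = (CLINT y|lborel. std_normal_density y *\<^sub>R iexp (s * y))"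
    unfolding char_def by (subst integral_density) (auto intro!: normal_density_nonneg)
  moreover have int: "integrable lborel (\<lambda>y. std_normal_density y *\<^sub>R iexp (s * y))"
    by (rule Bochner_Integration.integrable_bound[OF integrable_normal_density[of 1 0]]) auto
  ultimately have "has_bochner_integral lborel (\<lambda>y. std_normal_density y *\<^sub>R iexp (s * y)) (of_real (exp (- s\<^sup>2 / 2)))"
    by (simp add: has_bochner_integral_iff)
  from has_bochner_integral_bounded_linear[OF bounded_linear_Re this]
  have "has_bochner_integral lborel (\<lambda>y. std_normal_density y * cos (s * y)) (exp (- s\<^sup>2 / 2))"
    by (simp add: Re_exp)
  then have H: "has_bochner_integral lborel (\<lambda>v. std_normal_density (0 + sqrt (2 * pi * x) * v) * cos (s * (0 + sqrt (2 * pi * x) * v)))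
      (exp (- s\<^sup>2 / 2) /\<^sub>R \<bar>sqrt (2 * pi * x)\<bar>)"
    by (subst (asm) lborel_has_bochner_integral_real_affine_iff[of "sqrt (2 * pi * x)" _ _ 0]) (use sq x in auto)
  have e1: "s * (0 + sqrt (2 * pi * x) * v) = 2 * pi * k * v" for v using sq(2) x by (simp add: s_def)
  have e2: "std_normal_density (0 + sqrt (2 * pi * x) * v) = 1 / sqrt (2 * pi) * exp (- (pi * x * v\<^sup>2))" for v
    unfolding std_normal_density_def using sq by (simp add: power_mult_distrib)
  have "s\<^sup>2 / 2 = pi * k\<^sup>2 / x"
    unfolding s_def power_divide sq(1) using x by (simp add: power2_eq_square field_simps)
  then have "- s\<^sup>2 / 2 = - (pi * k\<^sup>2 / x)" by simp
  moreover have "\<bar>sqrt (2 * pi * x)\<bar> = sqrt (2 * pi) * sqrt x" using x by (simp add: real_sqrt_mult)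
  ultimately have val: "exp (- s\<^sup>2 / 2) /\<^sub>R \<bar>sqrt (2 * pi * x)\<bar> = exp (- (pi * k\<^sup>2 / x)) / (sqrt (2 * pi) * sqrt x)"
    by (simp only: real_scaleR_def divide_inverse mult.commute)
  have "has_bochner_integral lborel (\<lambda>v. 1 / sqrt (2 * pi) * exp (- (pi * x * v\<^sup>2)) * cos (2 * pi * k * v))
      (exp (- (pi * k\<^sup>2 / x)) / (sqrt (2 * pi) * sqrt x))"
    using H unfolding e1 e2 val .
  from has_bochner_integral_mult_right[OF this, of "sqrt (2 * pi)"]
  have "has_bochner_integral lborel (\<lambda>v. sqrt (2 * pi) * (1 / sqrt (2 * pi) * exp (- (pi * x * v\<^sup>2)) * cos (2 * pi * k * v)))
      (sqrt (2 * pi) * (exp (- (pi * k\<^sup>2 / x)) / (sqrt (2 * pi) * sqrt x)))" .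
  moreover have "sqrt (2 * pi) * (1 / sqrt (2 * pi) * a * b) = a * b" for a b by simp
  moreover have "sqrt (2 * pi) * (a / (sqrt (2 * pi) * sqrt x)) = a / sqrt x" for a by simp
  ultimately show ?thesis by (simp only:)
qed

text \<open>The sum of the Gaussian over all integer shifts, folded into a series over the naturals:
  term \<open>n\<close> holds the shifts by \<open>n\<close> and by \<open>- n - 1\<close>, so every
  integer occurs once. A complex argument makes the sum holomorphic.\<close>

definition theta_terms :: "real \<Rightarrow> nat \<Rightarrow> complex \<Rightarrow> complex" where
  "theta_terms x n z = exp (- (of_real (pi * x) * (z + of_nat n)\<^sup>2)) + exp (- (of_real (pi * x) * (z - of_nat n - 1)\<^sup>2))"

text \<open>The real part of \<open>(z + m)\<^sup>2\<close> is
  \<open>(Re z + m)\<^sup>2 - (Im z)\<^sup>2\<close>, and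
  \<open>m\<^sup>2 \<le> 2 * (Re z + m)\<^sup>2 + 2 * (Re z)\<^sup>2\<close>. Half of the Gaussian
  decay in \<open>m\<close> therefore remains, uniformly on discs.\<close>

lemma gaussian_shift_bound:
  fixes z :: complex
  assumes x: "0 < x" and z: "norm z \<le> r"
  shows "norm (exp (- (of_real (pi * x) * (z + of_real m)\<^sup>2))) \<le> exp (2 * (pi * x * r\<^sup>2)) * exp (- (pi * x / 2 * m\<^sup>2))"
proof -
  have "m\<^sup>2 \<le> 2 * (Re z + m)\<^sup>2 + 2 * (Re z)\<^sup>2"
    using zero_le_power2[of "2 * Re z + m"] by (simp add: power2_eq_square algebra_simps)
  moreover have "(Re z)\<^sup>2 + (Im z)\<^sup>2 \<le> r\<^sup>2"
    using power_mono[OF z, of 2] by (simp add: cmod_power2)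
  moreover have "0 \<le> (Re z)\<^sup>2" "0 \<le> (Im z)\<^sup>2" by auto
  ultimately have "m\<^sup>2 / 2 - 2 * r\<^sup>2 \<le> (Re z + m)\<^sup>2 - (Im z)\<^sup>2" by linarith
  then have "pi * x * (m\<^sup>2 / 2 - 2 * r\<^sup>2) \<le> pi * x * ((Re z + m)\<^sup>2 - (Im z)\<^sup>2)"
    using x by (intro mult_left_mono) auto
  then have "- (pi * x * ((Re z + m)\<^sup>2 - (Im z)\<^sup>2)) \<le> 2 * (pi * x * r\<^sup>2) + - (pi * x / 2 * m\<^sup>2)"
    by (simp add: algebra_simps)
  then show ?thesis unfolding exp_add[symmetric] by (simp add: power2_eq_square)
qed

lemma theta_terms_bound:
  assumes x: "0 < x" and z: "norm z \<le> r"
  shows "norm (theta_terms x n z) \<le> 2 * exp (2 * (pi * x * r\<^sup>2)) * exp (- (pi * x / 2)) ^ n"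
proof -
  let ?C = "exp (2 * (pi * x * r\<^sup>2))"
  have nn: "real n \<le> (real n)\<^sup>2" by (cases n) (auto simp: power2_eq_square)
  have e: "exp (- (pi * x / 2 * m\<^sup>2)) \<le> exp (- (pi * x / 2)) ^ n" if "real n \<le> m\<^sup>2" for m
  proof -
    have "pi * x / 2 * real n \<le> pi * x / 2 * m\<^sup>2" using x that by (intro mult_left_mono) auto
    then show ?thesis unfolding exp_of_nat_mult[symmetric] by (simp add: mult_ac)
  qed
  have "norm (theta_terms x n z) \<le> ?C * exp (- (pi * x / 2 * (real n)\<^sup>2)) + ?C * exp (- (pi * x / 2 * (- real n - 1)\<^sup>2))"
    unfolding theta_terms_def
    using gaussian_shift_bound[OF x z, of "real n"] gaussian_shift_bound[OF x z, of "- real n - 1"]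
    by (intro norm_triangle_mono) (simp_all add: algebra_simps)
  also have "\<dots> \<le> ?C * exp (- (pi * x / 2)) ^ n + ?C * exp (- (pi * x / 2)) ^ n"
  proof (intro add_mono mult_left_mono e)
    have "(- real n - 1)\<^sup>2 = (real n)\<^sup>2 + 2 * real n + 1" by (simp add: power2_eq_square algebra_simps)
    then show "real n \<le> (- real n - 1)\<^sup>2" using nn by linarith
  qed (use nn in auto)
  finally show ?thesis by (simp add: mult_ac)
qed

lemma summable_theta_majorant: "0 < x \<Longrightarrow> summable (\<lambda>n. C * exp (- (pi * x / 2)) ^ n :: real)"
  by (intro summable_mult summable_geometric) simp

definition theta_fun :: "real \<Rightarrow> complex \<Rightarrow> complex" where
  "theta_fun x z = (\<Sum>n. theta_terms x n z)"

lemma theta_uniform: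
  assumes x: "0 < x"
  shows "uniform_limit (cball 0 r) (\<lambda>N z. \<Sum>n<N. theta_terms x n z) (theta_fun x) sequentially"
  unfolding theta_fun_def[abs_def]
  by (rule Weierstrass_m_test[OF _ summable_theta_majorant[OF x]]) (use theta_terms_bound[OF x] in auto)

lemma theta_fun_holomorphic:
  assumes x: "0 < x"
  shows "theta_fun x holomorphic_on UNIV"
proof (rule holomorphic_uniform_sequence[OF open_UNIV])
  show "(\<lambda>z. \<Sum>n<N. theta_terms x n z) holomorphic_on UNIV" for N
    unfolding theta_terms_def by (intro holomorphic_intros)
  fix z :: complex
  have "cball z 1 \<subseteq> cball 0 (norm z + 1)"
  proof
    fix w assume "w \<in> cball z 1"
    then show "w \<in> cball 0 (norm z + 1)"
      using norm_triangle_ineq[of z "w - z"] by (simp add: dist_norm norm_minus_commute)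
  qed
  then show "\<exists>d>0. cball z d \<subseteq> UNIV \<and> uniform_limit (cball z d) (\<lambda>N z. \<Sum>n<N. theta_terms x n z) (theta_fun x) sequentially"
    by (intro exI[of _ 1]) (auto intro: uniform_limit_on_subset[OF theta_uniform[OF x]])
qed

lemma theta_fun_sums:
  assumes x: "0 < x"
  shows "(\<lambda>n. theta_terms x n z) sums theta_fun x z"
  unfolding theta_fun_def
  by (rule summable_sums[OF summable_comparison_test'[OF summable_theta_majorant[OF x] theta_terms_bound[OF x order.refl]]])

text \<open>Translation by an integer leaves \<open>cos (2 * pi * k * t)\<close> unchanged, so the
  integrals of the shifts over one period become integrals of one function over adjacent unit
  intervals.\<close>

lemma gaussian_interval_integral:
  fixes x :: real
  shows "((\<lambda>t. exp (- (pi * x * (t + real_of_int m)\<^sup>2)) * cos (2 * pi * real k * t)) has_integral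
    (integral {real_of_int m - 1/2..real_of_int m + 1/2} (\<lambda>v. exp (- (pi * x * v\<^sup>2)) * cos (2 * pi * real k * v)))) {-1/2..1/2}"
proof -
  let ?F = "\<lambda>v. exp (- (pi * x * v\<^sup>2)) * cos (2 * pi * real k * v)"
  have "(?F has_integral integral {real_of_int m - 1/2..real_of_int m + 1/2} ?F) {real_of_int m - 1/2..real_of_int m + 1/2}"
    by (intro integrable_integral integrable_continuous_real continuous_intros)
  from has_integral_shift_real_ivl[OF this, of "real_of_int m"]
  have "((\<lambda>t. ?F (t + real_of_int m)) has_integral integral {real_of_int m - 1/2..real_of_int m + 1/2} ?F) {-1/2..1/2}"
    by simp
  moreover have "cos (2 * pi * real k * (t + real_of_int m)) = cos (2 * pi * real k * t)" for t
  proof -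
    have "2 * pi * real k * (t + real_of_int m) = 2 * pi * real k * t + 2 * pi * real_of_int (int k * m)"
      by (simp add: algebra_simps)
    moreover have "cos (2 * pi * real_of_int (int k * m)) = 1" by (rule cos_int_2pin)
    moreover have "sin (2 * pi * real_of_int (int k * m)) = 0" by (rule sin_int_2pin)
    ultimately show ?thesis by (simp only: cos_add mult_1_right mult_zero_right diff_zero)
  qed
  ultimately show ?thesis by simp
qed

text \<open>Unfolding: integrating the sum of all shifts over one period is integrating a single
  Gaussian over the whole line.\<close>

lemma theta_fourier_coefficient:
  assumes x: "0 < x"
  shows "((\<lambda>t. theta_fun x (of_real t) * of_real (cos (2 * pi * real k * t))) has_integral
    of_real (exp (- (pi * (real k)\<^sup>2 / x)) / sqrt x)) {-1/2..1/2}"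
proof -
  let ?F = "\<lambda>v. exp (- (pi * x * v\<^sup>2)) * cos (2 * pi * real k * v)"
  \<comment> \<open>The first \<open>N\<close> terms carry the shifts from \<open>- N\<close> to
    \<open>N - 1\<close>, hence an interval centred at \<open>- 1/2\<close>.\<close>
  define J where "J = (\<lambda>N. integral {- real N - 1/2..real N - 1/2} ?F)"
  have Fint: "?F integrable_on {a..b}" for a b by (intro integrable_continuous_real continuous_intros)
  have partial: "((\<lambda>t. (\<Sum>n<N. theta_terms x n (of_real t)) * of_real (cos (2 * pi * real k * t))) has_integral of_real (J N)) {-1/2..1/2}" for N
  proof (induction N)
    case 0
    then show ?case by (simp add: J_def)
  next
    case (Suc N)
    let ?I = "\<lambda>m::int. integral {real_of_int m - 1/2..real_of_int m + 1/2} ?F"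
    have "((\<lambda>t. complex_of_real (exp (- (pi * x * (t + real_of_int (int N))\<^sup>2)) * cos (2 * pi * real k * t) +
        exp (- (pi * x * (t + real_of_int (- int N - 1))\<^sup>2)) * cos (2 * pi * real k * t))) has_integral
        of_real (?I (int N) + ?I (- int N - 1))) {-1/2..1/2}"
      by (intro has_integral_of_real has_integral_add gaussian_interval_integral)
    moreover have "complex_of_real (exp (- (pi * x * (t + real_of_int (int N))\<^sup>2)) * cos (2 * pi * real k * t) +
        exp (- (pi * x * (t + real_of_int (- int N - 1))\<^sup>2)) * cos (2 * pi * real k * t)) =
        theta_terms x N (of_real t) * of_real (cos (2 * pi * real k * t))" for t
      by (simp add: theta_terms_def exp_of_real[symmetric] algebra_simps)
    ultimately have "((\<lambda>t. theta_terms x N (of_real t) * of_real (cos (2 * pi * real k * t))) has_integral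
        of_real (?I (int N) + ?I (- int N - 1))) {-1/2..1/2}" by simp
    from has_integral_add[OF Suc this]
    have "((\<lambda>t. (\<Sum>n<Suc N. theta_terms x n (of_real t)) * of_real (cos (2 * pi * real k * t))) has_integral
        of_real (J N + (?I (int N) + ?I (- int N - 1)))) {-1/2..1/2}"
      by (simp add: algebra_simps)
    moreover have "J N + (?I (int N) + ?I (- int N - 1)) = J (Suc N)"
    proof -
      have "integral {- real N - 3/2..- real N - 1/2} ?F + integral {- real N - 1/2..real N - 1/2} ?F =
          integral {- real N - 3/2..real N - 1/2} ?F"
        by (intro Henstock_Kurzweil_Integration.integral_combine Fint) auto
      moreover have "integral {- real N - 3/2..real N - 1/2} ?F + integral {real N - 1/2..real N + 1/2} ?F =
          integral {- real N - 3/2..real N + 1/2} ?F"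
        by (intro Henstock_Kurzweil_Integration.integral_combine Fint) auto
      ultimately show ?thesis by (simp add: J_def algebra_simps)
    qed
    ultimately show ?case by (simp only:)
  qed
  have limJ: "(\<lambda>N. of_real (J N)) \<longlonglongrightarrow> integral {-1/2..1/2} (\<lambda>t. theta_fun x (of_real t) * of_real (cos (2 * pi * real k * t)))"
    and int: "(\<lambda>t. theta_fun x (of_real t) * of_real (cos (2 * pi * real k * t))) integrable_on {-1/2..1/2}"
  proof -
    show int: "(\<lambda>t. theta_fun x (of_real t) * of_real (cos (2 * pi * real k * t))) integrable_on {-1/2..1/2}"
    proof (intro integrable_continuous_real continuous_intros)
      show "continuous_on {-1/2..1/2} (\<lambda>t. theta_fun x (of_real t))"
        by (rule continuous_on_compose2[OF holomorphic_on_imp_continuous_on[OF theta_fun_holomorphic[OF x]]])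
           (auto intro!: continuous_intros)
    qed
    have u: "uniform_limit {-1/2..1/2} (\<lambda>N t. \<Sum>n<N. theta_terms x n (of_real t)) (\<lambda>t. theta_fun x (of_real t)) sequentially"
      by (rule uniform_limit_compose'[OF theta_uniform[OF x, of 1]]) auto
    have "uniform_limit {-1/2..1/2} (\<lambda>N t. (\<Sum>n<N. theta_terms x n (of_real t)) * of_real (cos (2 * pi * real k * t)))
        (\<lambda>t. theta_fun x (of_real t) * of_real (cos (2 * pi * real k * t))) sequentially"
    proof (rule uniform_limitI)
      fix e :: real assume "0 < e"
      from uniform_limitD[OF u this]
      show "\<forall>\<^sub>F N in sequentially. \<forall>t\<in>{-1/2..1/2}. dist ((\<Sum>n<N. theta_terms x n (of_real t)) * of_real (cos (2 * pi * real k * t)))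
          (theta_fun x (of_real t) * of_real (cos (2 * pi * real k * t))) < e"
      proof eventually_elim
        case (elim N)
        show ?case
        proof
          fix t :: real assume t: "t \<in> {-1/2..1/2}"
          have "norm ((\<Sum>n<N. theta_terms x n (of_real t)) - theta_fun x (of_real t)) * \<bar>cos (2 * pi * real k * t)\<bar> \<le>
              norm ((\<Sum>n<N. theta_terms x n (of_real t)) - theta_fun x (of_real t)) * 1"
            by (intro mult_left_mono) auto
          also have "\<dots> < e" using elim t unfolding dist_norm by simp
          finally show "dist ((\<Sum>n<N. theta_terms x n (of_real t)) * of_real (cos (2 * pi * real k * t)))
              (theta_fun x (of_real t) * of_real (cos (2 * pi * real k * t))) < e"
            by (simp add: dist_norm left_diff_distrib[symmetric] norm_mult)
        qed
      qed
    qed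
    then obtain I J' where IJ: "\<And>N. ((\<lambda>t. (\<Sum>n<N. theta_terms x n (of_real t)) * of_real (cos (2 * pi * real k * t))) has_integral I N) {-1/2..1/2}"
        "((\<lambda>t. theta_fun x (of_real t) * of_real (cos (2 * pi * real k * t))) has_integral J') {-1/2..1/2}" "I \<longlonglongrightarrow> J'"
    proof (rule uniform_limit_integral)
      show "continuous_on {- 1/2..1/2} (\<lambda>t. (\<Sum>n<N. theta_terms x n (of_real t)) * of_real (cos (2 * pi * real k * t)))" for N
        unfolding theta_terms_def by (intro continuous_intros)
    qed auto
    have "I = (\<lambda>N. of_real (J N))" by (intro ext has_integral_unique[OF IJ(1) partial])
    then show "(\<lambda>N. of_real (J N)) \<longlonglongrightarrow> integral {-1/2..1/2} (\<lambda>t. theta_fun x (of_real t) * of_real (cos (2 * pi * real k * t)))"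
      using IJ(3) unfolding integral_unique[OF IJ(2)] by (simp only:)
  qed
  have "J \<longlonglongrightarrow> exp (- (pi * (real k)\<^sup>2 / x)) / sqrt x"
  proof -
    have G: "has_bochner_integral lborel ?F (exp (- (pi * (real k)\<^sup>2 / x)) / sqrt x)" by (rule gaussian_fourier[OF x])
    have "(\<lambda>N. \<integral>v. indicator {- real N - 1/2..real N - 1/2} v *\<^sub>R ?F v \<partial>lborel) \<longlonglongrightarrow> (\<integral>v. ?F v \<partial>lborel)"
    proof (rule integral_dominated_convergence[where w = "\<lambda>v. \<bar>?F v\<bar>"])
      show "integrable lborel (\<lambda>v. \<bar>?F v\<bar>)" using G by (intro integrable_abs) (rule integrable.intros)
      show "AE v in lborel. (\<lambda>N. indicator {- real N - 1/2..real N - 1/2} v *\<^sub>R ?F v) \<longlonglongrightarrow> ?F v"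
      proof (intro AE_I2)
        fix v :: real
        have "eventually (\<lambda>N. indicator {- real N - 1/2..real N - 1/2} v *\<^sub>R ?F v = ?F v) sequentially"
        proof (rule eventually_sequentiallyI)
          fix N assume "nat \<lceil>\<bar>v\<bar> + 1\<rceil> \<le> N"
          then have "\<bar>v\<bar> + 1 \<le> real N" by linarith
          then show "indicator {- real N - 1/2..real N - 1/2} v *\<^sub>R ?F v = ?F v" by (auto simp: indicator_def abs_if split: if_splits)
        qed
        then show "(\<lambda>N. indicator {- real N - 1/2..real N - 1/2} v *\<^sub>R ?F v) \<longlonglongrightarrow> ?F v" by (rule tendsto_eventually)
      qed
    qed (auto simp: indicator_def)
    moreover have "(\<integral>v. indicator {a..b} v *\<^sub>R ?F v \<partial>lborel) = integral {a..b} ?F" for a b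
      using set_borel_integral_eq_integral(2)[OF borel_integrable_atLeastAtMost'[of a b ?F]]
      by (simp add: set_lebesgue_integral_def continuous_intros)
    ultimately show ?thesis
      using has_bochner_integral_integral_eq[OF G] unfolding J_def by simp
  qed
  then have "(\<lambda>N. complex_of_real (J N)) \<longlonglongrightarrow> of_real (exp (- (pi * (real k)\<^sup>2 / x)) / sqrt x)" by (rule tendsto_of_real)
  with limJ have eq: "integral {-1/2..1/2} (\<lambda>t. theta_fun x (of_real t) * of_real (cos (2 * pi * real k * t))) =
      of_real (exp (- (pi * (real k)\<^sup>2 / x)) / sqrt x)" by (rule LIMSEQ_unique)
  show ?thesis unfolding eq[symmetric] by (rule integrable_integral[OF int])
qed

section \<open>The functional equation of theta\<close>

definition theta_tail :: "real \<Rightarrow> real" where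
  "theta_tail x = (\<Sum>n. exp (- (pi * (real (Suc n))\<^sup>2 * x)))"

lemma theta_tail_sums:
  assumes x: "0 < x"
  shows "(\<lambda>n. exp (- (pi * (real (Suc n))\<^sup>2 * x))) sums theta_tail x"
  unfolding theta_tail_def
proof (rule summable_sums[OF summable_comparison_test'[OF summable_geometric[of "exp (- (pi * x))"]]])
  show "norm (exp (- (pi * (real (Suc n))\<^sup>2 * x))) \<le> exp (- (pi * x)) ^ n" for n
  proof -
    have "real n \<le> (real (Suc n))\<^sup>2" by (simp add: power2_eq_square algebra_simps)
    then have "pi * x * real n \<le> pi * x * (real (Suc n))\<^sup>2" using x by (intro mult_left_mono) auto
    then show ?thesis unfolding exp_of_nat_mult[symmetric] by (simp add: mult_ac)
  qed
qed (use x in simp)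

text \<open>The shifts by \<open>n\<close> contribute 1 and the tail, the shifts by
  \<open>- n - 1\<close> the tail once more.\<close>

lemma theta_fun_0:
  assumes x: "0 < x"
  shows "theta_fun x 0 = of_real (1 + 2 * theta_tail x)"
proof -
  have tail: "(\<lambda>n. exp (- (pi * x * (real (Suc n))\<^sup>2))) sums theta_tail x"
    using theta_tail_sums[OF x] by (simp add: mult_ac)
  then have "(\<lambda>n. exp (- (pi * x * (real n)\<^sup>2))) sums (theta_tail x + 1)"
    by (subst (asm) sums_Suc_iff) simp
  from sums_add[OF this tail]
  have "(\<lambda>n. complex_of_real (exp (- (pi * x * (real n)\<^sup>2)) + exp (- (pi * x * (real (Suc n))\<^sup>2)))) sums
      of_real (theta_tail x + 1 + theta_tail x)" by (rule sums_of_real)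
  moreover have "complex_of_real (exp (- (pi * x * (real n)\<^sup>2)) + exp (- (pi * x * (real (Suc n))\<^sup>2))) = theta_terms x n 0" for n
  proof -
    have "(- of_nat n - 1 :: complex)\<^sup>2 = (of_nat (Suc n))\<^sup>2" by (simp add: power2_eq_square algebra_simps)
    then show ?thesis unfolding theta_terms_def by (simp add: exp_of_real[symmetric])
  qed
  ultimately have "(\<lambda>n. theta_terms x n 0) sums of_real (theta_tail x + 1 + theta_tail x)" by simp
  from sums_unique2[OF theta_fun_sums[OF x] this] show ?thesis by simp
qed

text \<open>Poisson summation: the Dirichlet kernel sums the Fourier series of the periodised
  Gaussian at 0. The function value is the left-hand side, and the coefficients
  \<open>exp (- (pi * k\<^sup>2 / x)) / sqrt x\<close> add up to the right-hand side.\<close>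

theorem theta_functional_equation:
  assumes x: "0 < x"
  shows "1 + 2 * theta_tail x = (1 + 2 * theta_tail (1 / x)) / sqrt x"
proof -
  define c where "c = (\<lambda>k. exp (- (pi * (real k)\<^sup>2 / x)) / sqrt x)"
  have "integral {-1/2..1/2} (\<lambda>t. theta_fun x (of_real t) * of_real (dirichlet_kernel N t)) =
      of_real (c 0 + 2 * (\<Sum>k=1..N. c k))" for N
  proof (rule integral_unique)
    have fc: "((\<lambda>t. theta_fun x (of_real t) * of_real (cos (2 * pi * real k * t))) has_integral of_real (c k)) {-1/2..1/2}" for k
      unfolding c_def by (rule theta_fourier_coefficient[OF x])
    have "((\<lambda>t. theta_fun x (of_real t) * of_real (cos (2 * pi * real 0 * t)) +
        2 * (\<Sum>k=1..N. theta_fun x (of_real t) * of_real (cos (2 * pi * real k * t)))) has_integral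
        (of_real (c 0) + 2 * (\<Sum>k=1..N. of_real (c k)))) {-1/2..1/2}"
      by (intro has_integral_add has_integral_mult_right has_integral_sum fc) auto
    then show "((\<lambda>t. theta_fun x (of_real t) * of_real (dirichlet_kernel N t)) has_integral
        of_real (c 0 + 2 * (\<Sum>k=1..N. c k))) {-1/2..1/2}"
      by (simp add: dirichlet_kernel_def distrib_left sum_distrib_left mult.left_commute)
  qed
  with dirichlet_kernel_tendsto[of "theta_fun x"] theta_fun_holomorphic[OF x]
  have "(\<lambda>N. complex_of_real (c 0 + 2 * (\<Sum>k=1..N. c k))) \<longlonglongrightarrow> theta_fun x 0"
    by (auto intro: holomorphic_on_subset)
  then have "(\<lambda>N. c 0 + 2 * (\<Sum>k=1..N. c k)) \<longlonglongrightarrow> 1 + 2 * theta_tail x"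
    unfolding theta_fun_0[OF x] by (simp only: tendsto_of_real_iff)
  moreover have "(\<lambda>N. c 0 + 2 * (\<Sum>k=1..N. c k)) \<longlonglongrightarrow> 1 / sqrt x + 2 * (theta_tail (1 / x) / sqrt x)"
  proof -
    have "(\<lambda>N. \<Sum>n<N. exp (- (pi * (real (Suc n))\<^sup>2 * (1 / x)))) \<longlonglongrightarrow> theta_tail (1 / x)"
      using theta_tail_sums[of "1 / x"] x by (simp add: sums_def)
    then have "(\<lambda>N. 1 / sqrt x + 2 * ((\<Sum>n<N. exp (- (pi * (real (Suc n))\<^sup>2 * (1 / x)))) / sqrt x)) \<longlonglongrightarrow>
        1 / sqrt x + 2 * (theta_tail (1 / x) / sqrt x)"
      using x by (intro tendsto_intros) auto
    moreover have "1 / sqrt x + 2 * ((\<Sum>n<N. exp (- (pi * (real (Suc n))\<^sup>2 * (1 / x)))) / sqrt x) =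
        c 0 + 2 * (\<Sum>k=1..N. c k)" for N
    proof -
      have "(\<Sum>k=1..N. c k) = (\<Sum>n<N. c (Suc n))"
        by (rule sum.reindex_bij_witness[of _ Suc "\<lambda>k. k - 1"]) auto
      then show ?thesis by (simp add: c_def sum_divide_distrib)
    qed
    ultimately show ?thesis by simp
  qed
  ultimately have "1 + 2 * theta_tail x = 1 / sqrt x + 2 * (theta_tail (1 / x) / sqrt x)"
    by (rule LIMSEQ_unique)
  then show ?thesis by (simp add: add_divide_distrib)
qed

section \<open>The xi function\<close>

lemma has_bochner_integral_indicator_iff:
  fixes g :: "real \<Rightarrow> real"
  assumes [measurable]: "g \<in> borel_measurable borel" "S \<in> sets borel"
  shows "has_bochner_integral lborel (\<lambda>x. indicator S x * g x) I \<longleftrightarrow> g absolutely_integrable_on S \<and> integral S g = I"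
proof -
  have m: "(\<lambda>x. indicator S x * g x) \<in> borel_measurable lborel" by measurable
  have "g absolutely_integrable_on S \<longleftrightarrow> integrable lborel (\<lambda>x. indicator S x * g x)"
    by (simp add: set_integrable_def integrable_completion[OF m])
  moreover have "integral S g = (\<integral>x. indicator S x * g x \<partial>lborel)" if "g absolutely_integrable_on S"
    using set_lebesgue_integral_eq_integral(2)[OF that] integral_completion[OF m]
    by (simp add: set_lebesgue_integral_def)
  ultimately show ?thesis by (auto simp: has_bochner_integral_iff)
qed

lemma theta_tail_measurable [measurable]: "theta_tail \<in> borel_measurable borel"
  unfolding theta_tail_def[abs_def] by measurable

lemma theta_tail_nonneg: "0 < x \<Longrightarrow> 0 \<le> theta_tail x"
  by (rule sums_le[OF _ sums_zero theta_tail_sums]) simp_all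

text \<open>As \<open>pi > 3\<close>, the \<open>n\<close>-th exponent, counted from 0, is at least
  \<open>x + 2 * n\<close>. The series is below a geometric one of ratio
  \<open>exp (- 2) \<le> 1 / 3\<close>, whence \<open>3 / 2\<close>. The constant is explicit
  because it later decides the sign of xi at \<open>1/2\<close>.\<close>

lemma theta_tail_le:
  assumes x: "1 \<le> x"
  shows "theta_tail x \<le> 3 / 2 * exp (- x)"
proof -
  have "3 \<le> exp (2::real)" using exp_ge_add_one_self[of "2::real"] by simp
  then have "inverse (exp 2) \<le> inverse (3::real)" by (rule le_imp_inverse_le) simp
  then have e: "exp (- 2) \<le> 1 / (3::real)" unfolding exp_minus by (simp only: inverse_eq_divide)
  have geo: "(\<lambda>n. exp (- x) * exp (- 2) ^ n) sums (exp (- x) * (1 / (1 - exp (- 2))))"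
    by (intro sums_mult geometric_sums) simp
  have le: "exp (- (pi * (real (Suc n))\<^sup>2 * x)) \<le> exp (- x) * exp (- 2) ^ n" for n
  proof -
    have "x + 2 * real n \<le> 3 * real (Suc n) * x"
    proof -
      have "real n * 1 \<le> real n * x" using x by (intro mult_left_mono) auto
      then show ?thesis using x by (simp add: algebra_simps)
    qed
    also have "\<dots> \<le> pi * (real (Suc n))\<^sup>2 * x"
    proof (intro mult_right_mono)
      have "3 * real (Suc n) \<le> pi * real (Suc n)" using pi_gt3 by (intro mult_right_mono) auto
      also have "\<dots> \<le> pi * (real (Suc n))\<^sup>2"
      proof (rule mult_left_mono)
        have "real (Suc n) * 1 \<le> real (Suc n) * real (Suc n)" by (rule mult_left_mono) auto
        then show "real (Suc n) \<le> (real (Suc n))\<^sup>2" by (simp only: power2_eq_square mult_1_right)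
      qed simp
      finally show "3 * real (Suc n) \<le> pi * (real (Suc n))\<^sup>2" .
    qed (use x in auto)
    finally have "x + 2 * real n \<le> pi * (real (Suc n))\<^sup>2 * x" .
    then have "- (pi * (real (Suc n))\<^sup>2 * x) \<le> - x + real n * - 2" by linarith
    then have "exp (- (pi * (real (Suc n))\<^sup>2 * x)) \<le> exp (- x + real n * - 2)" by (rule exp_le_cancel_iff[THEN iffD2])
    then show ?thesis unfolding exp_add exp_of_nat_mult .
  qed
  have "theta_tail x \<le> exp (- x) * (1 / (1 - exp (- 2)))"
    by (rule sums_le[OF le theta_tail_sums geo]) (use x in simp)
  also have "\<dots> \<le> exp (- x) * (3 / 2)"
  proof (rule mult_left_mono)
    have "2 / 3 \<le> 1 - exp (- 2 :: real)" using e by linarith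
    then have "1 / (1 - exp (- 2 :: real)) \<le> 1 / (2 / 3)" by (intro divide_left_mono mult_pos_pos) linarith+
    then show "1 / (1 - exp (- 2 :: real)) \<le> 3 / 2" by simp
  qed simp
  finally show ?thesis by (simp add: mult.commute)
qed

lemma has_bochner_integral_Gamma:
  fixes r c :: real
  assumes r: "0 < r" and c: "0 < c"
  shows "has_bochner_integral lborel (\<lambda>x. indicator {0<..} x * (x powr (r - 1) * exp (- (c * x)))) (Gamma r * c powr (- r))"
proof -
  have "((\<lambda>t. t powr (r - 1) / exp t) has_integral Gamma r) {0..}" by (rule Gamma_integral_real[OF r])
  moreover from this have "(\<lambda>t. t powr (r - 1) / exp t) absolutely_integrable_on {0..}"
    by (intro nonnegative_absolutely_integrable_1) auto
  ultimately have "has_bochner_integral lborel (\<lambda>t. indicator {0..} t * (t powr (r - 1) / exp t)) (Gamma r)"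
    by (subst has_bochner_integral_indicator_iff) auto
  moreover have "indicator {0..} t * (t powr (r - 1) / exp t) = indicator {0<..} t * (t powr (r - 1) * exp (- t))" for t
    by (auto simp: indicator_def exp_minus divide_inverse)
  ultimately have "has_bochner_integral lborel (\<lambda>t. indicator {0<..} t * (t powr (r - 1) * exp (- t))) (Gamma r)" by simp
  then have "has_bochner_integral lborel (\<lambda>x. indicator {0<..} (0 + c * x) * ((0 + c * x) powr (r - 1) * exp (- (0 + c * x)))) (Gamma r /\<^sub>R \<bar>c\<bar>)"
    by (subst (asm) lborel_has_bochner_integral_real_affine_iff[of c _ _ 0]) (use c in auto)
  then have "has_bochner_integral lborel (\<lambda>x. c powr (1 - r) * (indicator {0<..} (0 + c * x) * ((0 + c * x) powr (r - 1) * exp (- (0 + c * x)))))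
      (c powr (1 - r) * (Gamma r /\<^sub>R \<bar>c\<bar>))" by (rule has_bochner_integral_mult_right)
  moreover have "c powr (1 - r) * (indicator {0<..} (0 + c * x) * ((0 + c * x) powr (r - 1) * exp (- (0 + c * x)))) =
      indicator {0<..} x * (x powr (r - 1) * exp (- (c * x)))" for x
  proof (cases "x > 0")
    case True
    have "c powr (1 - r) * (c * x) powr (r - 1) = (c powr (1 - r) * c powr (r - 1)) * x powr (r - 1)"
      using True c by (simp add: powr_mult)
    also have "c powr (1 - r) * c powr (r - 1) = 1" using c by (simp add: powr_add[symmetric])
    finally show ?thesis using True c by simp
  next
    case False
    then have "\<not> c * x > 0" using c by (simp add: zero_less_mult_iff)
    then show ?thesis using False by simp
  qed
  moreover have "c powr (1 - r) * (Gamma r /\<^sub>R \<bar>c\<bar>) = Gamma r * c powr (- r)"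
    using c by (simp add: powr_diff powr_minus divide_inverse)
  ultimately show ?thesis by (simp only:)
qed

lemma cosh_measurable [measurable]: "(cosh :: real \<Rightarrow> real) \<in> borel_measurable borel"
  by (intro borel_measurable_continuous_onI continuous_intros)

lemma cosh_sums_even: "(\<lambda>k. x ^ (2 * k) / fact (2 * k)) sums cosh (x :: real)"
proof -
  have "(\<lambda>k. (\<lambda>n. if even n then x ^ n /\<^sub>R fact n else 0) (2 * k)) sums cosh x"
    by (subst sums_mono_reindex[where f = "\<lambda>n. if even n then x ^ n /\<^sub>R fact n else 0"])
       (auto simp: strict_mono_def cosh_converges elim!: evenE)
  then show ?thesis by (simp add: divide_inverse mult.commute)
qed

text \<open>Even moments in the variable \<open>ln y / 2\<close>. The factor
  \<open>y powr (- 3/4)\<close> centres the two powers of \<open>y\<close> in Riemann's integral at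
  \<open>s = 1/2\<close>, where they combine to a hyperbolic cosine.\<close>

definition theta_moment :: "nat \<Rightarrow> real" where
  "theta_moment k = (\<integral>y. indicator {1<..} y * (theta_tail y * y powr (- 3/4) * (ln y / 2) ^ (2 * k)) \<partial>lborel)"

definition theta_cosh_integral :: "real \<Rightarrow> real" where
  "theta_cosh_integral \<sigma> = (\<integral>y. indicator {1<..} y * (theta_tail y * y powr (- 3/4) * cosh (\<sigma> * (ln y / 2))) \<partial>lborel)"

lemma theta_cosh_bound:
  assumes "\<bar>\<sigma>\<bar> \<le> real m" and y: "1 < y"
  shows "theta_tail y * y powr (- 3/4) * cosh (\<sigma> * (ln y / 2)) \<le> 3 / 2 * (y ^ m * exp (- y))"
proof -
  have "cosh (\<sigma> * (ln y / 2)) \<le> exp \<bar>\<sigma> * (ln y / 2)\<bar>"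
  proof -
    have le: "cosh t \<le> exp \<bar>t\<bar>" for t :: real
      by (cases "t \<ge> 0") (auto simp: cosh_field_def)
    show ?thesis by (rule le)
  qed
  also have "\<bar>\<sigma> * (ln y / 2)\<bar> \<le> real m * ln y"
  proof -
    have "\<bar>\<sigma>\<bar> * (ln y / 2) \<le> real m * ln y" using assms by (intro mult_mono) auto
    then show ?thesis using y by (simp add: abs_mult)
  qed
  then have "exp \<bar>\<sigma> * (ln y / 2)\<bar> \<le> exp (real m * ln y)" by simp
  also have "exp (real m * ln y) = y ^ m" using y by (simp add: exp_of_nat_mult)
  finally have c: "cosh (\<sigma> * (ln y / 2)) \<le> y ^ m" .
  have "y powr (- 3/4) \<le> y powr 0" using y by (intro powr_mono) auto
  then have "y powr (- 3/4) \<le> 1" using y by simp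
  then have "theta_tail y * y powr (- 3/4) * cosh (\<sigma> * (ln y / 2)) \<le> (3 / 2 * exp (- y)) * 1 * y ^ m"
    using y theta_tail_le[of y] theta_tail_nonneg[of y] c by (intro mult_mono mult_nonneg_nonneg) auto
  then show ?thesis by (simp add: mult_ac)
qed

lemma theta_cosh_majorant:
  "has_bochner_integral lborel (\<lambda>y. 3 / 2 * (indicator {0<..} y * (y ^ m * exp (- y)))) (3 / 2 * fact m :: real)"
proof -
  have "has_bochner_integral lborel (\<lambda>x. indicator {0<..} x * (x powr (real (Suc m) - 1) * exp (- (1 * x)))) (Gamma (real (Suc m)) * 1 powr (- real (Suc m)))"
    by (rule has_bochner_integral_Gamma) auto
  moreover have "indicator {0<..} x * (x powr (real (Suc m) - 1) * exp (- (1 * x))) = indicator {0<..} x * (x ^ m * exp (- x))" for x :: real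
    by (cases "x > 0") (auto simp: powr_realpow)
  moreover have "Gamma (real (Suc m)) * 1 powr (- real (Suc m)) = fact m"
    using Gamma_fact[of m, where 'a = real] by (simp add: add_ac)
  ultimately have "has_bochner_integral lborel (\<lambda>x. indicator {0<..} x * (x ^ m * exp (- x))) (fact m :: real)" by (simp only:)
  then show ?thesis by (rule has_bochner_integral_mult_right)
qed

text \<open>The cosh series has nonnegative terms, so its partial sums share the majorant of cosh
  itself and may be integrated termwise. The majorant integrates to a multiple of
  \<open>fact m\<close>, which is what later bounds the growth of xi.\<close>

lemma theta_cosh_integral:
  assumes m: "\<bar>\<sigma>\<bar> \<le> real m"
  shows theta_cosh_integrable: "integrable lborel (\<lambda>y. indicator {1<..} y * (theta_tail y * y powr (- 3/4) * cosh (\<sigma> * (ln y / 2))))"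
    and theta_moment_sums: "(\<lambda>k. \<sigma> ^ (2 * k) / fact (2 * k) * theta_moment k) sums theta_cosh_integral \<sigma>"
    and theta_cosh_integral_le: "theta_cosh_integral \<sigma> \<le> 3 / 2 * fact m"
proof -
  let ?D = "\<lambda>y. 3 / 2 * (indicator {0<..} y * (y ^ m * exp (- y))) :: real"
  let ?w = "\<lambda>y. theta_tail y * y powr (- 3/4)"
  have w_nn: "0 \<le> ?w y" if "1 < y" for y using theta_tail_nonneg[of y] that by simp
  have D_int: "integrable lborel ?D" using theta_cosh_majorant by (rule integrable.intros)
  have partial: "indicator {1<..} y * (?w y * (\<Sum>k<N. (\<sigma> * (ln y / 2)) ^ (2 * k) / fact (2 * k))) \<in> {0..?D y}" for N y
  proof (cases "1 < y")
    case True
    have "(\<Sum>k<N. (\<sigma> * (ln y / 2)) ^ (2 * k) / fact (2 * k)) \<le> cosh (\<sigma> * (ln y / 2))"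
    proof -
      note cs = cosh_sums_even[of "\<sigma> * (ln y / 2)"]
      show ?thesis unfolding sums_unique[OF cs] by (rule sum_le_suminf[OF sums_summable[OF cs]]) auto
    qed
    then have "?w y * (\<Sum>k<N. (\<sigma> * (ln y / 2)) ^ (2 * k) / fact (2 * k)) \<le> ?w y * cosh (\<sigma> * (ln y / 2))"
      using w_nn[OF True] by (rule mult_left_mono)
    also have "\<dots> \<le> 3 / 2 * (y ^ m * exp (- y))" using theta_cosh_bound[OF m True] .
    finally have "?w y * (\<Sum>k<N. (\<sigma> * (ln y / 2)) ^ (2 * k) / fact (2 * k)) \<le> 3 / 2 * (y ^ m * exp (- y))" .
    moreover have "0 \<le> ?w y * (\<Sum>k<N. (\<sigma> * (ln y / 2)) ^ (2 * k) / fact (2 * k))"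
      by (rule mult_nonneg_nonneg[OF w_nn[OF True]]) (auto intro!: sum_nonneg)
    ultimately show ?thesis using True by simp
  qed (auto simp: indicator_def)
  have moment_int: "integrable lborel (\<lambda>y. indicator {1<..} y * (?w y * ((\<sigma> * (ln y / 2)) ^ (2 * k) / fact (2 * k))))" for k
  proof (rule Bochner_Integration.integrable_bound[OF D_int])
    have le: "norm a \<le> norm d" if "a \<in> {0..d}" for a d :: real using that by simp
    have "indicator {1<..} y * (?w y * ((\<sigma> * (ln y / 2)) ^ (2 * k) / fact (2 * k))) \<in> {0..?D y}" for y
    proof (cases "1 < y")
      case True
      then have ind: "indicator {1<..} y = (1::real)" by simp
      have "(\<sigma> * (ln y / 2)) ^ (2 * k) / fact (2 * k) \<le> (\<Sum>k<Suc k. (\<sigma> * (ln y / 2)) ^ (2 * k) / fact (2 * k))"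
        by (simp add: sum_nonneg)
      note le1 = mult_left_mono[OF this w_nn[OF True]]
      have "?w y * (\<Sum>k<Suc k. (\<sigma> * (ln y / 2)) ^ (2 * k) / fact (2 * k)) \<le> ?D y"
        using partial[of y "Suc k"] unfolding ind mult_1 atLeastAtMost_iff by blast
      with le1 have "?w y * ((\<sigma> * (ln y / 2)) ^ (2 * k) / fact (2 * k)) \<le> ?D y" by (rule order_trans)
      moreover have "0 \<le> ?w y * ((\<sigma> * (ln y / 2)) ^ (2 * k) / fact (2 * k))"
        by (rule mult_nonneg_nonneg[OF w_nn[OF True]]) simp
      ultimately show ?thesis unfolding ind mult_1 atLeastAtMost_iff by blast
    qed (auto simp: indicator_def)
    then show "AE y in lborel. norm (indicator {1<..} y * (?w y * ((\<sigma> * (ln y / 2)) ^ (2 * k) / fact (2 * k)))) \<le> norm (?D y)"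
      by (intro AE_I2 le)
  qed measurable
  have moment_eq: "(\<integral>y. indicator {1<..} y * (?w y * ((\<sigma> * (ln y / 2)) ^ (2 * k) / fact (2 * k))) \<partial>lborel) =
      \<sigma> ^ (2 * k) / fact (2 * k) * theta_moment k" for k
  proof -
    have "indicator {1<..} y * (?w y * ((\<sigma> * (ln y / 2)) ^ (2 * k) / fact (2 * k))) =
        \<sigma> ^ (2 * k) / fact (2 * k) * (indicator {1<..} y * (?w y * (ln y / 2) ^ (2 * k)))" for y
      unfolding power_mult_distrib[of \<sigma>] by (simp only: divide_inverse mult_ac)
    then show ?thesis unfolding theta_moment_def by (simp only: integral_mult_right_zero)
  qed
  have lim: "AE y in lborel. (\<lambda>N. indicator {1<..} y * (?w y * (\<Sum>k<N. (\<sigma> * (ln y / 2)) ^ (2 * k) / fact (2 * k)))) \<longlonglongrightarrow>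
      indicator {1<..} y * (?w y * cosh (\<sigma> * (ln y / 2)))"
    by (intro AE_I2 tendsto_mult tendsto_const cosh_sums_even[unfolded sums_def])
  have bound: "AE y in lborel. norm (indicator {1<..} y * (?w y * (\<Sum>k<N. (\<sigma> * (ln y / 2)) ^ (2 * k) / fact (2 * k)))) \<le> ?D y" for N
  proof -
    have le: "norm a \<le> d" if "a \<in> {0..d}" for a d :: real using that by simp
    show ?thesis by (intro AE_I2 le partial)
  qed
  show "integrable lborel (\<lambda>y. indicator {1<..} y * (?w y * cosh (\<sigma> * (ln y / 2))))"
    by (rule integrable_dominated_convergence[OF _ _ D_int lim bound]; measurable)
  have limI: "(\<lambda>N. \<integral>y. indicator {1<..} y * (?w y * (\<Sum>k<N. (\<sigma> * (ln y / 2)) ^ (2 * k) / fact (2 * k))) \<partial>lborel) \<longlonglongrightarrow> theta_cosh_integral \<sigma>"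
    unfolding theta_cosh_integral_def by (rule integral_dominated_convergence[OF _ _ D_int lim bound]; measurable)
  have eqI: "(\<integral>y. indicator {1<..} y * (?w y * (\<Sum>k<N. (\<sigma> * (ln y / 2)) ^ (2 * k) / fact (2 * k))) \<partial>lborel) =
      (\<Sum>k<N. \<sigma> ^ (2 * k) / fact (2 * k) * theta_moment k)" for N
    unfolding moment_eq[symmetric] sum_distrib_left by (rule Bochner_Integration.integral_sum) (rule moment_int)
  show "(\<lambda>k. \<sigma> ^ (2 * k) / fact (2 * k) * theta_moment k) sums theta_cosh_integral \<sigma>"
    using limI unfolding eqI sums_def .
  show "theta_cosh_integral \<sigma> \<le> 3 / 2 * fact m"
  proof (rule LIMSEQ_le_const2[OF limI], intro exI allI impI)
    fix N
    have "(\<integral>y. indicator {1<..} y * (?w y * (\<Sum>k<N. (\<sigma> * (ln y / 2)) ^ (2 * k) / fact (2 * k))) \<partial>lborel) \<le> (\<integral>y. ?D y \<partial>lborel)"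
    proof (rule integral_mono_AE'[OF D_int]; intro AE_I2)
      fix y
      show "indicator {1<..} y * (?w y * (\<Sum>k<N. (\<sigma> * (ln y / 2)) ^ (2 * k) / fact (2 * k))) \<le> ?D y"
        using partial[of y N] unfolding atLeastAtMost_iff by blast
      show "0 \<le> ?D y" by (auto simp: indicator_def)
    qed
    then show "(\<integral>y. indicator {1<..} y * (?w y * (\<Sum>k<N. (\<sigma> * (ln y / 2)) ^ (2 * k) / fact (2 * k))) \<partial>lborel) \<le> 3 / 2 * fact m"
      using has_bochner_integral_integral_eq[OF theta_cosh_majorant] by simp
  qed
qed

section \<open>Riemann's integral on the real axis\<close>

lemma powr_halfline:
  fixes p :: real
  assumes p: "1 < p"
  shows "has_bochner_integral lborel (\<lambda>y. indicator {1<..} y * y powr (- p)) (1 / (p - 1))"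
proof -
  have "((\<lambda>x. x powr (- p)) has_integral - (1 powr (- p + 1)) / (- p + 1)) {1..}"
    by (rule has_integral_powr_to_inf) (use p in auto)
  moreover have "- (1 powr (- p + 1)) / (- p + 1) = 1 / (p - 1)" using p by (simp add: field_simps)
  ultimately have I: "((\<lambda>x. x powr (- p)) has_integral 1 / (p - 1)) {1..}" by simp
  then have "(\<lambda>x. x powr (- p)) absolutely_integrable_on {1..}"
    by (intro nonnegative_absolutely_integrable_1) auto
  with I have J: "has_bochner_integral lborel (\<lambda>y. indicator {1..} y * y powr (- p)) (1 / (p - 1))"
    by (subst has_bochner_integral_indicator_iff) auto
  have "AE y in lborel. y \<noteq> (1::real)" by (rule AE_lborel_singleton)
  then have "AE y in lborel. indicator {1..} y * y powr (- p) = indicator {1<..} y * y powr (- p)"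
    by eventually_elim (auto simp: indicator_def)
  then show ?thesis by (rule has_bochner_integralI_AE[OF J, rotated]) measurable
qed

lemma theta_tail_inverse:
  assumes y: "0 < y"
  shows "theta_tail (1 / y) = sqrt y * theta_tail y + sqrt y / 2 - 1 / 2"
proof -
  have "(1 + 2 * theta_tail (1 / y)) / sqrt y = 1 + 2 * theta_tail y"
    using theta_functional_equation[OF y] by simp
  then have "1 + 2 * theta_tail (1 / y) = (1 + 2 * theta_tail y) * sqrt y"
    using y by (simp add: divide_eq_eq)
  then show ?thesis by (simp add: algebra_simps)
qed

lemma summable_powr_neg:
  assumes "1 < p" shows "summable (\<lambda>n. real (Suc n) powr (- p))"
  using summable_real_powr_iff[of "- p"] assms by (subst summable_Suc_iff) simp

text \<open>Termwise integration, each term being a Gamma integral. With \<open>r = s / 2\<close>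
  real all terms are nonnegative, and \<open>r > 1/2\<close> makes the Dirichlet series converge;
  complex arguments follow later by analytic continuation.\<close>

lemma theta_mellin:
  fixes r :: real
  assumes r: "1 / 2 < r"
  shows "has_bochner_integral lborel (\<lambda>x. indicator {0<..} x * (x powr (r - 1) * theta_tail x))
    (Gamma r * pi powr (- r) * (\<Sum>n. real (Suc n) powr (- (2 * r))))"
proof -
  let ?g = "\<lambda>n x. indicator {0<..} x * (x powr (r - 1) * exp (- (pi * (real (Suc n))\<^sup>2 * x))) :: real"
  have r0: "0 < r" using r by simp
  have val: "Gamma r * (pi * (real (Suc n))\<^sup>2) powr (- r) = Gamma r * pi powr (- r) * real (Suc n) powr (- (2 * r))" for n
  proof -
    have "(real (Suc n))\<^sup>2 = real (Suc n) powr 2" by (simp add: powr_numeral)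
    then have "((real (Suc n))\<^sup>2) powr (- r) = real (Suc n) powr (- (2 * r))" by (simp only: powr_powr) simp
    then show ?thesis by (simp add: powr_mult del: of_nat_Suc)
  qed
  have g: "has_bochner_integral lborel (?g n) (Gamma r * pi powr (- r) * real (Suc n) powr (- (2 * r)))" for n
    using has_bochner_integral_Gamma[OF r0, of "pi * (real (Suc n))\<^sup>2"] unfolding val by simp
  have int: "integrable lborel (?g n)" for n using g by (rule integrable.intros)
  have nn: "0 \<le> ?g n x" for n x by (simp add: indicator_def)
  have sums_x: "(\<lambda>n. ?g n x) sums (indicator {0<..} x * (x powr (r - 1) * theta_tail x))" for x
  proof (cases "x > 0")
    case True
    then show ?thesis by (intro sums_mult theta_tail_sums)
  qed (simp add: sums_zero)
  have norm_int: "(\<integral>x. norm (?g n x) \<partial>lborel) = Gamma r * pi powr (- r) * real (Suc n) powr (- (2 * r))" for n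
    using nn has_bochner_integral_integral_eq[OF g[of n]] by simp
  have ae: "AE x in lborel. summable (\<lambda>n. norm (?g n x))"
  proof (intro AE_I2)
    fix x show "summable (\<lambda>n. norm (?g n x))"
      using sums_summable[OF sums_x[of x]] nn by (simp only: real_norm_def abs_of_nonneg)
  qed
  have sm: "summable (\<lambda>n. \<integral>x. norm (?g n x) \<partial>lborel)"
    unfolding norm_int using r by (intro summable_mult summable_powr_neg) auto
  have "integrable lborel (\<lambda>x. \<Sum>n. ?g n x)" by (rule integrable_suminf[OF int ae sm])
  moreover have "(\<integral>x. (\<Sum>n. ?g n x) \<partial>lborel) = (\<Sum>n. \<integral>x. ?g n x \<partial>lborel)" by (rule integral_suminf[OF int ae sm])
  ultimately have "has_bochner_integral lborel (\<lambda>x. \<Sum>n. ?g n x) (\<Sum>n. Gamma r * pi powr (- r) * real (Suc n) powr (- (2 * r)))"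
    by (simp only: has_bochner_integral_iff has_bochner_integral_integral_eq[OF g])
  moreover have "(\<Sum>n. Gamma r * pi powr (- r) * real (Suc n) powr (- (2 * r))) = Gamma r * pi powr (- r) * (\<Sum>n. real (Suc n) powr (- (2 * r)))"
    by (rule suminf_mult) (use r in \<open>intro summable_powr_neg, simp\<close>)
  ultimately show ?thesis by (simp only: sums_unique[OF sums_x, symmetric])
qed

lemma inversion_substitution:
  fixes f :: "real \<Rightarrow> real"
  assumes [measurable]: "f \<in> borel_measurable borel"
    and f: "has_bochner_integral lborel (\<lambda>x. indicator {0<..<1} x * f x) I"
  shows "has_bochner_integral lborel (\<lambda>y. indicator {1<..} y * (1 / y\<^sup>2 * f (1 / y))) I"
proof -
  have img: "(\<lambda>y. 1 / y) ` {1<..} = {0<..<(1::real)}"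
  proof (intro equalityI subsetI)
    fix x :: real assume x: "x \<in> {0<..<1}"
    then show "x \<in> (\<lambda>y. 1 / y) ` {1<..}" by (intro image_eqI[of _ _ "1 / x"]) auto
  qed auto
  have "f absolutely_integrable_on ((\<lambda>y. 1 / y) ` {1<..}) \<and> integral ((\<lambda>y. 1 / y) ` {1<..}) f = I"
    using f unfolding img by (subst (asm) has_bochner_integral_indicator_iff) auto
  then have "(\<lambda>y. \<bar>- 1 / y\<^sup>2\<bar> * f (1 / y)) absolutely_integrable_on {1<..} \<and> integral {1<..} (\<lambda>y. \<bar>- 1 / y\<^sup>2\<bar> * f (1 / y)) = I"
  proof (subst has_absolute_integral_change_of_variables_1'[where g = "\<lambda>y. 1 / y" and g' = "\<lambda>y. - 1 / y\<^sup>2"])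
    show "((\<lambda>y. 1 / y) has_field_derivative - 1 / x\<^sup>2) (at x within {1<..})" if "x \<in> {1<..}" for x :: real
      using that by (auto intro!: derivative_eq_intros simp: power2_eq_square)
    show "inj_on (\<lambda>y::real. 1 / y) {1<..}" by (auto simp: inj_on_def)
  qed auto
  then have "has_bochner_integral lborel (\<lambda>y. indicator {1<..} y * (\<bar>- 1 / y\<^sup>2\<bar> * f (1 / y))) I"
    by (subst has_bochner_integral_indicator_iff) auto
  then show ?thesis by simp
qed


text \<open>The Mellin integral is cut at 1, the part below 1 is inverted by
  \<open>x = 1 / y\<close>, and the functional equation brings back the theta tail at
  \<open>y\<close>. The leftover \<open>sqrt y / 2 - 1 / 2\<close> gives the two rational summands,
  and the two powers of \<open>y\<close> beside the tail form the cosh.\<close>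

lemma completed_zeta_real:
  fixes r :: real
  assumes r: "1 / 2 < r"
  shows "Gamma r * pi powr (- r) * (\<Sum>n. real (Suc n) powr (- (2 * r))) =
    2 * theta_cosh_integral (2 * r - 1 / 2) + (1 / (r - 1 / 2) - 1 / r) / 2"
proof -
  let ?f = "\<lambda>x. x powr (r - 1) * theta_tail x"
  let ?L = "Gamma r * pi powr (- r) * (\<Sum>n. real (Suc n) powr (- (2 * r)))"
  have mel: "has_bochner_integral lborel (\<lambda>x. indicator {0<..} x * ?f x) ?L" by (rule theta_mellin[OF r])
  have part: "integrable lborel (\<lambda>x. indicator S x * ?f x)" if S: "S \<in> sets borel" "S \<subseteq> {0<..}" for S
  proof -
    have "integrable lborel (\<lambda>x. indicator S x *\<^sub>R (indicator {0<..} x * ?f x))"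
      using mel S by (intro integrable_mult_indicator) (auto simp: has_bochner_integral_iff)
    moreover have "indicator S x *\<^sub>R (indicator {0<..} x * ?f x) = indicator S x * ?f x" for x
      using S by (auto simp: indicator_def)
    ultimately show ?thesis by (simp only:)
  qed
  define A where "A = (\<integral>x. indicator {0<..<1} x * ?f x \<partial>lborel)"
  define B where "B = (\<integral>x. indicator {1<..} x * ?f x \<partial>lborel)"
  have hA: "has_bochner_integral lborel (\<lambda>x. indicator {0<..<1} x * ?f x) A"
    unfolding A_def by (rule has_bochner_integral_integrable[OF part]) auto
  have hB: "has_bochner_integral lborel (\<lambda>x. indicator {1<..} x * ?f x) B"
    unfolding B_def by (rule has_bochner_integral_integrable[OF part]) auto
  have "AE x in lborel. x \<noteq> (1::real)" by (rule AE_lborel_singleton)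
  then have "AE x in lborel. indicator {0<..<1} x * ?f x + indicator {1<..} x * ?f x = indicator {0<..} x * ?f x"
    by eventually_elim (auto simp: indicator_def)
  from has_bochner_integral_eq_AE[OF has_bochner_integral_add[OF hA hB] mel this]
  have L: "?L = A + B" by simp
  have hA': "has_bochner_integral lborel (\<lambda>y. indicator {1<..} y * (1 / y\<^sup>2 * ?f (1 / y))) A"
    by (rule inversion_substitution[OF _ hA]) measurable
  have p1: "has_bochner_integral lborel (\<lambda>y. indicator {1<..} y * y powr (- (r + 1 / 2))) (1 / (r + 1 / 2 - 1))"
    by (rule powr_halfline) (use r in simp)
  have p2: "has_bochner_integral lborel (\<lambda>y. indicator {1<..} y * y powr (- (r + 1))) (1 / (r + 1 - 1))"
    by (rule powr_halfline) (use r in simp)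
  have hP: "has_bochner_integral lborel (\<lambda>y. 1 / 2 * (indicator {1<..} y * y powr (- (r + 1 / 2)) - indicator {1<..} y * y powr (- (r + 1))))
      (1 / 2 * (1 / (r + 1 / 2 - 1) - 1 / (r + 1 - 1)))"
    by (intro has_bochner_integral_mult_right has_bochner_integral_diff p1 p2)
  have pt: "indicator {1<..} y * (1 / y\<^sup>2 * ?f (1 / y)) + indicator {1<..} y * ?f y -
      1 / 2 * (indicator {1<..} y * y powr (- (r + 1 / 2)) - indicator {1<..} y * y powr (- (r + 1))) =
      2 * (indicator {1<..} y * (theta_tail y * y powr (- 3/4) * cosh ((2 * r - 1 / 2) * (ln y / 2))))" for y :: real
  proof (cases "1 < y")
    case True
    have inv: "1 / y\<^sup>2 * (1 / y) powr (r - 1) = y powr (- (r + 1))"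
    proof -
      have "(1 / y) powr (r - 1) = y powr (1 - r)" using True by (simp add: powr_divide powr_minus_divide[symmetric])
      moreover have "1 / y\<^sup>2 = y powr (- 2)" using True by (simp add: powr_minus_divide powr_numeral)
      ultimately have "1 / y\<^sup>2 * (1 / y) powr (r - 1) = y powr (- 2 + (1 - r))" by (simp only: powr_add)
      also have "- 2 + (1 - r) = - (r + 1)" by simp
      finally show ?thesis .
    qed
    have sq: "y powr (- (r + 1)) * sqrt y = y powr (- (r + 1 / 2))"
    proof -
      have "sqrt y = y powr (1 / 2)" using True by (simp add: powr_half_sqrt)
      then have "y powr (- (r + 1)) * sqrt y = y powr (- (r + 1) + 1 / 2)" by (simp only: powr_add)
      also have "- (r + 1) + 1 / 2 = - (r + 1 / 2)" by simp
      finally show ?thesis .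
    qed
    have "1 / y\<^sup>2 * ?f (1 / y) = y powr (- (r + 1)) * (sqrt y * theta_tail y + sqrt y / 2 - 1 / 2)"
      unfolding inv[symmetric] using theta_tail_inverse[of y] True by simp
    also have "\<dots> = y powr (- (r + 1 / 2)) * theta_tail y + 1 / 2 * (y powr (- (r + 1 / 2)) - y powr (- (r + 1)))"
      unfolding sq[symmetric] by (simp add: algebra_simps)
    finally have e1: "1 / y\<^sup>2 * ?f (1 / y) = y powr (- (r + 1 / 2)) * theta_tail y + 1 / 2 * (y powr (- (r + 1 / 2)) - y powr (- (r + 1)))" .
    have c1: "y powr (- 3/4) * exp ((2 * r - 1 / 2) * (ln y / 2)) = y powr (r - 1)"
      using True by (simp add: powr_def exp_add[symmetric] algebra_simps) (simp add: field_simps)?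
    have c2: "y powr (- 3/4) * exp (- ((2 * r - 1 / 2) * (ln y / 2))) = y powr (- (r + 1 / 2))"
      using True by (simp add: powr_def exp_add[symmetric] algebra_simps) (simp add: field_simps)?
    have "2 * (theta_tail y * y powr (- 3/4) * cosh ((2 * r - 1 / 2) * (ln y / 2))) =
        theta_tail y * (y powr (- 3/4) * exp ((2 * r - 1 / 2) * (ln y / 2)) + y powr (- 3/4) * exp (- ((2 * r - 1 / 2) * (ln y / 2))))"
      by (simp add: cosh_field_def distrib_left)
    then have e2: "2 * (theta_tail y * y powr (- 3/4) * cosh ((2 * r - 1 / 2) * (ln y / 2))) = theta_tail y * (y powr (r - 1) + y powr (- (r + 1 / 2)))"
      unfolding c1 c2 .
    have ind: "indicator {1<..} y = (1::real)" using True by simp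
    show ?thesis unfolding ind mult_1 e1 e2 by (simp add: algebra_simps)
  qed simp
  have "has_bochner_integral lborel (\<lambda>y. 2 * (indicator {1<..} y * (theta_tail y * y powr (- 3/4) * cosh ((2 * r - 1 / 2) * (ln y / 2)))))
      (A + B - 1 / 2 * (1 / (r + 1 / 2 - 1) - 1 / (r + 1 - 1)))"
    using has_bochner_integral_diff[OF has_bochner_integral_add[OF hA' hB] hP] unfolding pt .
  then have "A + B - 1 / 2 * (1 / (r + 1 / 2 - 1) - 1 / (r + 1 - 1)) = 2 * theta_cosh_integral (2 * r - 1 / 2)"
    unfolding theta_cosh_integral_def by (simp add: has_bochner_integral_iff)
  moreover have "r + 1 / 2 - 1 = r - 1 / 2" "r + 1 - 1 = r" by simp_all
  ultimately show ?thesis unfolding L by simp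
qed

section \<open>The entire functions behind xi\<close>

lemma theta_moment_nonneg: "0 \<le> theta_moment k"
  unfolding theta_moment_def
proof (rule Bochner_Integration.integral_nonneg)
  fix y :: real
  show "0 \<le> indicator {1<..} y * (theta_tail y * y powr (- 3/4) * (ln y / 2) ^ (2 * k))"
    by (cases "1 < y") (auto intro!: mult_nonneg_nonneg theta_tail_nonneg)
qed

text \<open>The cosh series with \<open>- w\<close> in place of \<open>\<sigma>\<^sup>2\<close>, in
  effect a cosine transform at \<open>sqrt w\<close>; as a power series in \<open>w\<close> it
  involves no choice of a root.\<close>

definition theta_series :: "complex \<Rightarrow> complex" where
  "theta_series w = (\<Sum>k. of_real ((-1) ^ k * theta_moment k / fact (2 * k)) * w ^ k)"

lemma norm_theta_series_term:
  fixes w :: complex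
  shows "norm (of_real ((-1) ^ k * theta_moment k / fact (2 * k)) * w ^ k) =
    sqrt (norm w) ^ (2 * k) / fact (2 * k) * theta_moment k"
  by (simp add: norm_mult norm_power norm_divide abs_mult power_abs theta_moment_nonneg power_mult)

lemma abs_le_nat_ceiling: "\<bar>sqrt (norm w)\<bar> \<le> real (nat \<lceil>sqrt (norm w)\<rceil>)"
  by (simp add: of_nat_ceiling)

lemma theta_series_sums:
  "(\<lambda>k. of_real ((-1) ^ k * theta_moment k / fact (2 * k)) * w ^ k) sums theta_series w"
  unfolding theta_series_def
  by (rule summable_sums, rule summable_norm_cancel, unfold norm_theta_series_term,
      rule sums_summable[OF theta_moment_sums[OF abs_le_nat_ceiling]])

text \<open>The moments are nonnegative, so the norms of the terms add up to the cosh integral at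
  \<open>sqrt (norm w)\<close>.\<close>

lemma norm_theta_series_le: "norm (theta_series w) \<le> 3 / 2 * fact (nat \<lceil>sqrt (norm w)\<rceil>)"
proof -
  note s = theta_moment_sums[OF abs_le_nat_ceiling[of w]]
  have "norm (theta_series w) \<le> (\<Sum>k. sqrt (norm w) ^ (2 * k) / fact (2 * k) * theta_moment k)"
    unfolding theta_series_def
    by (rule norm_suminf_le[OF _ sums_summable[OF s]]) (simp only: norm_theta_series_term order.refl)
  also have "\<dots> = theta_cosh_integral (sqrt (norm w))" using s by (rule sums_unique[symmetric])
  also have "\<dots> \<le> 3 / 2 * fact (nat \<lceil>sqrt (norm w)\<rceil>)" by (rule theta_cosh_integral_le[OF abs_le_nat_ceiling])
  finally show ?thesis .
qed

lemma theta_series_of_real: "theta_series (of_real (- (\<sigma>\<^sup>2))) = of_real (theta_cosh_integral \<sigma>)"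
proof -
  have "\<bar>\<sigma>\<bar> \<le> real (nat \<lceil>\<bar>\<sigma>\<bar>\<rceil>)" by (simp add: of_nat_ceiling)
  from sums_of_real[OF theta_moment_sums[OF this], where 'a = complex]
  have "(\<lambda>k. complex_of_real (\<sigma> ^ (2 * k) / fact (2 * k) * theta_moment k)) sums of_real (theta_cosh_integral \<sigma>)" .
  moreover have "complex_of_real (\<sigma> ^ (2 * k) / fact (2 * k) * theta_moment k) =
      of_real ((-1) ^ k * theta_moment k / fact (2 * k)) * (of_real (- (\<sigma>\<^sup>2))) ^ k" for k
  proof -
    have "(- (\<sigma>\<^sup>2)) ^ k = (-1) ^ k * \<sigma> ^ (2 * k)" by (simp add: power_minus[of "\<sigma>\<^sup>2"] power_mult)
    moreover have "(-1) ^ k * ((-1) ^ k * x) = x" for x :: real by (simp add: mult.assoc[symmetric] power_mult_distrib[symmetric])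
    ultimately have "\<sigma> ^ (2 * k) / fact (2 * k) * theta_moment k = ((-1) ^ k * theta_moment k / fact (2 * k)) * (- (\<sigma>\<^sup>2)) ^ k"
      by (simp add: mult.left_commute)
    then show ?thesis by (simp only: of_real_mult of_real_power)
  qed
  ultimately have "(\<lambda>k. of_real ((-1) ^ k * theta_moment k / fact (2 * k)) * (of_real (- (\<sigma>\<^sup>2))) ^ k) sums
      complex_of_real (theta_cosh_integral \<sigma>)" by (simp only:)
  then show ?thesis by (rule sums_unique2[OF theta_series_sums])
qed

text \<open>Writing \<open>\<Xi> s = xi_square (s\<^sup>2)\<close> halves the order of growth.\<close>

definition xi_square :: "complex \<Rightarrow> complex" where
  "xi_square w = 1 / 2 - (w + 1 / 4) * theta_series w"

lemma theta_series_holomorphic: "theta_series holomorphic_on UNIV"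
proof -
  have "theta_series field_differentiable (at z)" for z
  proof -
    have "theta_series holomorphic_on ball 0 (norm z + 1)"
      by (rule power_series_holomorphic[where a = "\<lambda>k. of_real ((-1) ^ k * theta_moment k / fact (2 * k))"])
         (use theta_series_sums in simp)
    then show ?thesis by (rule holomorphic_on_imp_differentiable_at) auto
  qed
  then show ?thesis by (simp add: holomorphic_on_def)
qed

lemma xi_square_holomorphic: "xi_square holomorphic_on UNIV"
  unfolding xi_square_def by (intro holomorphic_intros theta_series_holomorphic)

lemma xi_square_0: "xi_square 0 = of_real (1 / 2 - theta_cosh_integral 0 / 4)"
  using theta_series_of_real[of 0] by (simp add: xi_square_def)

text \<open>The explicit constant enters here: the integral is at most \<open>3 / 2\<close>, and
  \<open>1 / 2 - 3 / 8 > 0\<close>.\<close>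

lemma xi_square_0_pos: "0 < 1 / 2 - theta_cosh_integral 0 / 4"
  using theta_cosh_integral_le[of 0 0] by simp

text \<open>With \<open>m\<close> at most \<open>sqrt (norm w) + 1\<close> and
  \<open>fact m \<le> m ^ m\<close> the logarithm of the bound is of size
  \<open>sqrt (norm w) * ln (norm w)\<close>, which is below every multiple of
  \<open>norm w\<close>.\<close>

lemma xi_square_growth:
  assumes \<epsilon>: "0 < \<epsilon>"
  shows "eventually (\<lambda>w. norm (xi_square w) \<le> exp (\<epsilon> * norm w)) at_infinity"
proof -
  have "eventually (\<lambda>R::real. 1 / 2 + (R + 1 / 4) * (3 / 2 * (sqrt R + 1) powr (sqrt R + 1)) \<le> exp (\<epsilon> * R)) at_top"
    using \<epsilon> by real_asymp
  then obtain B where B: "\<And>R. B \<le> R \<Longrightarrow> 1 / 2 + (R + 1 / 4) * (3 / 2 * (sqrt R + 1) powr (sqrt R + 1)) \<le> exp (\<epsilon> * R)"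
    unfolding eventually_at_top_linorder by blast
  have "norm (xi_square w) \<le> exp (\<epsilon> * norm w)" if "B \<le> norm w" for w
  proof -
    define m where "m = nat \<lceil>sqrt (norm w)\<rceil>"
    have "0 \<le> sqrt (norm w)" by simp
    then have m: "real m \<le> sqrt (norm w) + 1" unfolding m_def by linarith
    have "fact m \<le> real m ^ m" using fact_le_power[of m, where 'a = real] by simp
    also have "\<dots> \<le> (sqrt (norm w) + 1) ^ m" by (rule power_mono[OF m]) simp
    also have "\<dots> = (sqrt (norm w) + 1) powr real m" by (simp add: powr_realpow add_nonneg_pos)
    also have "\<dots> \<le> (sqrt (norm w) + 1) powr (sqrt (norm w) + 1)" by (rule powr_mono[OF m]) simp
    finally have fact: "fact m \<le> (sqrt (norm w) + 1) powr (sqrt (norm w) + 1)" .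
    have "norm (xi_square w) \<le> norm (1 / 2 :: complex) + norm ((w + 1 / 4) * theta_series w)"
      unfolding xi_square_def by (rule norm_triangle_ineq4)
    also have "\<dots> \<le> 1 / 2 + (norm w + 1 / 4) * (3 / 2 * (sqrt (norm w) + 1) powr (sqrt (norm w) + 1))"
    proof -
      have "norm (w + 1 / 4) \<le> norm w + 1 / 4" using norm_triangle_ineq[of w "1 / 4"] by simp
      moreover have "norm (theta_series w) \<le> 3 / 2 * (sqrt (norm w) + 1) powr (sqrt (norm w) + 1)"
        using norm_theta_series_le[of w] fact unfolding m_def by linarith
      ultimately have "norm ((w + 1 / 4) * theta_series w) \<le> (norm w + 1 / 4) * (3 / 2 * (sqrt (norm w) + 1) powr (sqrt (norm w) + 1))"
        unfolding norm_mult by (intro mult_mono) auto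
      then show ?thesis by simp
    qed
    also have "\<dots> \<le> exp (\<epsilon> * norm w)" by (rule B[OF that])
    finally show ?thesis .
  qed
  then show ?thesis unfolding eventually_at_infinity by blast
qed

text \<open>If \<open>s = 1/2 + \<i> * z\<close> then
  \<open>z\<^sup>2 = - ((s - 1/2)\<^sup>2)\<close>. The symmetry under \<open>1 - s\<close> is built
  into this form.\<close>

definition xi_fun :: "complex \<Rightarrow> complex" where
  "xi_fun s = xi_square (- ((s - 1 / 2)\<^sup>2))"

lemma xi_fun_holomorphic: "xi_fun holomorphic_on A"
proof -
  have "(xi_square \<circ> (\<lambda>s. - ((s - 1 / 2)\<^sup>2))) holomorphic_on UNIV"
    by (rule holomorphic_on_compose_gen[OF _ xi_square_holomorphic]) (auto intro!: holomorphic_intros)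
  then show ?thesis unfolding o_def xi_fun_def[symmetric] by (rule holomorphic_on_subset) simp
qed

lemma xi_fun_reflect: "xi_fun (1 - s) = xi_fun s"
proof -
  have "(1 - s - 1 / 2)\<^sup>2 = (s - 1 / 2)\<^sup>2" by (simp add: power2_eq_square algebra_simps)
  then show ?thesis by (simp add: xi_fun_def)
qed

lemma xi_fun_1: "xi_fun 1 = 1 / 2"
  by (simp add: xi_fun_def xi_square_def power2_eq_square)

section \<open>The Dirichlet series and the completed zeta function\<close>

lemma norm_dirichlet_term: "norm (1 / of_nat (Suc n) powr s :: complex) = real (Suc n) powr (- Re s)"
proof -
  have "norm (of_nat (Suc n) powr s :: complex) = real (Suc n) powr Re s"
    using norm_powr_real_powr[of "of_nat (Suc n)" s] by simp
  then show ?thesis by (simp add: norm_divide powr_minus_divide)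
qed

lemma dirichlet_summable:
  fixes s :: complex
  assumes "1 < Re s" shows "summable (\<lambda>n. 1 / of_nat (Suc n) powr s)"
  by (rule summable_norm_cancel) (unfold norm_dirichlet_term, rule summable_powr_neg[OF assms])

definition dirichlet_zeta :: "complex \<Rightarrow> complex" where
  "dirichlet_zeta s = (\<Sum>n. 1 / of_nat (Suc n) powr s)"

lemma dirichlet_zeta_holomorphic: "dirichlet_zeta holomorphic_on {s. 1 < Re s}"
proof (rule holomorphic_uniform_sequence[where f = "\<lambda>N s. \<Sum>n<N. 1 / of_nat (Suc n) powr s"])
  show "open {s. 1 < Re s}" by (rule open_halfspace_Re_gt)
  show "(\<lambda>s. \<Sum>n<N. 1 / of_nat (Suc n) powr s :: complex) holomorphic_on {s. 1 < Re s}" for N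
    by (intro holomorphic_intros) (auto simp del: of_nat_Suc)
  fix z :: complex assume z: "z \<in> {s. 1 < Re s}"
  define d where "d = (Re z - 1) / 2"
  have d: "0 < d" using z by (simp add: d_def)
  have ge: "1 + d \<le> Re s" if "s \<in> cball z d" for s
    using that abs_Re_le_cmod[of "z - s"] by (simp add: dist_norm d_def abs_le_iff field_simps)
  have "uniform_limit (cball z d) (\<lambda>N s. \<Sum>n<N. 1 / of_nat (Suc n) powr s) dirichlet_zeta sequentially"
    unfolding dirichlet_zeta_def[abs_def]
  proof (rule Weierstrass_m_test)
    show "summable (\<lambda>n. real (Suc n) powr (- (1 + d)))" using d by (intro summable_powr_neg) simp
    show "norm (1 / of_nat (Suc n) powr s :: complex) \<le> real (Suc n) powr (- (1 + d))" if "s \<in> cball z d" for n s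
      unfolding norm_dirichlet_term using ge[OF that] by (intro powr_mono) auto
  qed
  moreover have "cball z d \<subseteq> {s. 1 < Re s}" using ge d by force
  ultimately show "\<exists>d>0. cball z d \<subseteq> {s. 1 < Re s} \<and>
      uniform_limit (cball z d) (\<lambda>N s. \<Sum>n<N. 1 / of_nat (Suc n) powr s) dirichlet_zeta sequentially"
    using d by blast
qed

lemma Re_pos_not_nonpos_Int: "0 < Re z \<Longrightarrow> z \<notin> \<int>\<^sub>\<le>\<^sub>0" for z :: complex
  by (auto elim!: nonpos_Ints_cases)

definition completed_zeta :: "complex \<Rightarrow> complex" where
  "completed_zeta s = 1 / 2 * s * (s - 1) * of_real pi powr (- (s / 2)) * Gamma (s / 2) * dirichlet_zeta s"

lemma completed_zeta_of_real:
  assumes r: "1 / 2 < r"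
  shows "completed_zeta (of_real (2 * r)) = xi_fun (of_real (2 * r))"
proof -
  let ?T = "theta_cosh_integral (2 * r - 1 / 2)"
  have "1 / of_nat (Suc n) powr complex_of_real (2 * r) = of_real (real (Suc n) powr (- (2 * r)))" for n
  proof -
    have "of_nat (Suc n) powr complex_of_real (2 * r) = of_real (real (Suc n) powr (2 * r))"
      using powr_of_real[of "real (Suc n)" "2 * r"] by simp
    then show ?thesis by (simp add: powr_minus_divide)
  qed
  then have D: "dirichlet_zeta (of_real (2 * r)) = of_real (\<Sum>n. real (Suc n) powr (- (2 * r)))"
    unfolding dirichlet_zeta_def using summable_powr_neg[of "2 * r"] r by (simp only:) (rule suminf_of_real[symmetric], simp)
  have P: "complex_of_real pi powr (- (of_real (2 * r) / 2)) = of_real (pi powr (- r))"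
    using powr_of_real[of pi "- r"] by simp
  have G: "Gamma (complex_of_real (2 * r) / 2) = of_real (Gamma r)"
    using Gamma_complex_of_real[of r] by simp
  have "completed_zeta (of_real (2 * r)) = of_real (1 / 2 * (2 * r) * (2 * r - 1) *
      (Gamma r * pi powr (- r) * (\<Sum>n. real (Suc n) powr (- (2 * r)))))"
    unfolding completed_zeta_def D P G by (simp add: mult_ac)
  \<comment> \<open>The rational summands equal \<open>1 / (2 * r * (2 * r - 1))\<close>, so the
    prefactor turns them into \<open>1 / 2\<close>.\<close>
  also have "1 / 2 * (2 * r) * (2 * r - 1) * (Gamma r * pi powr (- r) * (\<Sum>n. real (Suc n) powr (- (2 * r)))) =
      1 / 2 + (2 * r) * (2 * r - 1) * ?T"
    unfolding completed_zeta_real[OF r] using r by (simp add: field_simps)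
  \<comment> \<open>With \<open>s = 2 * r\<close> this is
    \<open>s * (s - 1) = (s - 1/2)\<^sup>2 - 1/4\<close>, the origin of \<open>w + 1 / 4\<close> in
    \<open>xi_square\<close>.\<close>
  also have "(2 * r) * (2 * r - 1) = (2 * r - 1 / 2)\<^sup>2 - 1 / 4" by (simp add: power2_eq_square algebra_simps)
  also have "complex_of_real (1 / 2 + ((2 * r - 1 / 2)\<^sup>2 - 1 / 4) * ?T) = xi_square (of_real (- ((2 * r - 1 / 2)\<^sup>2)))"
    unfolding xi_square_def theta_series_of_real by (simp add: algebra_simps)
  also have "\<dots> = xi_fun (of_real (2 * r))" by (simp add: xi_fun_def)
  finally show ?thesis .
qed

text \<open>Identity theorem: both sides are holomorphic on the half-plane and agree on the real
  half-line, which accumulates at 2.\<close>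

lemma completed_zeta_eq:
  assumes s: "1 < Re s"
  shows "completed_zeta s = xi_fun s"
proof -
  let ?S = "{s. 1 < Re s}"
  have "completed_zeta holomorphic_on ?S"
    unfolding completed_zeta_def
    by (intro holomorphic_intros dirichlet_zeta_holomorphic Re_pos_not_nonpos_Int) (auto simp: complex_nonpos_Reals_iff)
  then have hol: "(\<lambda>s. completed_zeta s - xi_fun s) holomorphic_on ?S" by (intro holomorphic_intros xi_fun_holomorphic)
  have lim: "(2::complex) islimpt (of_real ` {1<..})"
    unfolding islimpt_approachable
  proof (intro allI impI)
    fix e :: real assume "0 < e"
    show "\<exists>x'\<in>of_real ` {1<..}. x' \<noteq> (2::complex) \<and> dist x' 2 < e"
    proof (rule bexI)
      show "of_real (2 + e / 2) \<in> complex_of_real ` {1<..}" using \<open>0 < e\<close> by (intro imageI) simp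
      show "of_real (2 + e / 2) \<noteq> (2::complex) \<and> dist (complex_of_real (2 + e / 2)) 2 < e"
        using \<open>0 < e\<close> by (simp add: dist_norm norm_divide)
    qed
  qed
  have "completed_zeta s - xi_fun s = 0"
  proof (rule analytic_continuation[OF hol _ _ _ _ lim])
    fix z assume "z \<in> complex_of_real ` {1<..}"
    then obtain x where "z = of_real x" "1 < x" by auto
    then show "completed_zeta z - xi_fun z = 0" using completed_zeta_of_real[of "x / 2"] by simp
  qed (use s in \<open>auto simp: open_halfspace_Re_gt convex_halfspace_Re_gt convex_connected\<close>)
  then show ?thesis by simp
qed

section \<open>The Riemann hypothesis\<close>

lemma nicely_meromorphic_unique:
  assumes f: "f nicely_meromorphic_on UNIV" and g: "g nicely_meromorphic_on UNIV"
    and S: "open S" "S \<noteq> {}" and eq: "\<And>s. s \<in> S \<Longrightarrow> f s = g s"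
  shows "f = g"
proof -
  have fm: "f meromorphic_on UNIV" and gm: "g meromorphic_on UNIV"
    using f g by (auto simp: nicely_meromorphic_on_def)
  then have dm: "(\<lambda>s. f s - g s) meromorphic_on UNIV" by (intro meromorphic_intros)
  \<comment> \<open>Removing singularities makes the difference nicely meromorphic, so vanishing on
    \<open>S\<close> forces it to be constant.\<close>
  define d where "d = remove_sings (\<lambda>s. f s - g s)"
  have d: "d nicely_meromorphic_on UNIV" unfolding d_def by (rule remove_sings_nicely_meromorphic[OF dm])
  have "d s = 0" if "s \<in> S" for s
    unfolding d_def
  proof (rule remove_sings_eqI)
    have "eventually (\<lambda>x. x \<in> S) (at s)" using S that by (intro eventually_at_in_open') auto
    then have "eventually (\<lambda>x. f x - g x = 0) (at s)" by eventually_elim (simp add: eq)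
    then show "(\<lambda>x. f x - g x) \<midarrow>s\<rightarrow> 0" by (rule tendsto_eventually)
  qed
  then have dS: "d constant_on S" by (auto simp: constant_on_def)
  have "d constant_on UNIV"
    by (rule constant_on_extend_nicely_meromorphic_on[OF d dS]) (use S in auto)
  moreover obtain s where "s \<in> S" using S by blast
  moreover from this have "d s = 0" by fact
  ultimately have d0: "d x = 0" for x unfolding constant_on_def by auto
  show ?thesis
  proof
    fix z
    have "eventually (\<lambda>x. d x = f x - g x) (at z)"
      unfolding d_def
      by (rule eventually_remove_sings_eq_at, rule meromorphic_on_isolated_singularity,
          rule meromorphic_on_subset[OF dm]) simp
    then have ev: "eventually (\<lambda>x. f x = g x) (at z)" by eventually_elim (simp add: d0)
    have pole: "is_pole f z \<longleftrightarrow> is_pole g z" by (rule is_pole_cong[OF ev refl])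
    \<comment> \<open>Around \<open>z\<close> the functions agree, except perhaps at
      \<open>z\<close> itself. The value there is 0 at a pole and a limit otherwise, so the nearby
      values determine it.\<close>
    have f': "is_pole f z \<and> f z = 0 \<or> f \<midarrow>z\<rightarrow> f z" and g': "is_pole g z \<and> g z = 0 \<or> g \<midarrow>z\<rightarrow> g z"
      using f g by (auto simp: nicely_meromorphic_on_def)
    show "f z = g z"
    proof (cases "is_pole f z")
      case True
      then have "\<not> f \<midarrow>z\<rightarrow> f z" "\<not> g \<midarrow>z\<rightarrow> g z"
        using pole not_tendsto_and_filterlim_at_infinity[OF at_neq_bot] unfolding is_pole_def by blast+
      then show ?thesis using f' g' by simp
    next
      case False
      then have "f \<midarrow>z\<rightarrow> f z" "g \<midarrow>z\<rightarrow> g z" using f' g' pole by auto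
      then have "f \<midarrow>z\<rightarrow> f z" "f \<midarrow>z\<rightarrow> g z" using tendsto_cong[OF ev] by auto
      then show ?thesis by (rule tendsto_unique[OF at_neq_bot])
    qed
  qed
qed

text \<open>The definition of xi solved for zeta. As
  \<open>s / 2 * Gamma (s / 2) = Gamma (s / 2 + 1)\<close> has an entire reciprocal, the only
  possible pole is at 1; there division by zero returns 0, just the value of a nicely meromorphic
  function at a pole.\<close>

definition zeta_cont :: "complex \<Rightarrow> complex" where
  "zeta_cont s = of_real pi powr (s / 2) * rGamma (s / 2 + 1) * xi_fun s / (s - 1)"

lemma powr_pi_cancel: "of_real pi powr (- z) * of_real pi powr z = (1 :: complex)"
  by (simp add: powr_add[symmetric])

text \<open>The pole at 1 is genuine because \<open>xi_fun 1 = 1 / 2\<close> and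
  \<open>rGamma (3 / 2)\<close> is nonzero.\<close>

lemma zeta_cont_nicely_meromorphic: "zeta_cont nicely_meromorphic_on UNIV"
proof -
  define h where "h = (\<lambda>s. of_real pi powr (s / 2) * rGamma (s / 2 + 1) * xi_fun s)"
  have h: "h holomorphic_on A" for A
    unfolding h_def by (intro holomorphic_intros xi_fun_holomorphic) (auto simp: complex_nonpos_Reals_iff)
  have eq: "zeta_cont = (\<lambda>s. h s / (s - 1))" by (simp add: fun_eq_iff zeta_cont_def h_def)
  have hol: "zeta_cont holomorphic_on UNIV - {1}"
    unfolding eq by (intro holomorphic_on_divide h holomorphic_intros) auto
  have "h 1 \<noteq> 0"
  proof -
    have "(1 / 2 + 1 :: complex) \<notin> \<int>\<^sub>\<le>\<^sub>0" by (rule Re_pos_not_nonpos_Int) simp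
    then show ?thesis by (simp add: h_def xi_fun_1 rGamma_eq_zero_iff)
  qed
  then have "is_pole (\<lambda>s. h s / (s - 1) ^ 1) 1"
    by (intro is_pole_basic[OF h[of UNIV]]) auto
  then have pole: "is_pole zeta_cont 1" unfolding eq by simp
  show ?thesis
  proof (rule nicely_meromorphic_onI_open[where pts = "{1}"])
    show "zeta_cont analytic_on UNIV - {1}" using hol by (subst analytic_on_open) auto
    show "is_pole zeta_cont x \<and> zeta_cont x = 0" if "x \<in> {1}" for x
      using that pole by (simp add: zeta_cont_def)
    show "isolated_singularity_at zeta_cont x" for x
    proof (rule isolated_singularity_at_holomorphic[of _ "if x = 1 then UNIV else UNIV - {1}"])
      show "zeta_cont holomorphic_on (if x = 1 then UNIV else UNIV - {1}) - {x}"
        using hol by (auto elim: holomorphic_on_subset)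
    qed auto
  qed simp
qed

lemma Gamma_shift_cancel:
  fixes s :: complex
  assumes "0 < Re s"
  shows "s / 2 * Gamma (s / 2) * rGamma (s / 2 + 1) = 1"
proof -
  have "Gamma (s / 2 + 1) = s / 2 * Gamma (s / 2)"
    by (rule Gamma_plus1, rule Re_pos_not_nonpos_Int) (use assms in simp)
  moreover have "s / 2 + 1 \<notin> \<int>\<^sub>\<le>\<^sub>0" by (rule Re_pos_not_nonpos_Int) (use assms in simp)
  then have "Gamma (s / 2 + 1) * rGamma (s / 2 + 1) = 1"
    by (simp add: rGamma_inverse_Gamma Gamma_eq_zero_iff)
  ultimately show ?thesis by (simp only:)
qed

lemma zeta_cont_eq_dirichlet:
  assumes s: "1 < Re s"
  shows "zeta_cont s = dirichlet_zeta s"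
proof -
  have g: "s / 2 * Gamma (s / 2) * rGamma (s / 2 + 1) = 1"
    by (rule Gamma_shift_cancel) (use s in simp)
  have "s \<noteq> 1" using s by auto
  have "zeta_cont s = of_real pi powr (s / 2) * rGamma (s / 2 + 1) *
      (1 / 2 * s * (s - 1) * of_real pi powr (- (s / 2)) * Gamma (s / 2) * dirichlet_zeta s) / (s - 1)"
    unfolding zeta_cont_def completed_zeta_eq[OF s, symmetric] completed_zeta_def ..
  also have "\<dots> = (of_real pi powr (- (s / 2)) * of_real pi powr (s / 2)) *
      (s / 2 * Gamma (s / 2) * rGamma (s / 2 + 1)) * dirichlet_zeta s"
  proof -
    have "a * b * (1 / 2 * s * (s - 1) * p * g * d) / (s - 1) = (p * a) * (s / 2 * g * b) * d" for a b p g d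
      using \<open>s \<noteq> 1\<close> by (simp add: divide_simps)
    then show ?thesis .
  qed
  finally show ?thesis unfolding g powr_pi_cancel by simp
qed

lemma zeta_eq: "zeta = zeta_cont"
proof -
  have sums: "(\<lambda>n. 1 / of_nat (Suc n) powr s) sums zeta_cont s" if "1 < Re s" for s
    unfolding zeta_cont_eq_dirichlet[OF that] dirichlet_zeta_def
    by (rule summable_sums[OF dirichlet_summable[OF that]])
  show ?thesis
    unfolding zeta_def
  proof (rule the_equality)
    show "zeta_cont nicely_meromorphic_on UNIV \<and> (\<forall>s. Re s > 1 \<longrightarrow> (\<lambda>n. 1 / of_nat (Suc n) powr s) sums zeta_cont s)"
      using zeta_cont_nicely_meromorphic sums by blast
  next
    fix f assume f: "f nicely_meromorphic_on UNIV \<and> (\<forall>s. Re s > 1 \<longrightarrow> (\<lambda>n. 1 / of_nat (Suc n) powr s) sums f s)"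
    show "f = zeta_cont"
    proof (rule nicely_meromorphic_unique[where S = "{s. Re s > 1}"])
      show "f s = zeta_cont s" if "s \<in> {s. Re s > 1}" for s
        using f sums[of s] that by (auto intro: sums_unique2)
      show "{s. Re s > 1} \<noteq> {}" by (auto intro: exI[of _ 2])
    qed (use f zeta_cont_nicely_meromorphic in \<open>auto simp: open_halfspace_Re_gt\<close>)
  qed
qed

text \<open>Both sides are nicely meromorphic, so agreement for \<open>Re s > 1\<close> is enough;
  the removable singularities are settled by uniqueness and not one by one.\<close>

lemma xi_eq: "xi = xi_fun"
proof -
  define P where "P = (\<lambda>s. 1/2 * s * (s - 1) * of_real pi powr (- (s / 2)) * Gamma (s / 2) * zeta s)"
  have "zeta meromorphic_on UNIV"
    using zeta_cont_nicely_meromorphic unfolding zeta_eq by (simp add: nicely_meromorphic_on_def)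
  moreover have "(\<lambda>s. of_real pi powr (- (s / 2)) :: complex) meromorphic_on UNIV"
    by (intro analytic_on_imp_meromorphic_on analytic_intros) (auto simp: complex_nonpos_Reals_iff pi_gt_zero[THEN not_le[THEN iffD2]])
  moreover have "(\<lambda>s. Gamma (s / 2) :: complex) meromorphic_on UNIV"
  proof -
    have "(\<lambda>s. rGamma (s / 2) :: complex) meromorphic_on UNIV"
      by (intro analytic_on_imp_meromorphic_on) (auto simp: analytic_on_open intro!: holomorphic_intros)
    then have "(\<lambda>s. inverse (rGamma (s / 2)) :: complex) meromorphic_on UNIV" by (intro meromorphic_intros)
    then show ?thesis by (simp add: Gamma_def)
  qed
  ultimately have "P meromorphic_on UNIV"
    unfolding P_def by (intro meromorphic_intros)
  then have "remove_sings P nicely_meromorphic_on UNIV" by (rule remove_sings_nicely_meromorphic)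
  moreover have "xi_fun nicely_meromorphic_on UNIV"
    using xi_fun_holomorphic by (intro analytic_on_imp_nicely_meromorphic_on) (auto simp: analytic_on_open)
  moreover have "remove_sings P s = xi_fun s" if s: "1 < Re s" for s
  proof (rule remove_sings_eqI)
    have "isCont xi_fun s"
      using holomorphic_on_imp_continuous_on[OF xi_fun_holomorphic[of UNIV]] continuous_on_eq_continuous_at[OF open_UNIV] by blast
    then have "xi_fun \<midarrow>s\<rightarrow> xi_fun s" by (simp add: isCont_def)
    moreover have "eventually (\<lambda>x. x \<in> {x. 1 < Re x}) (at s)"
      using s by (intro eventually_at_in_open') (auto simp: open_halfspace_Re_gt)
    then have "eventually (\<lambda>x. xi_fun x = P x) (at s)"
    proof eventually_elim
      case (elim x)
      then show ?case
        using completed_zeta_eq[of x] by (simp add: P_def completed_zeta_def zeta_eq zeta_cont_eq_dirichlet)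
    qed
    ultimately show "P \<midarrow>s\<rightarrow> xi_fun s" by (rule Lim_transform_eventually)
  qed
  moreover have "{s. 1 < Re s} \<noteq> {}" by (auto intro: exI[of _ 2])
  ultimately have "remove_sings P = xi_fun"
    by (intro nicely_meromorphic_unique[where S = "{s. 1 < Re s}"]) (auto simp: open_halfspace_Re_gt)
  then show ?thesis unfolding xi_def P_def .
qed

lemma Xi_eq: "Xi s = xi_square (s\<^sup>2)"
  by (simp add: Xi_def xi_eq xi_fun_def power_mult_distrib)

lemma Xi_holomorphic: "Xi holomorphic_on UNIV"
proof -
  have "(xi_square \<circ> (\<lambda>s. s\<^sup>2)) holomorphic_on UNIV"
    by (rule holomorphic_on_compose_gen[OF _ xi_square_holomorphic]) (auto intro!: holomorphic_intros)
  then show ?thesis by (simp add: o_def Xi_eq[abs_def])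
qed

section \<open>Zeros of zeta and of xi\<close>

lemma rGamma_zero_iff: "rGamma (s / 2 + 1) = 0 \<longleftrightarrow> (\<exists>n::nat. n \<ge> 1 \<and> s = - (2 * of_nat n))" for s :: complex
proof
  assume "rGamma (s / 2 + 1) = 0"
  then obtain m :: nat where "s / 2 + 1 = - of_nat m"
    by (auto simp: rGamma_eq_zero_iff elim!: nonpos_Ints_cases')
  moreover have "s = 2 * (s / 2 + 1) - 2" by simp
  ultimately have "s = 2 * (- of_nat m) - 2" by simp
  then have "s = - (2 * of_nat (Suc m))" by simp
  then show "\<exists>n::nat. n \<ge> 1 \<and> s = - (2 * of_nat n)" by (intro exI[of _ "Suc m"]) simp
next
  assume "\<exists>n::nat. n \<ge> 1 \<and> s = - (2 * of_nat n)"
  then obtain n :: nat where n: "n \<ge> 1" "s = - (2 * of_nat n)" by blast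
  then have "s / 2 + 1 = - of_nat (n - 1)" by (simp add: of_nat_diff)
  then show "rGamma (s / 2 + 1) = 0" by (simp add: rGamma_eq_zero_iff)
qed

lemma dirichlet_zeta_nonzero:
  assumes x: "1 < x" shows "dirichlet_zeta (of_real x) \<noteq> 0"
proof -
  have "1 / of_nat (Suc n) powr complex_of_real x = of_real (real (Suc n) powr (- x))" for n
  proof -
    have "of_nat (Suc n) powr complex_of_real x = of_real (real (Suc n) powr x)"
      using powr_of_real[of "real (Suc n)" x] by simp
    then show ?thesis by (simp add: powr_minus_divide)
  qed
  then have D: "dirichlet_zeta (of_real x) = of_real (\<Sum>n. real (Suc n) powr (- x))"
    unfolding dirichlet_zeta_def using summable_powr_neg[of "x"] x by (simp only:) (rule suminf_of_real[symmetric], simp)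
  have "0 < (\<Sum>n. real (Suc n) powr (- x))" by (rule suminf_pos[OF summable_powr_neg[OF x]]) simp
  then show ?thesis unfolding D by simp
qed

text \<open>Reflection maps \<open>- 2 * n\<close> to \<open>1 + 2 * n\<close>, where the Dirichlet
  series has positive terms for \<open>n > 0\<close>; for \<open>n = 0\<close> it maps to 1, where
  xi is \<open>1 / 2\<close>.\<close>

lemma xi_fun_nonzero_trivial: "xi_fun (- (2 * of_nat n)) \<noteq> 0"
proof (cases "n = 0")
  case True
  then show ?thesis using xi_fun_reflect[of 1] xi_fun_1 by auto
next
  case False
  let ?s = "complex_of_real (1 + 2 * real n)"
  have "zeta_cont ?s \<noteq> 0"
    using dirichlet_zeta_nonzero[of "1 + 2 * real n"] zeta_cont_eq_dirichlet[of ?s] False by simp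
  then have "xi_fun ?s \<noteq> 0" by (auto simp: zeta_cont_def)
  moreover have "xi_fun (- (2 * of_nat n)) = xi_fun ?s" using xi_fun_reflect[of "- (2 * of_nat n)"] by simp
  ultimately show ?thesis by simp
qed

text \<open>The factor \<open>rGamma (s / 2 + 1)\<close> of zeta vanishes exactly at the trivial
  zeros, and xi vanishes neither there nor at 1.\<close>

lemma nontrivial_zeta_zero_iff: "nontrivial_zeta_zero s \<longleftrightarrow> xi_fun s = 0"
proof -
  have "nontrivial_zeta_zero s \<longleftrightarrow> s \<noteq> 1 \<and> xi_fun s = 0 \<and> rGamma (s / 2 + 1) \<noteq> 0"
    unfolding nontrivial_zeta_zero_def zeta_eq zeta_cont_def by (auto simp: rGamma_zero_iff)
  moreover have "rGamma (s / 2 + 1) \<noteq> 0" if "xi_fun s = 0"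
    unfolding rGamma_zero_iff using that xi_fun_nonzero_trivial by auto
  moreover have "s \<noteq> 1" if "xi_fun s = 0" using that xi_fun_1 by auto
  ultimately show ?thesis by blast
qed

lemma riemann_hypothesis_iff: "riemann_hypothesis \<longleftrightarrow> (\<forall>s. Xi s = 0 \<longrightarrow> Im s = 0)"
proof
  assume RH: riemann_hypothesis
  show "\<forall>s. Xi s = 0 \<longrightarrow> Im s = 0"
  proof (intro allI impI)
    fix s assume "Xi s = 0"
    then have "Re (1 / 2 + \<i> * s) = 1 / 2"
      using RH unfolding riemann_hypothesis_def nontrivial_zeta_zero_iff Xi_def xi_eq by blast
    then show "Im s = 0" by simp
  qed
next
  assume *: "\<forall>s. Xi s = 0 \<longrightarrow> Im s = 0"
  show riemann_hypothesis
    unfolding riemann_hypothesis_def nontrivial_zeta_zero_iff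
  proof (intro allI impI)
    fix s assume "xi_fun s = 0"
    moreover have "1 / 2 + \<i> * (- \<i> * (s - 1 / 2)) = s" by (simp add: algebra_simps)
    ultimately have "Xi (- \<i> * (s - 1 / 2)) = 0" unfolding Xi_def xi_eq by (simp only:)
    then have "Im (- \<i> * (s - 1 / 2)) = 0" using * by blast
    then show "Re s = 1 / 2" by simp
  qed
qed

text \<open>A point with real part \<open>1/2\<close> is neither 1 nor a trivial zero, so the zeros
  of zeta on the line are zeros of xi.\<close>

lemma zeta_critical_line_iff: "zeta (1 / 2 + \<i> * of_real t) = 0 \<longleftrightarrow> Xi (of_real t) = 0"
proof -
  let ?s = "1 / 2 + \<i> * complex_of_real t"
  have "Re ?s \<noteq> Re 1" by simp
  then have "?s \<noteq> 1" by metis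
  moreover have "?s \<noteq> - (2 * of_nat n)" for n
  proof
    assume "?s = - (2 * of_nat n)"
    then have "Re ?s = Re (- (2 * of_nat n))" by (rule arg_cong)
    then show False using of_nat_0_le_iff[of n, where 'a = real] by simp
  qed
  ultimately have "zeta ?s = 0 \<longleftrightarrow> nontrivial_zeta_zero ?s" by (simp add: nontrivial_zeta_zero_def)
  then show ?thesis unfolding nontrivial_zeta_zero_iff Xi_def xi_eq .
qed

theorem theorem3:
  fixes t\<^sub>0 :: real
  assumes "first_critical_zero t\<^sub>0"
  shows "riemann_hypothesis \<longleftrightarrow>
    (\<exists>\<Lambda>. polya_frequency_function \<Lambda> \<and>
       (\<forall>s::complex. \<bar>Re s\<bar> < t\<^sub>0 \<longrightarrow>
          Xi s \<noteq> 0 \<and>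
          has_bochner_integral lebesgue
            (\<lambda>x::real. of_real (\<Lambda> x) * exp (- (s * of_real x))) (1 / Xi s)))"
    (is "_ \<longleftrightarrow> ?R")
proof -
  have t0: "0 < t\<^sub>0" "Xi (of_real t\<^sub>0) = 0" "\<And>t. 0 < t \<Longrightarrow> t < t\<^sub>0 \<Longrightarrow> Xi (of_real t) \<noteq> 0"
    using assms by (auto simp: first_critical_zero_def zeta_critical_line_iff)
  show ?thesis
  proof
    assume RH: riemann_hypothesis
    have xi0: "xi_square 0 \<noteq> 0" unfolding xi_square_0 of_real_eq_0_iff using xi_square_0_pos by linarith
    \<comment> \<open>A zero \<open>w\<close> is the square of a zero of \<open>Xi\<close>, which
      under the hypothesis is a real number \<open>u\<close>. As \<open>Xi\<close> is even,
      \<open>\<bar>u\<bar>\<close> is also a zero, and it is at least \<open>t\<^sub>0\<close> by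
      minimality.\<close>
    have zeros: "w \<in> \<real> \<and> t\<^sub>0\<^sup>2 \<le> Re w" if w: "xi_square w = 0" for w
    proof -
      have "Xi (csqrt w) = 0" using w by (simp add: Xi_eq)
      then have "Im (csqrt w) = 0" using RH unfolding riemann_hypothesis_iff by blast
      then have cs: "csqrt w = of_real (Re (csqrt w))" by (simp add: complex_eq_iff)
      define u where "u = Re (csqrt w)"
      have "w = (csqrt w)\<^sup>2" by simp
      then have wu: "w = of_real (u\<^sup>2)" unfolding u_def by (subst (asm) cs) simp
      have "u \<noteq> 0" using w wu xi0 by auto
      moreover have "(complex_of_real \<bar>u\<bar>)\<^sup>2 = w" unfolding wu by (simp flip: of_real_power)
      then have "Xi (of_real \<bar>u\<bar>) = 0" using w by (simp add: Xi_eq)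
      ultimately have "t\<^sub>0 \<le> \<bar>u\<bar>" using t0(3)[of "\<bar>u\<bar>"] by force
      then have "t\<^sub>0\<^sup>2 \<le> \<bar>u\<bar>\<^sup>2" using t0(1) by (intro power_mono) auto
      then show ?thesis using wu by simp
    qed
    obtain \<Lambda> where \<Lambda>: "polya_frequency_function \<Lambda>"
        "\<And>s. \<bar>Re s\<bar> < t\<^sub>0 \<Longrightarrow> has_bochner_integral lebesgue (\<lambda>x. of_real (\<Lambda> x) * exp (- (s * of_real x))) (1 / xi_square (s\<^sup>2))"
    proof (rule polya_frequency_function_of_real_zeros[OF xi_square_holomorphic xi_square_0 xi_square_0_pos xi_square_growth zeros t0(1)])
      show "xi_square (of_real (t\<^sub>0\<^sup>2)) = 0" using t0(2) by (simp add: Xi_eq)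
    qed blast+
    \<comment> \<open>Shown on its own because \<open>1 / 0 = 0\<close> would give the integral
      formula a meaning even at a zero of \<open>Xi\<close>.\<close>
    have "Xi s \<noteq> 0" if s: "\<bar>Re s\<bar> < t\<^sub>0" for s
    proof
      assume X: "Xi s = 0"
      then have "Im s = 0" using RH unfolding riemann_hypothesis_iff by blast
      then have "s\<^sup>2 = of_real ((Re s)\<^sup>2)" by (simp add: complex_eq_iff power2_eq_square)
      then have "t\<^sub>0\<^sup>2 \<le> (Re s)\<^sup>2" using zeros[of "s\<^sup>2"] X by (simp add: Xi_eq)
      then show False using s t0(1) by (metis abs_le_square_iff abs_of_pos not_le)
    qed
    then show ?R using \<Lambda> unfolding Xi_eq by blast
  next
    assume ?R
    then obtain \<Lambda> where \<Lambda>: "polya_frequency_function \<Lambda>" "\<And>s. \<bar>Re s\<bar> < t\<^sub>0 \<Longrightarrow> Xi s \<noteq> 0"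
        "\<And>s. \<bar>Re s\<bar> < t\<^sub>0 \<Longrightarrow> has_bochner_integral lebesgue (\<lambda>x. of_real (\<Lambda> x) * exp (- (s * of_real x))) (1 / Xi s)"
      by blast
    show riemann_hypothesis
      unfolding riemann_hypothesis_iff
      using laplace_reciprocal_real_zeros[OF \<Lambda>(1) t0(1) Xi_holomorphic \<Lambda>(2,3)] by blast
  qed
qed

end
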